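(* Let $m\ge3$ be an integer and $0<\alpha<1$. Define $\omega_0(r,\theta)=-(r+\theta)^{-\alpha}$ for $r\ge0$ and $0\le\theta\le\frac{\pi}{m}$ (with $(r,\theta)\ne(0,0)$), and extend $\omega_0$ first by oddness to $-\frac{\pi}{m}\le\theta\le0$ and then by $m$-fold symmetry to $\theta\in\mathbb S$. Then the unique solution $\omega\in C([0,T_* ),\mathcal C^\omega_{-\alpha})$ of the 2d Euler equation $$\partial_t\omega+u\cdot\nabla\omega=0,\qquad u=\nabla^\perp\psi,\qquad\Delta\psi=\omega,$$ with $\omega(0,\cdot)=\omega_0$ has a finite maximal time of existence forward in time, i.e. $T_*<+\infty$.
   Context: Polar coordinates $(r,\theta)$ on $\mathbb R^2$ are used; $\nabla^\perp=(-\partial_y,\partial_x)$. All vorticities are odd in $\theta$ and $m$-fold symmetric (i.e. $\frac{2\pi}{m}$-periodic in $\theta$), hence determined by their values on the sector $r\ge0$, $0\le\theta\le\frac{\pi}{m}$. For $\lambda>0$, $$\|f\|_{C^\omega_{-\alpha,\lambda}}=\sum_{k=0}^{+\infty}\frac{\lambda^k}{k!}\Big(\|(r+\theta)^{k+\alpha}\partial_r^kf\|_{L^\infty(\mathbb R_+\times(0,\frac{\pi}{m}))}+\|(r+\theta)^{k+\alpha}\partial_\theta^kf\|_{L^\infty(\mathbb R_+\times(0,\frac{\pi}{m}))}\Big),$$ and $\mathcal C^\omega_{-\alpha}$ is the space of odd, $m$-fold symmetric functions with $\|f\|_{C^\omega_{-\alpha,\lambda}}<\infty$ for some $\lambda>0$.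 Membership in $C([0,T),\mathcal C^\omega_{-\alpha})$ means that for every $T'<T$ there is $\lambda>0$ such that $\omega$ is continuous from $[0,T']$ into the space with norm $\|\cdot\|_{C^\omega_{-\alpha,\lambda}}$. The stream function $\psi$ is the unique odd, $m$-fold symmetric solution of $\Delta\psi=\omega$ with $\sup_{x\neq0}|\psi(x)|/|x|^2<\infty$. The transport equation, in polar coordinates $\partial_t\omega+u^r\partial_r\omega+\frac{u^\theta}{r}\partial_\theta\omega=0$, is understood in the open sector $r>0$, $0<\theta<\frac{\pi}{m}$ (and extended by symmetry). For data in $\mathcal C^\omega_{-\alpha}$ a unique local-in-time solution exists in this class; the maximal time of existence $T_*$ is the supremum of the $T>0$ such that a solution in $C([0,T),\mathcal C^\omega_{-\alpha})$ exists. *)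

theory Defs
  imports "HOL-Analysis.Analysis"
begin

text \<open>The plane is identified with the complex numbers, so that the point with polar coordinates
  \<open>(r, \<theta>)\<close> is \<open>rcis r \<theta>\<close>.\<close>

definition odd_mfold :: "nat \<Rightarrow> (complex \<Rightarrow> real) \<Rightarrow> bool" where
  "odd_mfold m f \<longleftrightarrow>
     (\<forall>z. f (cnj z) = - f z) \<and> (\<forall>z. f (cis (2 * pi / real m) * z) = f z)"

definition sector :: "nat \<Rightarrow> (real \<times> real) set" where
  "sector m = {0<..} \<times> {0<..<pi / real m}"

definition dr :: "nat \<Rightarrow> (complex \<Rightarrow> real) \<Rightarrow> real \<Rightarrow> real \<Rightarrow> real" where
  "dr k f r \<theta> = (deriv ^^ k) (\<lambda>\<rho>. f (rcis \<rho> \<theta>)) r"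

definition dtheta :: "nat \<Rightarrow> (complex \<Rightarrow> real) \<Rightarrow> real \<Rightarrow> real \<Rightarrow> real" where
  "dtheta k f r \<theta> = (deriv ^^ k) (\<lambda>\<phi>. f (rcis r \<phi>)) \<theta>"

text \<open>All the derivatives entering the norm below exist; this is needed because \<^const>\<open>deriv\<close> is
  total.\<close>

definition smooth_in_sector :: "nat \<Rightarrow> (complex \<Rightarrow> real) \<Rightarrow> bool" where
  "smooth_in_sector m f \<longleftrightarrow>
     (\<forall>k. \<forall>(r, \<theta>) \<in> sector m.
        (\<lambda>\<rho>. dr k f \<rho> \<theta>) differentiable (at r) \<and>
        (\<lambda>\<phi>. dtheta k f r \<phi>) differentiable (at \<theta>))"

text \<open>The \<open>L\<^sup>\<infinity>\<close> norms are suprema, as the functions involved are continuous in the open sector.\<close>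

definition Comega_norm :: "nat \<Rightarrow> real \<Rightarrow> real \<Rightarrow> (complex \<Rightarrow> real) \<Rightarrow> ennreal" where
  "Comega_norm m \<alpha> l f =
     (\<Sum>k. ennreal (l ^ k / fact k) *
        ((SUP (r, \<theta>) \<in> sector m. ennreal ((r + \<theta>) powr (real k + \<alpha>) * \<bar>dr k f r \<theta>\<bar>)) +
         (SUP (r, \<theta>) \<in> sector m. ennreal ((r + \<theta>) powr (real k + \<alpha>) * \<bar>dtheta k f r \<theta>\<bar>))))"

definition Comega_ball :: "nat \<Rightarrow> real \<Rightarrow> real \<Rightarrow> (complex \<Rightarrow> real) set" where
  "Comega_ball m \<alpha> l =
     {f. odd_mfold m f \<and> smooth_in_sector m f \<and> Comega_norm m \<alpha> l f < \<infinity>}"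

definition Comega :: "nat \<Rightarrow> real \<Rightarrow> (complex \<Rightarrow> real) set" where
  "Comega m \<alpha> = (\<Union>l\<in>{0<..}. Comega_ball m \<alpha> l)"

definition in_C_Comega :: "nat \<Rightarrow> real \<Rightarrow> real \<Rightarrow> (real \<Rightarrow> complex \<Rightarrow> real) \<Rightarrow> bool" where
  "in_C_Comega m \<alpha> T \<omega> \<longleftrightarrow>
     (\<forall>T'. 0 \<le> T' \<and> T' < T \<longrightarrow>
        (\<exists>l>0. \<forall>t\<in>{0..T'}. \<omega> t \<in> Comega_ball m \<alpha> l \<and>
           ((\<lambda>s. Comega_norm m \<alpha> l (\<lambda>z. \<omega> s z - \<omega> t z)) \<longlongrightarrow> 0) (at t within {0..T'})))"

definition dx :: "(complex \<Rightarrow> real) \<Rightarrow> complex \<Rightarrow> real" where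
  "dx f z = deriv (\<lambda>h. f (z + of_real h)) 0"

definition dy :: "(complex \<Rightarrow> real) \<Rightarrow> complex \<Rightarrow> real" where
  "dy f z = deriv (\<lambda>h. f (z + \<i> * of_real h)) 0"

definition C1_on :: "complex set \<Rightarrow> (complex \<Rightarrow> real) \<Rightarrow> bool" where
  "C1_on S f \<longleftrightarrow>
     (\<forall>z\<in>S. f differentiable (at z)) \<and> continuous_on S (dx f) \<and> continuous_on S (dy f)"

definition C2_on :: "complex set \<Rightarrow> (complex \<Rightarrow> real) \<Rightarrow> bool" where
  "C2_on S f \<longleftrightarrow> C1_on S f \<and> C1_on S (dx f) \<and> C1_on S (dy f)"

definition laplacian :: "(complex \<Rightarrow> real) \<Rightarrow> complex \<Rightarrow> real" where
  "laplacian f z = dx (dx f) z + dy (dy f) z"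

text \<open>The complement of the rays \<open>\<theta> \<in> (\<pi>/m)\<int>\<close>, i.e. the union of the open sector and its images
  under the symmetries.\<close>

definition off_rays :: "nat \<Rightarrow> complex set" where
  "off_rays m = {z. Im (z ^ m) \<noteq> 0}"

text \<open>An odd vorticity jumps across the rays, so \<open>\<Delta>\<psi> = \<omega>\<close> is imposed pointwise off the rays, and
  \<open>\<psi>\<close> is \<open>C\<^sup>1\<close> across them. The latter excludes a single layer on the rays and the quadratic bound a
  singular contribution at the origin, so that \<open>\<Delta>\<psi> = \<omega>\<close> holds in the sense of distributions on the
  whole plane. Conversely, for \<open>\<omega>\<close> in \<^const>\<open>Comega\<close> with \<open>\<alpha> < 1\<close>, elliptic regularity gives every
  distributional solution with these symmetries and this bound the regularity required here.\<close>

definition stream_function :: "nat \<Rightarrow> (complex \<Rightarrow> real) \<Rightarrow> (complex \<Rightarrow> real) \<Rightarrow> bool" where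
  "stream_function m \<omega> \<psi> \<longleftrightarrow>
     odd_mfold m \<psi> \<and>
     C1_on (- {0}) \<psi> \<and> C2_on (off_rays m) \<psi> \<and>
     (\<forall>z\<in>off_rays m. laplacian \<psi> z = \<omega> z) \<and>
     (\<exists>C. \<forall>z. z \<noteq> 0 \<longrightarrow> \<bar>\<psi> z\<bar> / (cmod z)\<^sup>2 \<le> C)"

definition velocity :: "(complex \<Rightarrow> real) \<Rightarrow> complex \<Rightarrow> complex" where
  "velocity \<psi> z = Complex (- dy \<psi> z) (dx \<psi> z)"

definition velocity_r :: "(complex \<Rightarrow> real) \<Rightarrow> real \<Rightarrow> real \<Rightarrow> real" where
  "velocity_r \<psi> r \<theta> = velocity \<psi> (rcis r \<theta>) \<bullet> cis \<theta>"

definition velocity_theta :: "(complex \<Rightarrow> real) \<Rightarrow> real \<Rightarrow> real \<Rightarrow> real" where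
  "velocity_theta \<psi> r \<theta> = velocity \<psi> (rcis r \<theta>) \<bullet> (\<i> * cis \<theta>)"

definition euler_solution ::
  "nat \<Rightarrow> real \<Rightarrow> (complex \<Rightarrow> real) \<Rightarrow> real \<Rightarrow> (real \<Rightarrow> complex \<Rightarrow> real) \<Rightarrow> bool" where
  "euler_solution m \<alpha> \<omega>0 T \<omega> \<longleftrightarrow>
     in_C_Comega m \<alpha> T \<omega> \<and> \<omega> 0 = \<omega>0 \<and>
     (\<exists>\<psi>. (\<forall>t\<in>{0..<T}. stream_function m (\<omega> t) (\<psi> t)) \<and>
        (\<forall>t\<in>{0<..<T}. \<forall>(r, \<theta>) \<in> sector m.
           ((\<lambda>s. \<omega> s (rcis r \<theta>)) has_real_derivative
              - (velocity_r (\<psi> t) r \<theta> * dr 1 (\<omega> t) r \<theta>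
                 + velocity_theta (\<psi> t) r \<theta> / r * dtheta 1 (\<omega> t) r \<theta>)) (at t)))"

definition max_existence_time :: "nat \<Rightarrow> real \<Rightarrow> (complex \<Rightarrow> real) \<Rightarrow> ennreal" where
  "max_existence_time m \<alpha> \<omega>0 = Sup {ennreal T | T. T > 0 \<and> (\<exists>\<omega>. euler_solution m \<alpha> \<omega>0 T \<omega>)}"

text \<open>\<open>Arg (z ^ m) / m\<close> is the representative in \<open>(-\<pi>/m, \<pi>/m]\<close> of the angle of \<open>z\<close> modulo
  \<open>2\<pi>/m\<close>. On the rays, oddness and periodicity force the value 0.\<close>

definition initial_vorticity :: "nat \<Rightarrow> real \<Rightarrow> complex \<Rightarrow> real" where
  "initial_vorticity m \<alpha> z =
     (let \<beta> = Arg (z ^ m) / real m in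
      if z \<in> off_rays m then - sgn \<beta> * (cmod z + \<bar>\<beta>\<bar>) powr (- \<alpha>) else 0)"

lemma initial_vorticity_sector:
  assumes "m > 0" and "r > 0" and "0 < \<theta>" and "\<theta> < pi / real m"
  shows "initial_vorticity m \<alpha> (rcis r \<theta>) = - ((r + \<theta>) powr (- \<alpha>))"
proof -
  have b: "0 < real m * \<theta>" "real m * \<theta> < pi"
    using assms by (auto simp: field_simps)
  then have "- pi < real m * \<theta>"
    using pi_gt_zero by linarith
  have p: "rcis r \<theta> ^ m = rcis (r ^ m) (real m * \<theta>)"
    by (simp add: DeMoivre2)
  have "Arg (rcis r \<theta> ^ m) = real m * \<theta>"
    unfolding p using b \<open>- pi < real m * \<theta>\<close> assms by (intro Arg_unique[of "r ^ m"]) (auto simp: rcis_def cis_conv_exp)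
  moreover have "rcis r \<theta> \<in> off_rays m"
    using sin_gt_zero[OF b] assms by (simp add: off_rays_def p)
  ultimately show ?thesis
    using assms by (simp add: initial_vorticity_def)
qed

lemma initial_vorticity_odd_mfold:
  assumes "m > 0"
  shows "odd_mfold m (initial_vorticity m \<alpha>)"
proof -
  have "initial_vorticity m \<alpha> (cnj z) = - initial_vorticity m \<alpha> z" for z
  proof (cases "z \<in> off_rays m")
    case True
    then have "Arg (cnj (z ^ m)) = - Arg (z ^ m)"
      unfolding off_rays_def by (subst Arg_cnj) (auto simp: complex_is_Real_iff)
    with True show ?thesis
      by (simp add: initial_vorticity_def off_rays_def sgn_minus Let_def
          flip: complex_cnj_power)
  qed (simp add: initial_vorticity_def off_rays_def Let_def flip: complex_cnj_power)
  moreover have "cis (2 * pi / real m) ^ m = 1"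
    using assms unfolding Complex.DeMoivre by simp
  then have "(cis (2 * pi / real m) * z) ^ m = z ^ m" for z
    by (simp add: power_mult_distrib)
  then have "initial_vorticity m \<alpha> (cis (2 * pi / real m) * z) = initial_vorticity m \<alpha> z" for z
    by (simp add: initial_vorticity_def off_rays_def norm_mult Let_def)
  ultimately show ?thesis
    by (simp add: odd_mfold_def)
qed

end

theory Submission
  imports Defs
begin

text \<open>Write \<open>L = \<pi>/m\<close>. For a solution in the given class the vorticity has at the origin a trace
\<open>g(t, \<theta>) = lim\<^bsub>r\<rightarrow>0\<^esub> \<omega>(t, r, \<theta>)\<close> on \<open>0 < \<theta> < L\<close>, and the stream function satisfies
\<open>\<psi> \<approx> r\<^sup>2 G(t, \<theta>)\<close> as \<open>r \<rightarrow> 0\<close>, where \<open>G'' + 4 G = g\<close>, \<open>G(0) = G(L) = 0\<close>. In the limit the Euler equation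
becomes the one-dimensional transport equation \<open>g\<^sub>t + 2 G g\<^sub>\<theta> = 0\<close>, with data \<open>- \<theta> powr - \<alpha>\<close>, and the
singularity of the data at \<open>\<theta> = 0\<close> makes this equation blow up:

  \<^item> The sign \<open>g \<le> 0\<close> is preserved, and then \<open>G \<ge> c M(t) \<theta> (L - \<theta>)\<close> with the moment
    \<open>M(t) = - \<integral> sin(2s) sin(2(L - s)) g(t, s) ds\<close>, by positivity of the Green function
    (\<open>angular_profile.green_lower\<close>). This is where \<open>m \<ge> 3\<close>, that is \<open>2 L < \<pi>\<close>, enters.
  \<^item> The profile \<open>- K(t) ((L - \<theta>)/\<theta>) powr \<alpha>\<close> with \<open>K' = \<kappa> M K\<close> is therefore a supersolution, so \<open>g\<close> stays
    below it (\<open>transport_comparison\<close>).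
  \<^item> Integrating this bound gives \<open>M \<ge> c' K\<close>, hence \<open>K' \<ge> \<kappa> c' K\<^sup>2\<close>, and \<open>K\<close> cannot exist beyond the explicit
    time \<open>lifespan_bound\<close> (\<open>solution_time_bound\<close>).

The limit equation is never derived. The comparison argument is run for the Euler equation itself
on a small circle \<open>r = const\<close>, where radial transport is a small error; only the conclusion is
passed to the limit \<open>r \<rightarrow> 0\<close>, not the derivatives of the vorticity.

What has to be proved about the stream function is that \<open>u\<^sup>\<theta>/r - 2 G\<close> tends to 0 and \<open>u\<^sup>r = O(r)\<close>
as \<open>r \<rightarrow> 0\<close>, with constants uniform in time. With \<open>s = ln r\<close> the Laplacian becomes
\<open>\<psi>\<^sub>s\<^sub>s + \<psi>\<^sub>\<theta>\<^sub>\<theta> = exp(2s) \<omega>\<close> in the strip \<open>0 < \<theta> < L\<close>. The right-hand side of the equation for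
\<open>\<psi> - r\<^sup>2 G\<close> has an additional factor \<open>r powr \<gamma>\<close>, because \<open>\<omega>\<close> is Hoelder continuous in \<open>r\<close> down to \<open>r = 0\<close>; a barrier and the
quadratic growth of \<open>\<psi>\<close> bound this difference (\<open>strip_comparison\<close>), and an interior estimate, also
proved by the maximum principle, bounds its first derivatives (\<open>partial_derivative_bound\<close>).\<close>

section \<open>Maximum principle and interior derivative estimate\<close>

lemma second_derivative_at_max:
  fixes f f' :: "real \<Rightarrow> real"
  assumes x: "a < x" "x < b"
    and f: "\<And>y. a < y \<Longrightarrow> y < b \<Longrightarrow> (f has_real_derivative f' y) (at y)"
    and f': "(f' has_real_derivative D) (at x)"
    and max: "\<And>y. a < y \<Longrightarrow> y < b \<Longrightarrow> f y \<le> f x"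
  shows "D \<le> 0"
proof (rule ccontr)
  assume "\<not> D \<le> 0"
  then have D: "D > 0" by simp
  have 0: "f' x = 0"
  proof (rule DERIV_local_max[OF f[OF x], of "min (x - a) (b - x)"])
    show "0 < min (x - a) (b - x)" using x by simp
    show "\<forall>y. \<bar>x - y\<bar> < min (x - a) (b - x) \<longrightarrow> f y \<le> f x"
      using max by (auto simp: abs_if split: if_splits)
  qed
  obtain d where d: "d > 0" "\<And>h. h > 0 \<Longrightarrow> h < d \<Longrightarrow> f' x < f' (x + h)"
    using DERIV_pos_inc_right[OF f' D] by blast
  define y where "y = x + min (d / 2) ((b - x) / 2)"
  have y: "x < y" "y < b" "y < x + d"
    using x d(1) by (auto simp: y_def min_def field_simps)
  have "\<exists>z. x < z \<and> z < y \<and> f y - f x = (y - x) * f' z"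
    using x y by (intro MVT2 f) auto
  then obtain z where z: "x < z" "z < y" "f y - f x = (y - x) * f' z"
    by blast
  have "f' z > 0"
    using d(2)[of "z - x"] z y 0 by simp
  then have "f y > f x"
    using z y by (smt (verit) mult_pos_pos)
  then show False
    using max[of y] x y by simp
qed

lemma DERIV_translate:
  fixes u :: "real \<Rightarrow> real"
  assumes "(u has_real_derivative u') (at (c + x))"
  shows "((\<lambda>x. u (c + x)) has_real_derivative u') (at x)"
  using assms DERIV_shift[of u u' x c] by (simp add: add.commute)

lemma DERIV_reflect:
  fixes u :: "real \<Rightarrow> real"
  assumes "(u has_real_derivative u') (at (c - x))"
  shows "((\<lambda>x. u (c - x)) has_real_derivative - u') (at x)"
  using DERIV_mirror[of "\<lambda>x. u (c + x)" u' x] DERIV_translate[of u u' c "- x"] assms by simp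

lemma max_principle_rectangle:
  fixes w wx wxx wy wyy :: "real \<Rightarrow> real \<Rightarrow> real"
  assumes cont: "continuous_on ({a..b} \<times> {c..d}) (\<lambda>(x, y). w x y)"
    and wx: "\<And>x y. a < x \<Longrightarrow> x < b \<Longrightarrow> c < y \<Longrightarrow> y < d \<Longrightarrow>
        ((\<lambda>x. w x y) has_real_derivative wx x y) (at x)"
    and wxx: "\<And>x y. a < x \<Longrightarrow> x < b \<Longrightarrow> c < y \<Longrightarrow> y < d \<Longrightarrow>
        ((\<lambda>x. wx x y) has_real_derivative wxx x y) (at x)"
    and wy: "\<And>x y. a < x \<Longrightarrow> x < b \<Longrightarrow> c < y \<Longrightarrow> y < d \<Longrightarrow>
        ((\<lambda>y. w x y) has_real_derivative wy x y) (at y)"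
    and wyy: "\<And>x y. a < x \<Longrightarrow> x < b \<Longrightarrow> c < y \<Longrightarrow> y < d \<Longrightarrow>
        ((\<lambda>y. wy x y) has_real_derivative wyy x y) (at y)"
    and lap: "\<And>x y. a < x \<Longrightarrow> x < b \<Longrightarrow> c < y \<Longrightarrow> y < d \<Longrightarrow> wxx x y + wyy x y > 0"
    and bdry: "\<And>x y. a \<le> x \<Longrightarrow> x \<le> b \<Longrightarrow> c \<le> y \<Longrightarrow> y \<le> d \<Longrightarrow>
        x = a \<or> x = b \<or> y = c \<or> y = d \<Longrightarrow> w x y \<le> 0"
    and xy: "a \<le> x" "x \<le> b" "c \<le> y" "y \<le> d"
  shows "w x y \<le> 0"
proof (rule ccontr)
  assume neg: "\<not> w x y \<le> 0"
  have "\<exists>p\<in>{a..b} \<times> {c..d}. \<forall>q\<in>{a..b} \<times> {c..d}. (\<lambda>(x, y). w x y) q \<le> (\<lambda>(x, y). w x y) p"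
    using xy by (intro continuous_attains_sup cont compact_Times) auto
  then obtain p q where pq: "a \<le> p" "p \<le> b" "c \<le> q" "q \<le> d"
    and max: "\<And>x y. a \<le> x \<Longrightarrow> x \<le> b \<Longrightarrow> c \<le> y \<Longrightarrow> y \<le> d \<Longrightarrow> w x y \<le> w p q"
    by auto
  have "w p q > 0"
    using max[OF xy] neg by simp
  then have "a < p" "p < b" "c < q" "q < d"
    using bdry[OF pq] pq by (auto simp: less_le)
  note int = this
  have "wxx p q \<le> 0"
    using int max by (intro second_derivative_at_max[of a p b "\<lambda>x. w x q" "\<lambda>x. wx x q"] wx wxx) auto
  moreover have "wyy p q \<le> 0"
    using int max by (intro second_derivative_at_max[of c q d "\<lambda>y. w p y" "\<lambda>y. wy p y"] wy wyy) auto
  ultimately show False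
    using lap[OF int] by simp
qed

text \<open>Brandt's argument: the odd part of \<open>v\<close> under reflection in the line \<open>x = x0\<close> vanishes on that
line, and on the half square it lies below an explicit quadratic barrier. Comparing the slopes of both at
the reflection line bounds \<open>v\<^sub>x\<close> at the centre.\<close>

lemma partial_derivative_bound_upper:
  fixes v vx vxx vy vyy :: "real \<Rightarrow> real \<Rightarrow> real"
  assumes d: "d > 0" and B: "B > 0"
    and cont: "continuous_on ({x0 - d..x0 + d} \<times> {y0 - d..y0 + d}) (\<lambda>(x, y). v x y)"
    and vx: "\<And>x y. \<bar>x - x0\<bar> < d \<Longrightarrow> \<bar>y - y0\<bar> < d \<Longrightarrow>
        ((\<lambda>x. v x y) has_real_derivative vx x y) (at x)"
    and vxx: "\<And>x y. \<bar>x - x0\<bar> < d \<Longrightarrow> \<bar>y - y0\<bar> < d \<Longrightarrow>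
        ((\<lambda>x. vx x y) has_real_derivative vxx x y) (at x)"
    and vy: "\<And>x y. \<bar>x - x0\<bar> < d \<Longrightarrow> \<bar>y - y0\<bar> < d \<Longrightarrow>
        ((\<lambda>y. v x y) has_real_derivative vy x y) (at y)"
    and vyy: "\<And>x y. \<bar>x - x0\<bar> < d \<Longrightarrow> \<bar>y - y0\<bar> < d \<Longrightarrow>
        ((\<lambda>y. vy x y) has_real_derivative vyy x y) (at y)"
    and lap: "\<And>x y. \<bar>x - x0\<bar> < d \<Longrightarrow> \<bar>y - y0\<bar> < d \<Longrightarrow> \<bar>vxx x y + vyy x y\<bar> \<le> B"
    and A: "\<And>x y. \<bar>x - x0\<bar> \<le> d \<Longrightarrow> \<bar>y - y0\<bar> \<le> d \<Longrightarrow> \<bar>v x y\<bar> \<le> A"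
  shows "vx x0 y0 \<le> 2 * A / d + B * d"
proof -
  have A0: "A \<ge> 0"
    using A[of x0 y0] d by simp
  define k where "k = A / d\<^sup>2"
  have kd: "k * d\<^sup>2 = A" "k * d = A / d"
    using d by (simp_all add: k_def power2_eq_square)
  \<comment> \<open>The first summand is harmonic, at least \<open>A\<close> on the three outer sides and nonnegative on the
      reflection line; the second one makes the barrier strictly superharmonic.\<close>
  define b where "b x y = k * ((y - y0)\<^sup>2 + x * (2 * d - x)) + B * x * (d - x)" for x y
  define w where "w x y = (v (x0 + x) y - v (x0 - x) y) / 2 - b x y" for x y
  have w: "w x y \<le> 0" if xy: "0 \<le> x" "x \<le> d" "y0 - d \<le> y" "y \<le> y0 + d" for x y
  proof (rule max_principle_rectangle[OF _ _ _ _ _ _ _ xy])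
    have "continuous_on ({0..d} \<times> {y0 - d..y0 + d}) (\<lambda>p. v (x0 + fst p) (snd p))"
      by (rule continuous_on_compose2[OF cont, where f = "\<lambda>p. (x0 + fst p, snd p)", simplified])
        (use d in \<open>auto intro!: continuous_intros\<close>)
    moreover have "continuous_on ({0..d} \<times> {y0 - d..y0 + d}) (\<lambda>p. v (x0 - fst p) (snd p))"
      by (rule continuous_on_compose2[OF cont, where f = "\<lambda>p. (x0 - fst p, snd p)", simplified])
        (use d in \<open>auto intro!: continuous_intros\<close>)
    ultimately show "continuous_on ({0..d} \<times> {y0 - d..y0 + d}) (\<lambda>(x, y). w x y)"
      unfolding w_def b_def case_prod_beta by (intro continuous_intros) auto
  next
    fix x y assume "0 < x" "x < d" "y0 - d < y" "y < y0 + d"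
    then have i: "\<bar>x0 + x - x0\<bar> < d" "\<bar>x0 - x - x0\<bar> < d" "\<bar>y - y0\<bar> < d" by auto
    note [derivative_intros] = DERIV_translate[OF vx[OF i(1,3)]] DERIV_reflect[OF vx[OF i(2,3)]]
      DERIV_translate[OF vxx[OF i(1,3)]] DERIV_reflect[OF vxx[OF i(2,3)]]
      vy[OF i(1,3)] vy[OF i(2,3)] vyy[OF i(1,3)] vyy[OF i(2,3)]
    show "((\<lambda>x. w x y) has_real_derivative (vx (x0 + x) y + vx (x0 - x) y) / 2
        - (k * (2 * d - 2 * x) + B * (d - 2 * x))) (at x)"
      unfolding w_def b_def by (auto intro!: derivative_eq_intros; simp add: algebra_simps)
    show "((\<lambda>x. (vx (x0 + x) y + vx (x0 - x) y) / 2
        - (k * (2 * d - 2 * x) + B * (d - 2 * x))) has_real_derivative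
        (vxx (x0 + x) y - vxx (x0 - x) y) / 2 + (2 * k + 2 * B)) (at x)"
      by (auto intro!: derivative_eq_intros)
    show "((\<lambda>y. w x y) has_real_derivative (vy (x0 + x) y - vy (x0 - x) y) / 2
        - k * (2 * (y - y0))) (at y)"
      unfolding w_def b_def by (auto intro!: derivative_eq_intros; simp add: algebra_simps)
    show "((\<lambda>y. (vy (x0 + x) y - vy (x0 - x) y) / 2 - k * (2 * (y - y0)))
        has_real_derivative (vyy (x0 + x) y - vyy (x0 - x) y) / 2 - 2 * k) (at y)"
      by (auto intro!: derivative_eq_intros; simp add: algebra_simps)
    show "0 < (vxx (x0 + x) y - vxx (x0 - x) y) / 2 + (2 * k + 2 * B) +
      ((vyy (x0 + x) y - vyy (x0 - x) y) / 2 - 2 * k)"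
    proof -
      have "- B \<le> vxx (x0 + x) y + vyy (x0 + x) y" "vxx (x0 - x) y + vyy (x0 - x) y \<le> B"
        using lap[OF i(1,3)] lap[OF i(2,3)] by (auto simp: abs_le_iff)
      then show ?thesis
        using B by (simp add: diff_divide_distrib)
    qed
  next
    fix x y assume *: "0 \<le> x" "x \<le> d" "y0 - d \<le> y" "y \<le> y0 + d"
      and bd: "x = 0 \<or> x = d \<or> y = y0 - d \<or> y = y0 + d"
    have i: "\<bar>x0 + x - x0\<bar> \<le> d" "\<bar>x0 - x - x0\<bar> \<le> d" "\<bar>y - y0\<bar> \<le> d"
      using * by auto
    have v: "(v (x0 + x) y - v (x0 - x) y) / 2 \<le> A"
      using A[OF i(1,3)] A[OF i(2,3)] by (simp add: abs_le_iff diff_divide_distrib)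
    have q: "0 \<le> B * x * (d - x)" "0 \<le> x * (2 * d - x)"
      using * B by auto
    show "w x y \<le> 0"
    proof (cases "x = 0")
      case True
      then show ?thesis using A0 by (simp add: w_def b_def k_def)
    next
      case False
      have "d\<^sup>2 \<le> (y - y0)\<^sup>2 + x * (2 * d - x)"
        using bd False q zero_le_power2[of "y - y0"] by (auto simp: power2_eq_square algebra_simps)
      then have "k * d\<^sup>2 \<le> k * ((y - y0)\<^sup>2 + x * (2 * d - x))"
        using A0 by (intro mult_left_mono) (auto simp: k_def)
      then show ?thesis
        using v q by (simp add: w_def b_def kd)
    qed
  qed
  have w0: "w 0 y0 = 0" by (simp add: w_def b_def)
  have i: "\<bar>x0 + 0 - x0\<bar> < d" "\<bar>x0 - 0 - x0\<bar> < d" "\<bar>y0 - y0\<bar> < d" using d by auto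
  note [derivative_intros] = DERIV_translate[OF vx[OF i(1,3)]] DERIV_reflect[OF vx[OF i(2,3)]]
  have "((\<lambda>x. w x y0) has_real_derivative vx x0 y0 - (2 * (k * d) + B * d)) (at 0)"
    unfolding w_def b_def by (auto intro!: derivative_eq_intros; simp add: algebra_simps)
  then have w': "((\<lambda>x. w x y0) has_real_derivative vx x0 y0 - (2 * A / d + B * d)) (at 0)"
    by (simp add: kd(2))
  show ?thesis
  proof (rule ccontr)
    assume "\<not> ?thesis"
    then have "vx x0 y0 - (2 * A / d + B * d) > 0" by simp
    from DERIV_pos_inc_right[OF w' this] obtain e where e: "e > 0"
      "\<And>h. h > 0 \<Longrightarrow> h < e \<Longrightarrow> w 0 y0 < w (0 + h) y0" by blast
    then have "w 0 y0 < w (min (e/2) d) y0"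
      using d e(2)[of "min (e/2) d"] by (auto simp: min_def split: if_splits)
    moreover have "w (min (e/2) d) y0 \<le> 0"
      using w[of "min (e/2) d" y0] d e(1) by auto
    ultimately show False using w0 by simp
  qed
qed

lemma partial_derivative_bound:
  fixes v vx vxx vy vyy :: "real \<Rightarrow> real \<Rightarrow> real"
  assumes d: "d > 0" and B: "B > 0"
    and cont: "continuous_on ({x0 - d..x0 + d} \<times> {y0 - d..y0 + d}) (\<lambda>(x, y). v x y)"
    and vx: "\<And>x y. \<bar>x - x0\<bar> < d \<Longrightarrow> \<bar>y - y0\<bar> < d \<Longrightarrow>
        ((\<lambda>x. v x y) has_real_derivative vx x y) (at x)"
    and vxx: "\<And>x y. \<bar>x - x0\<bar> < d \<Longrightarrow> \<bar>y - y0\<bar> < d \<Longrightarrow>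
        ((\<lambda>x. vx x y) has_real_derivative vxx x y) (at x)"
    and vy: "\<And>x y. \<bar>x - x0\<bar> < d \<Longrightarrow> \<bar>y - y0\<bar> < d \<Longrightarrow>
        ((\<lambda>y. v x y) has_real_derivative vy x y) (at y)"
    and vyy: "\<And>x y. \<bar>x - x0\<bar> < d \<Longrightarrow> \<bar>y - y0\<bar> < d \<Longrightarrow>
        ((\<lambda>y. vy x y) has_real_derivative vyy x y) (at y)"
    and lap: "\<And>x y. \<bar>x - x0\<bar> < d \<Longrightarrow> \<bar>y - y0\<bar> < d \<Longrightarrow> \<bar>vxx x y + vyy x y\<bar> \<le> B"
    and A: "\<And>x y. \<bar>x - x0\<bar> \<le> d \<Longrightarrow> \<bar>y - y0\<bar> \<le> d \<Longrightarrow> \<bar>v x y\<bar> \<le> A"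
  shows "\<bar>vx x0 y0\<bar> \<le> 2 * A / d + B * d" and "\<bar>vy x0 y0\<bar> \<le> 2 * A / d + B * d"
proof -
  have cont': "continuous_on ({y0 - d..y0 + d} \<times> {x0 - d..x0 + d}) (\<lambda>(y, x). v x y)"
    unfolding case_prod_beta
    by (rule continuous_on_compose2[OF cont, where f = "\<lambda>p. (snd p, fst p)", simplified])
      (auto intro!: continuous_intros)
  have neg: "continuous_on S (\<lambda>(x, y). - u x y)" if "continuous_on S (\<lambda>(x, y). u x y)"
    for S and u :: "real \<Rightarrow> real \<Rightarrow> real"
    using continuous_on_minus[OF that] by (simp add: case_prod_beta)
  have lap': "\<bar>vyy x y + vxx x y\<bar> \<le> B" "\<bar>- vyy x y - vxx x y\<bar> \<le> B" "\<bar>- vxx x y - vyy x y\<bar> \<le> B"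
    if "\<bar>x - x0\<bar> < d" "\<bar>y - y0\<bar> < d" for x y
    using lap[OF that] by auto
  have "vx x0 y0 \<le> 2 * A / d + B * d"
    by (rule partial_derivative_bound_upper[OF d B cont vx vxx vy vyy lap A])
  moreover have "- vx x0 y0 \<le> 2 * A / d + B * d"
    by (rule partial_derivative_bound_upper[where vx = "\<lambda>x y. - vx x y" and vy = "\<lambda>x y. - vy x y",
          OF d B neg[OF cont] DERIV_minus[OF vx] DERIV_minus[OF vxx] DERIV_minus[OF vy] DERIV_minus[OF vyy]])
      (use lap' A in auto)
  ultimately show "\<bar>vx x0 y0\<bar> \<le> 2 * A / d + B * d" by simp
  have "vy x0 y0 \<le> 2 * A / d + B * d"
    by (rule partial_derivative_bound_upper[where v = "\<lambda>y x. v x y" and vx = "\<lambda>y x. vy x y" and vy = "\<lambda>y x. vx x y"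
          and vxx = "\<lambda>y x. vyy x y" and vyy = "\<lambda>y x. vxx x y",
          OF d B cont' vy vyy vx vxx lap'(1) A])
  moreover have "- vy x0 y0 \<le> 2 * A / d + B * d"
    by (rule partial_derivative_bound_upper[where v = "\<lambda>y x. - v x y" and vx = "\<lambda>y x. - vy x y" and vy = "\<lambda>y x. - vx x y"
          and vxx = "\<lambda>y x. - vyy x y" and vyy = "\<lambda>y x. - vxx x y",
          OF d B neg[OF cont'] DERIV_minus[OF vy] DERIV_minus[OF vyy] DERIV_minus[OF vx] DERIV_minus[OF vxx]])
      (use lap' A in auto)
  ultimately show "\<bar>vy x0 y0\<bar> \<le> 2 * A / d + B * d" by simp
qed

section \<open>The angular Dirichlet problem\<close>

text \<open>The range of \<open>y\<close> reaches beyond \<open>\<pi>/2\<close> because \<open>2 L\<close> may be as large as \<open>2 \<pi>/3\<close>.\<close>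

lemma sin_ge_quarter:
  assumes "0 \<le> y" "y \<le> 2 * pi / 3"
  shows "y / 4 \<le> sin y"
proof -
  define x where "x = y / 2"
  have x: "0 \<le> x" "x \<le> pi / 3" "x < pi / 2" "y = 2 * x"
    using assms pi_gt_zero unfolding x_def by linarith+
  have c: "1 / 2 \<le> cos x"
    using cos_monotone_0_pi_le[of x "pi / 3"] x cos_60 pi_gt_zero by simp
  have "0 \<le> tan x"
    using x by (cases "x = 0") (auto intro!: less_imp_le tan_gt_zero)
  then have "x \<le> tan x"
    using abs_tan_ge[of x] x by simp
  then have "x * cos x \<le> sin x"
    using c by (simp add: tan_def field_simps)
  moreover have "x * (1 / 2) \<le> x * cos x"
    using c x by (intro mult_left_mono) auto
  ultimately have s: "x / 2 \<le> sin x" by simp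
  have "(x / 2) * (1 / 2) \<le> sin x * cos x"
    using s c x by (intro mult_mono) auto
  then show ?thesis
    by (simp add: x(4) sin_double)
qed

text \<open>The solution of \<open>G'' + 4 G = g\<close>, \<open>G(0) = G(L) = 0\<close>, by variation of constants with the
fundamental solutions \<open>sin(2 \<theta>)\<close> and \<open>sin(2 (L - \<theta>))\<close>, which vanish at one end each. This is why the
integrands extend continuously to \<open>0\<close> and to \<open>L\<close>, although \<open>g\<close> is singular at \<open>0\<close> and need not have a limit at \<open>L\<close>. The function \<open>green'\<close> is the derivative.\<close>

definition left_integral :: "(real \<Rightarrow> real) \<Rightarrow> real \<Rightarrow> real" where
  "left_integral g \<theta> = integral {0..\<theta>} (\<lambda>s. sin (2 * s) * g s)"

definition right_integral :: "real \<Rightarrow> (real \<Rightarrow> real) \<Rightarrow> real \<Rightarrow> real" where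
  "right_integral L g \<theta> = integral {\<theta>..L} (\<lambda>s. sin (2 * (L - s)) * g s)"

definition green :: "real \<Rightarrow> (real \<Rightarrow> real) \<Rightarrow> real \<Rightarrow> real" where
  "green L g \<theta> = - (sin (2 * (L - \<theta>)) * left_integral g \<theta> +
     sin (2 * \<theta>) * right_integral L g \<theta>) / (2 * sin (2 * L))"

definition green' :: "real \<Rightarrow> (real \<Rightarrow> real) \<Rightarrow> real \<Rightarrow> real" where
  "green' L g \<theta> = (cos (2 * (L - \<theta>)) * left_integral g \<theta> -
     cos (2 * \<theta>) * right_integral L g \<theta>) / sin (2 * L)"

definition green_const :: "real \<Rightarrow> real \<Rightarrow> real" where
  "green_const L \<alpha> = 2 * L powr (1 - \<alpha>) * (1 + 1 / (1 - \<alpha>)) / sin (2 * L)"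

text \<open>The weight is the product of the two fundamental solutions: up to a constant, \<open>\<theta> (L - \<theta>)\<close> times this
weight is a lower bound for the Green function. The sign makes the moment positive for negative \<open>g\<close>.\<close>

definition moment :: "real \<Rightarrow> (real \<Rightarrow> real) \<Rightarrow> real" where
  "moment L g = - integral {0..L} (\<lambda>s. sin (2 * s) * (sin (2 * (L - s)) * g s))"

locale angular_profile =
  fixes L \<alpha> A :: real and g :: "real \<Rightarrow> real"
  assumes L: "0 < L" "L \<le> pi / 3" and \<alpha>: "0 < \<alpha>" "\<alpha> < 1"
    and cont: "continuous_on {0<..<L} g"
    and bound: "\<And>\<theta>. 0 < \<theta> \<Longrightarrow> \<theta> < L \<Longrightarrow> \<bar>g \<theta>\<bar> \<le> A * \<theta> powr - \<alpha>"
begin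

lemma A_nonneg: "0 \<le> A"
proof -
  have "0 \<le> A * (L / 2) powr - \<alpha>"
    using bound[of "L / 2"] L abs_ge_zero order_trans by fastforce
  then show ?thesis
    using L by (simp add: zero_le_mult_iff)
qed

lemma sin_bounds:
  assumes "0 \<le> \<theta>" "\<theta> \<le> L"
  shows "\<theta> / 2 \<le> sin (2 * \<theta>)" "sin (2 * \<theta>) \<le> 2 * \<theta>" "0 \<le> sin (2 * \<theta>)"
    "(L - \<theta>) / 2 \<le> sin (2 * (L - \<theta>))" "sin (2 * (L - \<theta>)) \<le> 2 * (L - \<theta>)" "0 \<le> sin (2 * (L - \<theta>))"
proof -
  have *: "x / 2 \<le> sin (2 * x)" if "0 \<le> x" "x \<le> L" for x
    using sin_ge_quarter[of "2 * x"] that L by simp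
  show *: "\<theta> / 2 \<le> sin (2 * \<theta>)" "(L - \<theta>) / 2 \<le> sin (2 * (L - \<theta>))"
    by (rule *; use assms in simp)+
  show "sin (2 * \<theta>) \<le> 2 * \<theta>" "sin (2 * (L - \<theta>)) \<le> 2 * (L - \<theta>)"
    using assms by (auto intro!: sin_x_le_x)
  show "0 \<le> sin (2 * \<theta>)" "0 \<le> sin (2 * (L - \<theta>))"
    by (rule order_trans[OF _ *(1)] order_trans[OF _ *(2)]; use assms in simp)+
qed

lemma sin_2L: "0 < sin (2 * L)"
  using sin_bounds(1)[of L] L by simp

lemma green_const_nonneg: "0 \<le> green_const L \<alpha>"
  using sin_2L \<alpha> by (simp add: green_const_def)

lemma isCont_g: "0 < \<theta> \<Longrightarrow> \<theta> < L \<Longrightarrow> isCont g \<theta>"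
  using cont by (simp add: continuous_on_eq_continuous_at)

lemma continuous_left:
  assumes "c < L"
  shows "continuous_on {0..c} (\<lambda>s. sin (2 * s) * g s)"
  unfolding continuous_on_eq_continuous_within
proof
  fix x assume x: "x \<in> {0..c}"
  show "continuous (at x within {0..c}) (\<lambda>s. sin (2 * s) * g s)"
  proof (cases "x = 0")
    case False
    then have "isCont g x" using x assms isCont_g by auto
    then show ?thesis
      by (intro continuous_intros) (auto intro: continuous_at_imp_continuous_at_within)
  next
    case True
    have "((\<lambda>s. 2 * A * s powr (1 - \<alpha>)) \<longlongrightarrow> 2 * A * 0 powr (1 - \<alpha>)) (at 0 within {0..c})"
      using \<alpha> by (intro tendsto_intros tendsto_powr2) (auto simp: eventually_at intro!: exI[of _ 1])
    then have "((\<lambda>s. 2 * A * s powr (1 - \<alpha>)) \<longlongrightarrow> 0) (at 0 within {0..c})"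
      by simp
    moreover have "\<forall>\<^sub>F s in at 0 within {0..c}. norm (sin (2 * s) * g s) \<le> 2 * A * s powr (1 - \<alpha>)"
      unfolding eventually_at
    proof (intro exI[of _ L] conjI ballI impI)
      fix s assume s: "s \<in> {0..c}" "s \<noteq> 0 \<and> dist s 0 < L"
      have "norm (sin (2 * s) * g s) \<le> (2 * s) * (A * s powr - \<alpha>)"
        unfolding norm_mult using s bound[of s] sin_bounds(2,3)[of s] by (intro mult_mono) auto
      also have "\<dots> = 2 * A * s powr (1 - \<alpha>)"
        using s by (simp add: powr_diff powr_minus divide_simps)
      finally show "norm (sin (2 * s) * g s) \<le> 2 * A * s powr (1 - \<alpha>)" .
    qed (use L in auto)
    ultimately have "((\<lambda>s. sin (2 * s) * g s) \<longlongrightarrow> 0) (at 0 within {0..c})"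
      by (rule Lim_null_comparison[rotated])
    then show ?thesis
      using True by (simp add: continuous_within)
  qed
qed

lemma continuous_right:
  assumes "0 < c"
  shows "continuous_on {c..L} (\<lambda>s. sin (2 * (L - s)) * g s)"
  unfolding continuous_on_eq_continuous_within
proof
  fix x assume x: "x \<in> {c..L}"
  show "continuous (at x within {c..L}) (\<lambda>s. sin (2 * (L - s)) * g s)"
  proof (cases "x = L")
    case False
    then have "isCont g x" using x assms isCont_g by auto
    then show ?thesis
      by (intro continuous_intros) (auto intro: continuous_at_imp_continuous_at_within)
  next
    case True
    have "((\<lambda>s. 2 * (L - s) * (A * c powr - \<alpha>)) \<longlongrightarrow> 2 * (L - L) * (A * c powr - \<alpha>)) (at L within {c..L})"
      by (intro tendsto_intros)
    then have "((\<lambda>s. 2 * (L - s) * (A * c powr - \<alpha>)) \<longlongrightarrow> 0) (at L within {c..L})"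
      by simp
    moreover have "\<forall>\<^sub>F s in at L within {c..L}.
        norm (sin (2 * (L - s)) * g s) \<le> 2 * (L - s) * (A * c powr - \<alpha>)"
      unfolding eventually_at
    proof (intro exI[of _ L] conjI ballI impI)
      fix s assume s: "s \<in> {c..L}" "s \<noteq> L \<and> dist s L < L"
      have "A * s powr - \<alpha> \<le> A * c powr - \<alpha>"
        using s assms \<alpha> A_nonneg by (intro mult_left_mono powr_mono2') auto
      then have "\<bar>g s\<bar> \<le> A * c powr - \<alpha>"
        using bound[of s] s assms by auto
      then show "norm (sin (2 * (L - s)) * g s) \<le> 2 * (L - s) * (A * c powr - \<alpha>)"
        unfolding norm_mult using s assms sin_bounds(5,6)[of s] by (intro mult_mono) auto
    qed (use L in auto)
    ultimately have "((\<lambda>s. sin (2 * (L - s)) * g s) \<longlongrightarrow> 0) (at L within {c..L})"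
      by (rule Lim_null_comparison[rotated])
    then show ?thesis
      using True by (simp add: continuous_within)
  qed
qed

lemma continuous_moment: "continuous_on {0..L} (\<lambda>s. sin (2 * s) * (sin (2 * (L - s)) * g s))"
proof -
  have "continuous_on ({0..L / 2} \<union> {L / 2..L}) (\<lambda>s. sin (2 * s) * (sin (2 * (L - s)) * g s))"
  proof (rule continuous_on_closed_Un)
    have "continuous_on {0..L / 2} (\<lambda>s. sin (2 * (L - s)) * (sin (2 * s) * g s))"
      using L by (intro continuous_intros continuous_left) auto
    then show "continuous_on {0..L / 2} (\<lambda>s. sin (2 * s) * (sin (2 * (L - s)) * g s))"
      by (simp add: mult_ac)
    show "continuous_on {L / 2..L} (\<lambda>s. sin (2 * s) * (sin (2 * (L - s)) * g s))"
      using L by (intro continuous_on_mult continuous_right continuous_intros) auto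
  qed auto
  moreover have "{0..L / 2} \<union> {L / 2..L} = {0..L}"
    using L by auto
  ultimately show ?thesis by simp
qed

lemma DERIV_integral_left:
  assumes "0 < \<theta>" "\<theta> < L"
  shows "(left_integral g has_real_derivative sin (2 * \<theta>) * g \<theta>) (at \<theta>)"
  using integral_has_real_derivative[OF continuous_left, of "(\<theta> + L) / 2" \<theta>] assms
    at_within_Icc_at[of 0 \<theta> "(\<theta> + L) / 2"] by (simp add: left_integral_def[abs_def])

lemma DERIV_integral_right:
  assumes "0 < \<theta>" "\<theta> < L"
  shows "(right_integral L g has_real_derivative
    - (sin (2 * (L - \<theta>)) * g \<theta>)) (at \<theta>)"
  using integral_has_real_derivative'[OF continuous_right, of "\<theta> / 2" \<theta>] assms
    at_within_Icc_at[of "\<theta> / 2" \<theta> L] by (simp add: right_integral_def[abs_def])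

lemma DERIV_green:
  assumes "0 < \<theta>" "\<theta> < L"
  shows "(green L g has_real_derivative green' L g \<theta>) (at \<theta>)"
proof -
  note [derivative_intros] = DERIV_integral_left[OF assms] DERIV_integral_right[OF assms]
  show ?thesis
    unfolding green_def green'_def using sin_2L
    by (auto intro!: derivative_eq_intros) (simp add: field_simps)
qed

lemma DERIV_green':
  assumes "0 < \<theta>" "\<theta> < L"
  shows "(green' L g has_real_derivative g \<theta> - 4 * green L g \<theta>) (at \<theta>)"
proof -
  note [derivative_intros] = DERIV_integral_left[OF assms] DERIV_integral_right[OF assms]
  have s: "sin (2 * L) = cos (2 * (L - \<theta>)) * sin (2 * \<theta>) + cos (2 * \<theta>) * sin (2 * (L - \<theta>))"
    using sin_add[of "2 * (L - \<theta>)" "2 * \<theta>"] by (simp add: algebra_simps)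
  let ?a = "left_integral g \<theta>" and ?b = "right_integral L g \<theta>"
  have "(green' L g has_real_derivative
      (2 * sin (2 * (L - \<theta>)) * ?a + 2 * sin (2 * \<theta>) * ?b +
       (cos (2 * (L - \<theta>)) * sin (2 * \<theta>) + cos (2 * \<theta>) * sin (2 * (L - \<theta>))) * g \<theta>) / sin (2 * L)) (at \<theta>)"
    unfolding green'_def using sin_2L
    by (auto intro!: derivative_eq_intros; simp add: algebra_simps)
  moreover have "(2 * sin (2 * (L - \<theta>)) * ?a + 2 * sin (2 * \<theta>) * ?b + sin (2 * L) * g \<theta>) / sin (2 * L) =
      g \<theta> - 4 * green L g \<theta>"
    unfolding green_def using sin_2L by (simp add: divide_simps; simp add: algebra_simps)
  ultimately show ?thesis
    unfolding s[symmetric] by simp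
qed

lemma integral_left_bound:
  assumes "0 \<le> \<theta>" "\<theta> < L"
  shows "\<bar>left_integral g \<theta>\<bar> \<le> 2 * A * L powr (1 - \<alpha>) * \<theta>"
proof -
  have "norm (integral {0..\<theta>} (\<lambda>s. sin (2 * s) * g s)) \<le> 2 * A * L powr (1 - \<alpha>) * (\<theta> - 0)"
  proof (intro integral_bound continuous_left assms ballI)
    fix s assume s: "s \<in> {0..\<theta>}"
    show "norm (sin (2 * s) * g s) \<le> 2 * A * L powr (1 - \<alpha>)"
    proof (cases "s = 0")
      case False
      have "norm (sin (2 * s) * g s) \<le> (2 * s) * (A * s powr - \<alpha>)"
        unfolding norm_mult using s assms False bound[of s] sin_bounds(2,3)[of s] by (intro mult_mono) auto
      also have "\<dots> = 2 * A * s powr (1 - \<alpha>)"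
        using s False by (simp add: powr_diff powr_minus divide_simps)
      also have "\<dots> \<le> 2 * A * L powr (1 - \<alpha>)"
        using A_nonneg s assms \<alpha> by (intro mult_left_mono powr_mono2) auto
      finally show ?thesis .
    qed (use A_nonneg in auto)
  qed
  then show ?thesis by (simp add: left_integral_def)
qed

lemma integral_right_bound:
  assumes "0 < \<theta>" "\<theta> \<le> L"
  shows "\<bar>right_integral L g \<theta>\<bar> \<le> 2 * A * (L powr (1 - \<alpha>) / (1 - \<alpha>)) * (L - \<theta>)"
proof -
  have "((\<lambda>s. s powr - \<alpha>) has_integral L powr (1 - \<alpha>) / (1 - \<alpha>) - \<theta> powr (1 - \<alpha>) / (1 - \<alpha>)) {\<theta>..L}"
  proof (rule fundamental_theorem_of_calculus)
    fix x assume x: "x \<in> {\<theta>..L}"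
    have "((\<lambda>s. s powr (1 - \<alpha>) / (1 - \<alpha>)) has_real_derivative x powr - \<alpha>) (at x)"
      using x assms \<alpha> by (auto intro!: derivative_eq_intros)
    then show "((\<lambda>s. s powr (1 - \<alpha>) / (1 - \<alpha>)) has_vector_derivative x powr - \<alpha>) (at x within {\<theta>..L})"
      by (simp add: has_real_derivative_iff_has_vector_derivative has_vector_derivative_at_within)
  qed (use assms in auto)
  from has_integral_mult_right[OF this, of "2 * (L - \<theta>) * A"]
  have I: "((\<lambda>s. 2 * (L - \<theta>) * A * s powr - \<alpha>) has_integral
    2 * (L - \<theta>) * A * (L powr (1 - \<alpha>) / (1 - \<alpha>) - \<theta> powr (1 - \<alpha>) / (1 - \<alpha>))) {\<theta>..L}" .
  have "norm (integral {\<theta>..L} (\<lambda>s. sin (2 * (L - s)) * g s)) \<le>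
      integral {\<theta>..L} (\<lambda>s. 2 * (L - \<theta>) * A * s powr - \<alpha>)"
  proof (rule integral_norm_bound_integral)
    show "(\<lambda>s. sin (2 * (L - s)) * g s) integrable_on {\<theta>..L}"
      using assms by (intro integrable_continuous_real continuous_right)
    show "(\<lambda>s. 2 * (L - \<theta>) * A * s powr - \<alpha>) integrable_on {\<theta>..L}"
      using I by blast
    fix s assume s: "s \<in> {\<theta>..L}"
    show "norm (sin (2 * (L - s)) * g s) \<le> 2 * (L - \<theta>) * A * s powr - \<alpha>"
    proof (cases "s = L")
      case False
      have "norm (sin (2 * (L - s)) * g s) \<le> (2 * (L - \<theta>)) * (A * s powr - \<alpha>)"
      proof (unfold norm_mult, intro mult_mono)
        have "0 \<le> s" "s \<le> L" using s assms by auto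
        from sin_bounds(5,6)[OF this] show "norm (sin (2 * (L - s))) \<le> 2 * (L - \<theta>)"
          using s by auto
      qed (use s assms False bound[of s] in auto)
      then show ?thesis by simp
    qed (use A_nonneg assms in auto)
  qed
  also have "\<dots> = 2 * (L - \<theta>) * A * (L powr (1 - \<alpha>) / (1 - \<alpha>) - \<theta> powr (1 - \<alpha>) / (1 - \<alpha>))"
    using I by (rule integral_unique)
  also have "\<dots> \<le> 2 * (L - \<theta>) * A * (L powr (1 - \<alpha>) / (1 - \<alpha>))"
    using assms A_nonneg \<alpha> by (intro mult_left_mono) auto
  also have "\<dots> = 2 * A * (L powr (1 - \<alpha>) / (1 - \<alpha>)) * (L - \<theta>)"
    by (simp only: mult_ac)
  finally show ?thesis unfolding right_integral_def by simp
qed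

text \<open>The factor \<open>\<theta> (L - \<theta>)\<close> says that the angular velocity \<open>2 G\<close> vanishes linearly at both ends, so that
the transport does not carry mass through the rays.\<close>

lemma green_upper:
  assumes "0 < \<theta>" "\<theta> < L"
  shows "\<bar>green L g \<theta>\<bar> \<le> A * green_const L \<alpha> * (\<theta> * (L - \<theta>))"
proof -
  let ?a = "left_integral g \<theta>" and ?b = "right_integral L g \<theta>"
  have "\<bar>sin (2 * (L - \<theta>)) * ?a + sin (2 * \<theta>) * ?b\<bar> \<le>
      \<bar>sin (2 * (L - \<theta>))\<bar> * \<bar>?a\<bar> + \<bar>sin (2 * \<theta>)\<bar> * \<bar>?b\<bar>"
    by (metis abs_mult abs_triangle_ineq)
  also have "\<dots> \<le> (2 * (L - \<theta>)) * (2 * A * L powr (1 - \<alpha>) * \<theta>) +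
      (2 * \<theta>) * (2 * A * (L powr (1 - \<alpha>) / (1 - \<alpha>)) * (L - \<theta>))"
    using sin_bounds[of \<theta>] assms integral_left_bound[of \<theta>] integral_right_bound[of \<theta>]
    by (intro add_mono mult_mono) auto
  also have "\<dots> = 4 * A * L powr (1 - \<alpha>) * (1 + 1 / (1 - \<alpha>)) * (\<theta> * (L - \<theta>))"
    by (simp add: algebra_simps)
  finally have "\<bar>sin (2 * (L - \<theta>)) * ?a + sin (2 * \<theta>) * ?b\<bar> / (2 * sin (2 * L)) \<le>
      4 * A * L powr (1 - \<alpha>) * (1 + 1 / (1 - \<alpha>)) * (\<theta> * (L - \<theta>)) / (2 * sin (2 * L))"
    using sin_2L by (intro divide_right_mono) auto
  moreover have "\<bar>green L g \<theta>\<bar> = \<bar>sin (2 * (L - \<theta>)) * ?a + sin (2 * \<theta>) * ?b\<bar> / (2 * sin (2 * L))"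
    unfolding green_def using sin_2L by (simp add: abs_divide)
  moreover have "4 * A * L powr (1 - \<alpha>) * (1 + 1 / (1 - \<alpha>)) * (\<theta> * (L - \<theta>)) / (2 * sin (2 * L)) =
      A * green_const L \<alpha> * (\<theta> * (L - \<theta>))"
    by (simp add: green_const_def)
  ultimately show ?thesis by linarith
qed

text \<open>The Green function is positive because \<open>sin(2 \<theta>)\<close> and \<open>sin(2 (L - \<theta>))\<close> are. In each of the two integrals
the missing fundamental solution is inserted under the integral sign at the cost of a factor at most 1.\<close>

lemma green_lower:
  assumes neg: "\<And>s. 0 < s \<Longrightarrow> s < L \<Longrightarrow> g s \<le> 0" and \<theta>: "0 < \<theta>" "\<theta> < L"
  shows "1 / (4 * L * sin (2 * L)) * moment L g * (\<theta> * (L - \<theta>)) \<le> green L g \<theta>"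
proof -
  let ?w = "\<lambda>s. sin (2 * s) * (sin (2 * (L - s)) * g s)"
  let ?a = "left_integral g \<theta>" and ?b = "right_integral L g \<theta>"
  have int: "?w integrable_on {0..L}" "?w integrable_on {0..\<theta>}" "?w integrable_on {\<theta>..L}"
    by (rule integrable_continuous_real, rule continuous_on_subset[OF continuous_moment]; use \<theta> in auto)+
  have w: "?w s \<le> 0" if "0 \<le> s" "s \<le> L" for s
  proof (cases "s = 0 \<or> s = L")
    case False
    then show ?thesis
      using that by (intro mult_nonneg_nonpos sin_bounds neg) auto
  qed auto
  have a: "?a \<le> integral {0..\<theta>} ?w"
    unfolding left_integral_def
  proof (rule integral_le)
    fix s assume s: "s \<in> {0..\<theta>}"
    then have "sin (2 * s) * g s \<le> 0"
      using \<theta> by (cases "s = 0") (auto intro!: mult_nonneg_nonpos sin_bounds neg)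
    then have "1 * (sin (2 * s) * g s) \<le> sin (2 * (L - s)) * (sin (2 * s) * g s)"
      by (intro mult_right_mono_neg) auto
    then show "sin (2 * s) * g s \<le> ?w s" by (simp add: mult_ac)
  qed (use \<theta> int in \<open>auto intro!: integrable_continuous_real continuous_left\<close>)
  have b: "?b \<le> integral {\<theta>..L} ?w"
    unfolding right_integral_def
  proof (rule integral_le)
    fix s assume s: "s \<in> {\<theta>..L}"
    have "sin (2 * (L - s)) * g s \<le> 0"
    proof (cases "s = L")
      case False
      then show ?thesis
        using s \<theta> by (intro mult_nonneg_nonpos sin_bounds neg) auto
    qed simp
    then have "1 * (sin (2 * (L - s)) * g s) \<le> sin (2 * s) * (sin (2 * (L - s)) * g s)"
      by (intro mult_right_mono_neg) auto
    then show "sin (2 * (L - s)) * g s \<le> ?w s" by simp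
  next
    show "(\<lambda>s. sin (2 * (L - s)) * g s) integrable_on {\<theta>..L}"
      using \<theta> by (intro integrable_continuous_real continuous_right)
  qed (use int in auto)
  have nonpos: "integral {0..\<theta>} ?w \<le> 0" "integral {\<theta>..L} ?w \<le> 0"
    using integral_le[OF int(2) integrable_0] integral_le[OF int(3) integrable_0] w \<theta> by simp_all
  define k where "k = \<theta> * (L - \<theta>) / (2 * L)"
  have k: "0 \<le> k" "k \<le> sin (2 * (L - \<theta>))" "k \<le> sin (2 * \<theta>)"
  proof -
    show "0 \<le> k" using \<theta> L by (simp add: k_def)
    have "k \<le> L * (L - \<theta>) / (2 * L)"
      unfolding k_def using \<theta> L by (intro divide_right_mono mult_right_mono) auto
    then show "k \<le> sin (2 * (L - \<theta>))"
      using sin_bounds(4)[of \<theta>] \<theta> L by simp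
    have "k \<le> \<theta> * L / (2 * L)"
      unfolding k_def using \<theta> L by (intro divide_right_mono mult_left_mono) auto
    then show "k \<le> sin (2 * \<theta>)"
      using sin_bounds(1)[of \<theta>] \<theta> L by simp
  qed
  have "k * (- integral {0..\<theta>} ?w) \<le> sin (2 * (L - \<theta>)) * (- ?a)"
    using k a nonpos by (intro mult_mono) auto
  moreover have "k * (- integral {\<theta>..L} ?w) \<le> sin (2 * \<theta>) * (- ?b)"
    using k b nonpos by (intro mult_mono) auto
  moreover have "integral {0..\<theta>} ?w + integral {\<theta>..L} ?w = integral {0..L} ?w"
    using \<theta> int(1) by (intro Henstock_Kurzweil_Integration.integral_combine) auto
  then have "moment L g = - integral {0..\<theta>} ?w + - integral {\<theta>..L} ?w"
    unfolding moment_def by linarith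
  then have "k * moment L g = k * (- integral {0..\<theta>} ?w) + k * (- integral {\<theta>..L} ?w)"
    by (simp only: distrib_left)
  ultimately have "k * moment L g \<le> - (sin (2 * (L - \<theta>)) * ?a + sin (2 * \<theta>) * ?b)"
    by simp
  then have "k * moment L g / (2 * sin (2 * L)) \<le> green L g \<theta>"
    unfolding green_def using sin_2L by (intro divide_right_mono) auto
  moreover have "k * moment L g / (2 * sin (2 * L)) = 1 / (4 * L * sin (2 * L)) * moment L g * (\<theta> * (L - \<theta>))"
    by (simp add: k_def mult_ac)
  ultimately show ?thesis by simp
qed

lemma green'_upper:
  assumes "0 < \<theta>" "\<theta> < L"
  shows "\<bar>green' L g \<theta>\<bar> \<le> A * green_const L \<alpha> * L"
proof -
  let ?a = "left_integral g \<theta>" and ?b = "right_integral L g \<theta>"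
  let ?p = "2 * A * L powr (1 - \<alpha>)" and ?q = "2 * A * (L powr (1 - \<alpha>) / (1 - \<alpha>))"
  have pq: "0 \<le> ?p" "0 \<le> ?q"
    using A_nonneg \<alpha> by auto
  have "\<bar>cos (2 * (L - \<theta>)) * ?a - cos (2 * \<theta>) * ?b\<bar> \<le>
      \<bar>cos (2 * (L - \<theta>))\<bar> * \<bar>?a\<bar> + \<bar>cos (2 * \<theta>)\<bar> * \<bar>?b\<bar>"
    by (metis abs_mult abs_triangle_ineq4)
  also have "\<dots> \<le> 1 * (?p * \<theta>) + 1 * (?q * (L - \<theta>))"
    using assms integral_left_bound[of \<theta>] integral_right_bound[of \<theta>]
    by (intro add_mono mult_mono) auto
  also have "\<dots> \<le> ?p * L + ?q * L"
    using mult_left_mono[of \<theta> L ?p] mult_left_mono[of "L - \<theta>" L ?q] assms pq by simp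
  also have "\<dots> = A * (2 * L powr (1 - \<alpha>) * (1 + 1 / (1 - \<alpha>))) * L"
    by (simp add: algebra_simps)
  finally have "\<bar>cos (2 * (L - \<theta>)) * ?a - cos (2 * \<theta>) * ?b\<bar> / sin (2 * L) \<le>
      A * (2 * L powr (1 - \<alpha>) * (1 + 1 / (1 - \<alpha>))) * L / sin (2 * L)"
    using sin_2L by (intro divide_right_mono) auto
  moreover have "\<bar>green' L g \<theta>\<bar> = \<bar>cos (2 * (L - \<theta>)) * ?a - cos (2 * \<theta>) * ?b\<bar> / sin (2 * L)"
    unfolding green'_def using sin_2L by (simp add: abs_divide)
  ultimately show ?thesis by (simp add: green_const_def)
qed

lemma green_ends: "green L g 0 = 0" "green L g L = 0"
  by (simp_all add: green_def left_integral_def right_integral_def)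

lemma continuous_green: "continuous_on {0..L} (green L g)"
  unfolding continuous_on_eq_continuous_within
proof
  fix x assume x: "x \<in> {0..L}"
  show "continuous (at x within {0..L}) (green L g)"
  proof (cases "x = 0 \<or> x = L")
    case False
    with x have "0 < x" "x < L" by auto
    then show ?thesis
      by (rule continuous_at_imp_continuous_at_within[OF DERIV_isCont[OF DERIV_green]])
  next
    case True
    have ends: "\<theta> * (L - \<theta>) = 0" "green L g \<theta> = 0" if "\<theta> = 0 \<or> \<theta> = L" for \<theta>
      using that
    proof (atomize (full), elim disjE)
      assume "\<theta> = 0"
      show "\<theta> * (L - \<theta>) = 0 \<and> green L g \<theta> = 0"
        unfolding \<open>\<theta> = 0\<close> green_ends(1) by simp
    next
      assume "\<theta> = L"
      show "\<theta> * (L - \<theta>) = 0 \<and> green L g \<theta> = 0"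
        unfolding \<open>\<theta> = L\<close> green_ends(2) by simp
    qed
    note x0 = ends[OF True]
    define k where "k = A * green_const L \<alpha>"
    have "((\<lambda>\<theta>. k * (\<theta> * (L - \<theta>))) \<longlongrightarrow> k * (x * (L - x))) (at x within {0..L})"
      by (intro tendsto_intros)
    then have lim: "((\<lambda>\<theta>. k * (\<theta> * (L - \<theta>))) \<longlongrightarrow> 0) (at x within {0..L})"
      unfolding x0 by simp
    have "norm (green L g \<theta>) \<le> k * (\<theta> * (L - \<theta>))" if "\<theta> \<in> {0..L}" for \<theta>
    proof (cases "\<theta> = 0 \<or> \<theta> = L")
      case False
      with that have "0 < \<theta>" "\<theta> < L" by auto
      then show ?thesis
        unfolding k_def real_norm_def by (rule green_upper)
    next
      case True
      show ?thesis
        unfolding ends[OF True] by simp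
    qed
    then have "\<forall>\<^sub>F \<theta> in at x within {0..L}. norm (green L g \<theta>) \<le> k * (\<theta> * (L - \<theta>))"
      unfolding eventually_at_filter by simp
    from Lim_null_comparison[OF this lim] show ?thesis
      by (simp add: continuous_within x0)
  qed
qed

end

context angular_profile
begin

lemma moment_integrable: "(\<lambda>s. sin (2 * s) * (sin (2 * (L - s)) * g s)) integrable_on {0..L}"
  by (rule integrable_continuous_real[OF continuous_moment])

lemma moment_bound: "\<bar>moment L g\<bar> \<le> A * (2 * L powr (1 - \<alpha>) * L)"
proof -
  have "norm (integral {0..L} (\<lambda>s. sin (2 * s) * (sin (2 * (L - s)) * g s))) \<le> 2 * A * L powr (1 - \<alpha>) * (L - 0)"
  proof (intro integral_bound continuous_moment ballI)
    fix s assume s: "s \<in> {0..L}"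
    show "norm (sin (2 * s) * (sin (2 * (L - s)) * g s)) \<le> 2 * A * L powr (1 - \<alpha>)"
    proof (cases "s = 0 \<or> s = L")
      case True
      then have zero: "sin (2 * s) * (sin (2 * (L - s)) * g s) = 0" by (elim disjE) simp_all
      show ?thesis unfolding zero using A_nonneg by simp
    next
      case False
      then have s: "0 < s" "s < L" using s by auto
      have "norm (sin (2 * s) * (sin (2 * (L - s)) * g s)) \<le> (2 * s) * (1 * (A * s powr - \<alpha>))"
        unfolding norm_mult using s bound[of s] sin_bounds(2,3)[of s] by (intro mult_mono) auto
      also have "\<dots> = 2 * A * s powr (1 - \<alpha>)"
        using s by (simp add: powr_diff powr_minus divide_simps)
      also have "\<dots> \<le> 2 * A * L powr (1 - \<alpha>)"
        using A_nonneg s \<alpha> by (intro mult_left_mono powr_mono2) auto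
      finally show ?thesis .
    qed
  qed (use L in auto)
  then show ?thesis by (simp add: moment_def mult_ac)
qed

lemma moment_pos:
  assumes "\<And>\<theta>. 0 < \<theta> \<Longrightarrow> \<theta> < L \<Longrightarrow> g \<theta> < 0"
  shows "0 < moment L g"
proof -
  let ?w = "\<lambda>s. - (sin (2 * s) * (sin (2 * (L - s)) * g s))"
  have c: "continuous_on {0..L} ?w"
    by (rule continuous_on_minus[OF continuous_moment])
  have w: "0 \<le> ?w s" if "s \<in> {0..L}" for s
  proof (cases "s = 0 \<or> s = L")
    case True
    then show ?thesis by (elim disjE) simp_all
  next
    case False
    then have "0 < s" "s < L" using that by auto
    then have "sin (2 * s) * (sin (2 * (L - s)) * g s) \<le> 0"
      using assms[of s] sin_bounds[of s] by (intro mult_nonneg_nonpos) auto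
    then show ?thesis by simp
  qed
  have "integral {0..L} ?w \<noteq> 0"
  proof
    assume "integral {0..L} ?w = 0"
    then have "\<forall>s\<in>{0..L}. ?w s = 0"
      using integral_eq_0_iff[OF c L(1) w] by blast
    then have "?w (L / 2) = 0"
      using L by (elim bspec) simp
    moreover have "0 < L / 2" "L / 2 < L" using L by auto
    ultimately show False
      using assms[of "L / 2"] sin_bounds(1,4)[of "L / 2"] L by auto
  qed
  moreover have "0 \<le> integral {0..L} ?w"
    using w by (intro integral_nonneg integrable_continuous_real c) auto
  ultimately show ?thesis
    by (simp add: moment_def)
qed

end

lemma moment_diff:
  assumes "angular_profile L \<alpha> A g" "angular_profile L \<alpha> B h"
  shows "moment L (\<lambda>s. g s - h s) = moment L g - moment L h"
proof -
  have "(\<lambda>s. sin (2 * s) * (sin (2 * (L - s)) * (g s - h s))) =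
      (\<lambda>s. sin (2 * s) * (sin (2 * (L - s)) * g s) - sin (2 * s) * (sin (2 * (L - s)) * h s))"
    by (simp add: right_diff_distrib)
  then show ?thesis
    unfolding moment_def
    using integral_diff[OF angular_profile.moment_integrable[OF assms(1)] angular_profile.moment_integrable[OF assms(2)]]
    by simp
qed

lemma moment_mono:
  assumes "angular_profile L \<alpha> A g" "angular_profile L \<alpha> B h"
    and le: "\<And>\<theta>. 0 < \<theta> \<Longrightarrow> \<theta> < L \<Longrightarrow> g \<theta> \<le> h \<theta>"
  shows "moment L h \<le> moment L g"
  unfolding moment_def neg_le_iff_le
proof (rule integral_le)
  fix s assume s: "s \<in> {0..L}"
  show "sin (2 * s) * (sin (2 * (L - s)) * g s) \<le> sin (2 * s) * (sin (2 * (L - s)) * h s)"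
  proof (cases "s = 0 \<or> s = L")
    case True
    then show ?thesis by (elim disjE) simp_all
  next
    case False
    then have "0 < s" "s < L" using s by auto
    then show ?thesis
      using le[of s] angular_profile.sin_bounds[OF assms(1), of s] by (intro mult_left_mono) auto
  qed
qed (use assms angular_profile.moment_integrable in blast)+

lemma moment_scale: "moment L (\<lambda>s. c * g s) = c * moment L g"
proof -
  have "(\<lambda>s. sin (2 * s) * (sin (2 * (L - s)) * (c * g s))) =
      (\<lambda>s. c * (sin (2 * s) * (sin (2 * (L - s)) * g s)))"
    by (simp add: mult_ac)
  then show ?thesis
    by (simp add: moment_def)
qed

definition growth_moment :: "real \<Rightarrow> real \<Rightarrow> real" where
  "growth_moment L \<alpha> = moment L (\<lambda>\<theta>. - (((L - \<theta>) / \<theta>) powr \<alpha>))"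

lemma growth_profile:
  assumes "0 < L" "L \<le> pi / 3" "0 < \<alpha>" "\<alpha> < 1" "0 \<le> k"
  shows "angular_profile L \<alpha> (k * L powr \<alpha>) (\<lambda>\<theta>. k * (- (((L - \<theta>) / \<theta>) powr \<alpha>)))"
proof
  show "continuous_on {0<..<L} (\<lambda>\<theta>. k * (- (((L - \<theta>) / \<theta>) powr \<alpha>)))"
    by (intro continuous_intros) auto
  fix \<theta> assume \<theta>: "0 < \<theta>" "\<theta> < L"
  have "((L - \<theta>) / \<theta>) powr \<alpha> \<le> (L / \<theta>) powr \<alpha>"
    using \<theta> assms by (intro powr_mono2 divide_right_mono) auto
  also have "\<dots> = L powr \<alpha> * \<theta> powr - \<alpha>"
    using \<theta> by (simp add: powr_divide powr_minus_divide)
  finally show "\<bar>k * (- (((L - \<theta>) / \<theta>) powr \<alpha>))\<bar> \<le> k * L powr \<alpha> * \<theta> powr - \<alpha>"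
    using assms by (simp add: abs_mult mult.assoc mult_left_mono)
qed (use assms in auto)

lemma growth_moment_pos:
  assumes "0 < L" "L \<le> pi / 3" "0 < \<alpha>" "\<alpha> < 1"
  shows "0 < growth_moment L \<alpha>"
  unfolding growth_moment_def
  using angular_profile.moment_pos[OF growth_profile[OF assms, of 1]] by simp

section \<open>Comparison in a strip\<close>

text \<open>The frequency \<open>11/4\<close> lies between \<open>5/2\<close>, the largest radial exponent used below, and \<open>3 \<le> m\<close>, the lowest
Dirichlet frequency of the sector: so the cosine is positive up to the boundary rays, and its product
with \<open>exp (\<mu> s)\<close> for \<open>\<mu> \<le> 5/2\<close> is strictly superharmonic.\<close>

lemma cos_barrier:
  assumes "0 < L" "L \<le> pi / 3" "0 \<le> \<theta>" "\<theta> \<le> L"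
  shows "cos (11 * pi / 24) \<le> cos (11 / 4 * (\<theta> - L / 2))" "0 < cos (11 * pi / 24)"
proof -
  have "\<bar>\<theta> - L / 2\<bar> \<le> L / 2"
    using assms unfolding abs_le_iff by linarith
  then have "\<bar>11 / 4 * (\<theta> - L / 2)\<bar> \<le> 11 * pi / 24"
    using assms unfolding abs_mult by simp
  then have "cos (11 * pi / 24) \<le> cos \<bar>11 / 4 * (\<theta> - L / 2)\<bar>"
    by (intro cos_monotone_0_pi_le) auto
  then show "cos (11 * pi / 24) \<le> cos (11 / 4 * (\<theta> - L / 2))"
    unfolding cos_abs_real .
  show "0 < cos (11 * pi / 24)"
    by (rule cos_gt_zero_pi) auto
qed

definition strip_const :: "real \<Rightarrow> real \<Rightarrow> real" where
  "strip_const L \<beta> = (1 / ((2 - \<beta>) * (1 - \<beta>)) * L powr (2 - \<beta>) + 1) / cos (11 * pi / 24)"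

text \<open>A Phragmen-Lindeloef argument with the barrier \<open>A exp(\<mu> s) H(\<theta>)\<close>. The term \<open>\<theta> powr (2 - \<beta>)\<close> in \<open>H\<close>
absorbs the singularity \<open>\<theta> powr - \<beta>\<close> of the right-hand side, the cosine keeps \<open>H \<ge> 1\<close>. As \<open>\<mu> > 2\<close> is larger than the
growth exponent of \<open>v\<close>, the barrier wins as \<open>s \<rightarrow> \<infinity>\<close>, while \<open>v\<close> itself tends to 0 as \<open>s \<rightarrow> -\<infinity>\<close>. The conclusion is
independent of \<open>C\<close>, which for the stream function may depend on time in an uncontrolled way.\<close>

lemma strip_comparison_upper:
  fixes L \<beta> \<mu> :: real
  assumes L: "0 < L" "L \<le> pi / 3" and \<beta>: "0 < \<beta>" "\<beta> < 1" and \<mu>: "2 < \<mu>" "\<mu> \<le> 5 / 2"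
  fixes v vx vxx vy vyy :: "real \<Rightarrow> real \<Rightarrow> real"
  assumes A: "A > 0"
    and cont: "continuous_on (UNIV \<times> {0..L}) (\<lambda>(s, \<theta>). v s \<theta>)"
    and zero: "\<And>s. v s 0 = 0" "\<And>s. v s L = 0"
    and growth: "\<And>s \<theta>. 0 < \<theta> \<Longrightarrow> \<theta> < L \<Longrightarrow> \<bar>v s \<theta>\<bar> \<le> C * exp (2 * s)"
    and vx: "\<And>s \<theta>. 0 < \<theta> \<Longrightarrow> \<theta> < L \<Longrightarrow> ((\<lambda>s. v s \<theta>) has_real_derivative vx s \<theta>) (at s)"
    and vxx: "\<And>s \<theta>. 0 < \<theta> \<Longrightarrow> \<theta> < L \<Longrightarrow> ((\<lambda>s. vx s \<theta>) has_real_derivative vxx s \<theta>) (at s)"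
    and vy: "\<And>s \<theta>. 0 < \<theta> \<Longrightarrow> \<theta> < L \<Longrightarrow> ((\<lambda>\<theta>. v s \<theta>) has_real_derivative vy s \<theta>) (at \<theta>)"
    and vyy: "\<And>s \<theta>. 0 < \<theta> \<Longrightarrow> \<theta> < L \<Longrightarrow> ((\<lambda>\<theta>. vy s \<theta>) has_real_derivative vyy s \<theta>) (at \<theta>)"
    and lap: "\<And>s \<theta>. 0 < \<theta> \<Longrightarrow> \<theta> < L \<Longrightarrow>
        - (A * exp (\<mu> * s) * \<theta> powr - \<beta>) \<le> vxx s \<theta> + vyy s \<theta>"
    and \<theta>: "0 \<le> \<theta>" "\<theta> \<le> L"
  shows "v s \<theta> \<le> A * strip_const L \<beta> * exp (\<mu> * s)"
proof -
  define b where "b = 1 / ((2 - \<beta>) * (1 - \<beta>))"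
  define Q where "Q = strip_const L \<beta>"
  define H where "H \<theta> = Q * cos (11 / 4 * (\<theta> - L / 2)) - b * \<theta> powr (2 - \<beta>)" for \<theta>
  define H' where "H' \<theta> = - (11 / 4 * Q * sin (11 / 4 * (\<theta> - L / 2))) - b * (2 - \<beta>) * \<theta> powr (1 - \<beta>)" for \<theta>
  define H'' where "H'' \<theta> = - ((11 / 4)\<^sup>2 * Q * cos (11 / 4 * (\<theta> - L / 2))) - (\<theta> powr - \<beta>)" for \<theta>
  have b: "b > 0" "b * (2 - \<beta>) * (1 - \<beta>) = 1"
    using \<beta> by (auto simp: b_def)
  have c0: "0 < cos (11 * pi / 24)"
    by (rule cos_gt_zero_pi) auto
  have Q: "Q > 0" "Q * cos (11 * pi / 24) = b * L powr (2 - \<beta>) + 1"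
    using b c0 by (auto simp: Q_def strip_const_def b_def intro!: divide_pos_pos add_nonneg_pos)
  have H_ge: "1 \<le> H \<theta>" and H_le: "H \<theta> \<le> Q" if "0 \<le> \<theta>" "\<theta> \<le> L" for \<theta>
  proof -
    have "Q * cos (11 * pi / 24) \<le> Q * cos (11 / 4 * (\<theta> - L / 2))"
      using Q cos_barrier(1)[OF L that] by (intro mult_left_mono) auto
    moreover have "b * \<theta> powr (2 - \<beta>) \<le> b * L powr (2 - \<beta>)"
      using b that \<beta> by (intro mult_left_mono powr_mono2) auto
    ultimately show "1 \<le> H \<theta>"
      unfolding H_def using Q(2) by linarith
    have "Q * cos (11 / 4 * (\<theta> - L / 2)) \<le> Q * 1"
      using Q by (intro mult_left_mono) auto
    then show "H \<theta> \<le> Q"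
      unfolding H_def using b by (smt (verit) mult_nonneg_nonneg powr_ge_zero)
  qed
  have H': "(H has_real_derivative H' \<theta>) (at \<theta>)" if "0 < \<theta>" for \<theta>
    unfolding H_def H'_def using that
    by (auto intro!: derivative_eq_intros)
  have H'': "(H' has_real_derivative H'' \<theta>) (at \<theta>)" if "0 < \<theta>" for \<theta>
  proof -
    have "(H' has_real_derivative - ((11 / 4)\<^sup>2 * Q * cos (11 / 4 * (\<theta> - L / 2))) -
        b * (2 - \<beta>) * (1 - \<beta>) * \<theta> powr - \<beta>) (at \<theta>)"
      unfolding H'_def using that
      by (auto intro!: derivative_eq_intros simp: power2_eq_square)
    then show ?thesis
      by (simp add: b H''_def)
  qed
  have super: "\<mu>\<^sup>2 * H \<theta> + H'' \<theta> < - (\<theta> powr - \<beta>)" if "0 < \<theta>" "\<theta> < L" for \<theta>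
  proof -
    have "0 < cos (11 / 4 * (\<theta> - L / 2))"
      using cos_barrier[OF L, of \<theta>] that by linarith
    moreover have "\<mu>\<^sup>2 \<le> (5 / 2)\<^sup>2"
      using \<mu> by (intro power_mono) auto
    then have "\<mu>\<^sup>2 < (11 / 4)\<^sup>2"
      by (simp add: power2_eq_square)
    ultimately have "\<mu>\<^sup>2 * (Q * cos (11 / 4 * (\<theta> - L / 2))) < (11 / 4)\<^sup>2 * (Q * cos (11 / 4 * (\<theta> - L / 2)))"
      using Q by (intro mult_strict_right_mono) auto
    moreover have "0 \<le> \<mu>\<^sup>2 * (b * \<theta> powr (2 - \<beta>))"
      using b by simp
    ultimately show ?thesis
      by (simp add: H_def H''_def algebra_simps)
  qed
  have contH: "continuous_on {0..L} H"
    unfolding H_def using \<beta> by (intro continuous_intros continuous_on_powr') auto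
  have main: "v s \<theta> - A * exp (\<mu> * s) * H \<theta> - \<kappa> \<le> 0" if \<kappa>: "\<kappa> > 0" for \<kappa>
  proof -
    \<comment> \<open>The rectangle is chosen so that \<open>w \<le> 0\<close> holds on its left side because of \<open>\<kappa>\<close> and on its right side because of the
      barrier.\<close>
    define s1 where "s1 = min s (ln (\<kappa> / (\<bar>C\<bar> + 1)) / 2)"
    define s2 where "s2 = max s (\<bar>C\<bar> / A / (\<mu> - 2))"
    have s1: "s1 \<le> s" "C * exp (2 * s1) < \<kappa>"
    proof -
      have "exp (2 * s1) \<le> exp (ln (\<kappa> / (\<bar>C\<bar> + 1)))"
        by (simp add: s1_def)
      also have "\<dots> = \<kappa> / (\<bar>C\<bar> + 1)"
        using \<kappa> by (intro exp_ln) auto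
      finally have "\<bar>C\<bar> * exp (2 * s1) \<le> \<bar>C\<bar> * (\<kappa> / (\<bar>C\<bar> + 1))"
        by (intro mult_left_mono) auto
      also have "\<dots> < \<kappa>"
        using \<kappa> by (simp add: field_simps)
      finally show "C * exp (2 * s1) < \<kappa>"
        by (smt (verit) exp_gt_zero mult_right_mono)
    qed (simp add: s1_def)
    have s2: "s \<le> s2" "C * exp (2 * s2) < A * exp (\<mu> * s2)"
    proof -
      have "\<bar>C\<bar> / A \<le> (\<mu> - 2) * s2"
        using \<mu> by (simp add: s2_def pos_divide_le_eq[symmetric] mult.commute[of "\<mu> - 2"])
      also have "\<dots> < exp ((\<mu> - 2) * s2)"
        using exp_ge_add_one_self[of "(\<mu> - 2) * s2"] by linarith
      finally have "\<bar>C\<bar> < A * exp ((\<mu> - 2) * s2)"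
        using A by (simp add: field_simps)
      then have "C * exp (2 * s2) < A * exp ((\<mu> - 2) * s2) * exp (2 * s2)"
        by (intro mult_strict_right_mono) auto
      then show "C * exp (2 * s2) < A * exp (\<mu> * s2)"
        by (simp add: mult_exp_exp algebra_simps)
    qed (simp add: s2_def)
    define w where "w s \<theta> = v s \<theta> - A * exp (\<mu> * s) * H \<theta> - \<kappa>" for s \<theta>
    have "w s \<theta> \<le> 0"
    proof (rule max_principle_rectangle[of s1 s2 0 L w])
      have "continuous_on ({s1..s2} \<times> {0..L}) (\<lambda>p. v (fst p) (snd p))"
        using continuous_on_subset[OF cont, of "{s1..s2} \<times> {0..L}"] by (auto simp: case_prod_beta)
      moreover have "continuous_on ({s1..s2} \<times> {0..L}) (\<lambda>p. H (snd p))"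
        by (rule continuous_on_compose2[OF contH]) (auto intro!: continuous_intros)
      ultimately show "continuous_on ({s1..s2} \<times> {0..L}) (\<lambda>(s, \<theta>). w s \<theta>)"
        unfolding w_def case_prod_beta by (intro continuous_intros)
    next
      fix s \<theta> assume "s1 < s" "s < s2" and \<theta>: "0 < \<theta>" "\<theta> < L"
      note [derivative_intros] = vx[OF \<theta>] vxx[OF \<theta>] vy[OF \<theta>] vyy[OF \<theta>] H'[OF \<theta>(1)] H''[OF \<theta>(1)]
      show "((\<lambda>s. w s \<theta>) has_real_derivative vx s \<theta> - A * (\<mu> * exp (\<mu> * s)) * H \<theta>) (at s)"
        unfolding w_def by (auto intro!: derivative_eq_intros)
      show "((\<lambda>s. vx s \<theta> - A * (\<mu> * exp (\<mu> * s)) * H \<theta>) has_real_derivative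
          vxx s \<theta> - A * exp (\<mu> * s) * (\<mu>\<^sup>2 * H \<theta>)) (at s)"
        by (auto intro!: derivative_eq_intros simp: power2_eq_square)
      show "((\<lambda>\<theta>. w s \<theta>) has_real_derivative vy s \<theta> - A * exp (\<mu> * s) * H' \<theta>) (at \<theta>)"
        unfolding w_def by (auto intro!: derivative_eq_intros)
      show "((\<lambda>\<theta>. vy s \<theta> - A * exp (\<mu> * s) * H' \<theta>) has_real_derivative
          vyy s \<theta> - A * exp (\<mu> * s) * H'' \<theta>) (at \<theta>)"
        by (auto intro!: derivative_eq_intros)
      have "A * exp (\<mu> * s) * (\<mu>\<^sup>2 * H \<theta> + H'' \<theta>) < A * exp (\<mu> * s) * (- (\<theta> powr - \<beta>))"
        using super[OF \<theta>] A by (intro mult_strict_left_mono) auto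
      then show "0 < vxx s \<theta> - A * exp (\<mu> * s) * (\<mu>\<^sup>2 * H \<theta>) + (vyy s \<theta> - A * exp (\<mu> * s) * H'' \<theta>)"
        using lap[OF \<theta>, of s] by (simp add: algebra_simps)
    next
      fix s \<theta> assume "s1 \<le> s" "s \<le> s2" and \<theta>: "0 \<le> \<theta>" "\<theta> \<le> L"
        and bd: "s = s1 \<or> s = s2 \<or> \<theta> = 0 \<or> \<theta> = L"
      have pos: "A * exp (\<mu> * s) * 1 \<le> A * exp (\<mu> * s) * H \<theta>"
        using A H_ge[OF \<theta>] by (intro mult_left_mono) auto
      show "w s \<theta> \<le> 0"
      proof (cases "\<theta> = 0 \<or> \<theta> = L")
        case True
        then have "v s \<theta> = 0" using zero by auto
        moreover have "0 < A * exp (\<mu> * s)" using A by simp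
        ultimately show ?thesis
          using pos \<kappa> by (simp add: w_def)
      next
        case False
        then have "v s \<theta> \<le> C * exp (2 * s)"
          using growth[of \<theta> s] \<theta> by auto
        moreover have "0 < A * exp (\<mu> * s)" using A by simp
        moreover have "s = s1 \<or> s = s2" using bd False by auto
        ultimately show ?thesis
          using pos \<kappa> s1(2) s2(2) by (auto simp: w_def)
      qed
    qed (use s1 s2 \<theta> in auto)
    then show ?thesis by (simp add: w_def)
  qed
  have "v s \<theta> - A * exp (\<mu> * s) * H \<theta> \<le> 0"
  proof (rule field_le_epsilon)
    fix e :: real assume "0 < e"
    from main[OF this] show "v s \<theta> - A * exp (\<mu> * s) * H \<theta> \<le> 0 + e" by simp
  qed
  moreover have "A * exp (\<mu> * s) * H \<theta> \<le> A * exp (\<mu> * s) * Q"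
    using A H_le[OF \<theta>] by (intro mult_left_mono) auto
  ultimately show ?thesis by (simp add: mult_ac Q_def)
qed

lemma strip_comparison:
  fixes L \<beta> \<mu> :: real
  fixes v vx vxx vy vyy :: "real \<Rightarrow> real \<Rightarrow> real"
  assumes L: "0 < L" "L \<le> pi / 3" and \<beta>: "0 < \<beta>" "\<beta> < 1" and \<mu>: "2 < \<mu>" "\<mu> \<le> 5 / 2"
    and A: "A > 0"
    and cont: "continuous_on (UNIV \<times> {0..L}) (\<lambda>(s, \<theta>). v s \<theta>)"
    and zero: "\<And>s. v s 0 = 0" "\<And>s. v s L = 0"
    and growth: "\<And>s \<theta>. 0 < \<theta> \<Longrightarrow> \<theta> < L \<Longrightarrow> \<bar>v s \<theta>\<bar> \<le> C * exp (2 * s)"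
    and vx: "\<And>s \<theta>. 0 < \<theta> \<Longrightarrow> \<theta> < L \<Longrightarrow> ((\<lambda>s. v s \<theta>) has_real_derivative vx s \<theta>) (at s)"
    and vxx: "\<And>s \<theta>. 0 < \<theta> \<Longrightarrow> \<theta> < L \<Longrightarrow> ((\<lambda>s. vx s \<theta>) has_real_derivative vxx s \<theta>) (at s)"
    and vy: "\<And>s \<theta>. 0 < \<theta> \<Longrightarrow> \<theta> < L \<Longrightarrow> ((\<lambda>\<theta>. v s \<theta>) has_real_derivative vy s \<theta>) (at \<theta>)"
    and vyy: "\<And>s \<theta>. 0 < \<theta> \<Longrightarrow> \<theta> < L \<Longrightarrow> ((\<lambda>\<theta>. vy s \<theta>) has_real_derivative vyy s \<theta>) (at \<theta>)"
    and lap: "\<And>s \<theta>. 0 < \<theta> \<Longrightarrow> \<theta> < L \<Longrightarrow>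
        \<bar>vxx s \<theta> + vyy s \<theta>\<bar> \<le> A * exp (\<mu> * s) * \<theta> powr - \<beta>"
    and \<theta>: "0 \<le> \<theta>" "\<theta> \<le> L"
  shows "\<bar>v s \<theta>\<bar> \<le> A * strip_const L \<beta> * exp (\<mu> * s)"
proof -
  have cont': "continuous_on (UNIV \<times> {0..L}) (\<lambda>(s, \<theta>). - v s \<theta>)"
    using continuous_on_minus[OF cont] by (simp add: case_prod_beta)
  have lap': "- (A * exp (\<mu> * s) * \<theta> powr - \<beta>) \<le> vxx s \<theta> + vyy s \<theta>"
    "- (A * exp (\<mu> * s) * \<theta> powr - \<beta>) \<le> - vxx s \<theta> + - vyy s \<theta>" if "0 < \<theta>" "\<theta> < L" for s \<theta>
    using lap[OF that, of s] by (auto simp: abs_le_iff)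
  have "v s \<theta> \<le> A * strip_const L \<beta> * exp (\<mu> * s)"
    by (rule strip_comparison_upper[OF L \<beta> \<mu> A cont zero growth vx vxx vy vyy lap'(1) \<theta>])
  moreover have "- v s \<theta> \<le> A * strip_const L \<beta> * exp (\<mu> * s)"
    by (rule strip_comparison_upper[OF L \<beta> \<mu> A cont' _ _ _ DERIV_minus[OF vx] DERIV_minus[OF vxx]
          DERIV_minus[OF vy] DERIV_minus[OF vyy] lap'(2) \<theta>]) (use zero growth in auto)
  ultimately show ?thesis by simp
qed

definition grad_const :: "real \<Rightarrow> real \<Rightarrow> real \<Rightarrow> real \<Rightarrow> real" where
  "grad_const L \<beta> \<mu> \<delta> =
     (4 * strip_const L \<beta> / \<delta> + (\<delta> / 2) powr - \<beta> * (\<delta> / 2)) * exp (\<mu> * (\<delta> / 2))"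

text \<open>Here \<open>P\<close> is the stream function in the variables \<open>s = ln r\<close> and \<open>\<theta>\<close>. The function \<open>exp(2s) G\<close> solves the
equation with \<open>F\<close> replaced by its limit \<open>g\<close> as \<open>s \<rightarrow> -\<infinity>\<close>; the difference is controlled in the strip by
comparison, and its first derivatives on a square of side \<open>\<delta>\<close> by the interior estimate.\<close>

lemma (in angular_profile) velocity_asymptotics:
  fixes \<gamma> :: real
  fixes P Px Pxx Py Pyy F :: "real \<Rightarrow> real \<Rightarrow> real"
  assumes \<gamma>: "0 < \<gamma>" "\<gamma> \<le> 1 / 2" "\<alpha> + \<gamma> < 1" and B: "B > 0"
    and contP: "continuous_on (UNIV \<times> {0..L}) (\<lambda>(s, \<theta>). P s \<theta>)"
    and zero: "\<And>s. P s 0 = 0" "\<And>s. P s L = 0"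
    and growth: "\<And>s \<theta>. 0 < \<theta> \<Longrightarrow> \<theta> < L \<Longrightarrow> \<bar>P s \<theta>\<bar> \<le> C * exp (2 * s)"
    and Px: "\<And>s \<theta>. 0 < \<theta> \<Longrightarrow> \<theta> < L \<Longrightarrow> ((\<lambda>s. P s \<theta>) has_real_derivative Px s \<theta>) (at s)"
    and Pxx: "\<And>s \<theta>. 0 < \<theta> \<Longrightarrow> \<theta> < L \<Longrightarrow> ((\<lambda>s. Px s \<theta>) has_real_derivative Pxx s \<theta>) (at s)"
    and Py: "\<And>s \<theta>. 0 < \<theta> \<Longrightarrow> \<theta> < L \<Longrightarrow> ((\<lambda>\<theta>. P s \<theta>) has_real_derivative Py s \<theta>) (at \<theta>)"
    and Pyy: "\<And>s \<theta>. 0 < \<theta> \<Longrightarrow> \<theta> < L \<Longrightarrow> ((\<lambda>\<theta>. Py s \<theta>) has_real_derivative Pyy s \<theta>) (at \<theta>)"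
    and lap: "\<And>s \<theta>. 0 < \<theta> \<Longrightarrow> \<theta> < L \<Longrightarrow> Pxx s \<theta> + Pyy s \<theta> = exp (2 * s) * F s \<theta>"
    and near: "\<And>s \<theta>. 0 < \<theta> \<Longrightarrow> \<theta> < L \<Longrightarrow> \<bar>F s \<theta> - g \<theta>\<bar> \<le> B * exp (\<gamma> * s) * \<theta> powr - (\<alpha> + \<gamma>)"
    and \<delta>: "0 < \<delta>" "\<delta> \<le> \<theta>" "\<theta> \<le> L - \<delta>"
  shows "\<bar>Px s \<theta> - 2 * exp (2 * s) * green L g \<theta>\<bar> \<le> B * grad_const L (\<alpha> + \<gamma>) (2 + \<gamma>) \<delta> * exp ((2 + \<gamma>) * s)"
    and "\<bar>Py s \<theta> - exp (2 * s) * green' L g \<theta>\<bar> \<le> B * grad_const L (\<alpha> + \<gamma>) (2 + \<gamma>) \<delta> * exp ((2 + \<gamma>) * s)"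
proof -
  define \<mu> where "\<mu> = 2 + \<gamma>"
  define \<beta> where "\<beta> = \<alpha> + \<gamma>"
  have \<mu>: "2 < \<mu>" "\<mu> \<le> 5 / 2" and \<beta>: "0 < \<beta>" "\<beta> < 1"
    using \<gamma> \<alpha> by (auto simp: \<mu>_def \<beta>_def)
  define v where "v s \<theta> = P s \<theta> - exp (2 * s) * green L g \<theta>" for s \<theta>
  define vx where "vx s \<theta> = Px s \<theta> - 2 * exp (2 * s) * green L g \<theta>" for s \<theta>
  define vxx where "vxx s \<theta> = Pxx s \<theta> - 4 * exp (2 * s) * green L g \<theta>" for s \<theta>
  define vy where "vy s \<theta> = Py s \<theta> - exp (2 * s) * green' L g \<theta>" for s \<theta>
  define vyy where "vyy s \<theta> = Pyy s \<theta> - exp (2 * s) * (g \<theta> - 4 * green L g \<theta>)" for s \<theta>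
  have cont_v: "continuous_on (UNIV \<times> {0..L}) (\<lambda>(s, \<theta>). v s \<theta>)"
  proof -
    have "continuous_on (UNIV \<times> {0..L}) (\<lambda>p. green L g (snd p) :: real)" for UNIV :: "real set"
      by (rule continuous_on_compose2[OF continuous_green]) (auto intro!: continuous_intros)
    then show ?thesis
      using contP unfolding v_def case_prod_beta by (intro continuous_intros)
  qed
  have v0: "v s 0 = 0" "v s L = 0" for s
    by (simp_all add: v_def zero green_ends)
  define k where "k = A * green_const L \<alpha> * (L * L)"
  have gr: "\<bar>v s \<theta>\<bar> \<le> (C + k) * exp (2 * s)" if "0 < \<theta>" "\<theta> < L" for s \<theta>
  proof -
    have "\<bar>green L g \<theta>\<bar> \<le> k"
      unfolding k_def using that
      by (intro order_trans[OF green_upper[OF that]] mult_left_mono mult_mono mult_nonneg_nonneg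
          A_nonneg green_const_nonneg) auto
    then have "\<bar>exp (2 * s) * green L g \<theta>\<bar> \<le> k * exp (2 * s)"
      by (simp add: abs_mult)
    then show ?thesis
      using growth[OF that, of s] abs_triangle_ineq4[of "P s \<theta>" "exp (2 * s) * green L g \<theta>"]
      unfolding v_def distrib_right by linarith
  qed
  have dv: "((\<lambda>s. v s \<theta>) has_real_derivative vx s \<theta>) (at s)"
    "((\<lambda>s. vx s \<theta>) has_real_derivative vxx s \<theta>) (at s)"
    "((\<lambda>\<theta>. v s \<theta>) has_real_derivative vy s \<theta>) (at \<theta>)"
    "((\<lambda>\<theta>. vy s \<theta>) has_real_derivative vyy s \<theta>) (at \<theta>)"
    if \<theta>: "0 < \<theta>" "\<theta> < L" for s \<theta>
  proof -
    note [derivative_intros] = Px[OF \<theta>] Pxx[OF \<theta>] Py[OF \<theta>] Pyy[OF \<theta>] DERIV_green[OF \<theta>] DERIV_green'[OF \<theta>]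
    show "((\<lambda>s. v s \<theta>) has_real_derivative vx s \<theta>) (at s)"
      unfolding v_def vx_def by (auto intro!: derivative_eq_intros)
    show "((\<lambda>s. vx s \<theta>) has_real_derivative vxx s \<theta>) (at s)"
      unfolding vx_def vxx_def by (auto intro!: derivative_eq_intros)
    show "((\<lambda>\<theta>. v s \<theta>) has_real_derivative vy s \<theta>) (at \<theta>)"
      unfolding v_def vy_def by (auto intro!: derivative_eq_intros)
    show "((\<lambda>\<theta>. vy s \<theta>) has_real_derivative vyy s \<theta>) (at \<theta>)"
      unfolding vy_def vyy_def by (auto intro!: derivative_eq_intros)
  qed
  have lap_v: "\<bar>vxx s \<theta> + vyy s \<theta>\<bar> \<le> B * exp (\<mu> * s) * \<theta> powr - \<beta>" if "0 < \<theta>" "\<theta> < L" for s \<theta>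
  proof -
    have "vxx s \<theta> + vyy s \<theta> = exp (2 * s) * (F s \<theta> - g \<theta>)"
      using lap[OF that, of s] by (simp add: vxx_def vyy_def algebra_simps)
    then have "\<bar>vxx s \<theta> + vyy s \<theta>\<bar> = exp (2 * s) * \<bar>F s \<theta> - g \<theta>\<bar>"
      by (simp add: abs_mult)
    also have "\<dots> \<le> exp (2 * s) * (B * exp (\<gamma> * s) * \<theta> powr - \<beta>)"
      unfolding \<beta>_def using near[OF that] by (intro mult_left_mono) auto
    also have "\<dots> = B * exp (\<mu> * s) * \<theta> powr - \<beta>"
      by (simp add: \<mu>_def algebra_simps exp_add)
    finally show ?thesis .
  qed
  have v_le: "\<bar>v s \<theta>\<bar> \<le> B * strip_const L \<beta> * exp (\<mu> * s)" if "0 \<le> \<theta>" "\<theta> \<le> L" for s \<theta>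
    by (rule strip_comparison[OF L \<beta> \<mu> B cont_v v0 gr dv lap_v that])
  have Q: "strip_const L \<beta> > 0"
    unfolding strip_const_def using \<beta> cos_barrier(2)[of L 0] L
    by (intro divide_pos_pos add_nonneg_pos) auto
  define d where "d = \<delta> / 2"
  have d: "d > 0" "\<delta> = 2 * d" using \<delta> by (auto simp: d_def)
  have box: "0 < y \<and> y < L" "d \<le> y" if "\<bar>y - \<theta>\<bar> \<le> d" for y
    using that \<delta> d by (auto simp: abs_le_iff)
  let ?e = "exp (\<mu> * (s + d))"
  have grad: "\<bar>vx s \<theta>\<bar> \<le> 2 * (B * strip_const L \<beta> * ?e) / d + (B * ?e * d powr - \<beta>) * d"
    "\<bar>vy s \<theta>\<bar> \<le> 2 * (B * strip_const L \<beta> * ?e) / d + (B * ?e * d powr - \<beta>) * d"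
  proof -
    have c: "continuous_on ({s - d..s + d} \<times> {\<theta> - d..\<theta> + d}) (\<lambda>(x, y). v x y)"
    proof (rule continuous_on_subset[OF cont_v], rule Sigma_mono)
      show "{\<theta> - d..\<theta> + d} \<subseteq> {0..L}"
      proof
        fix y assume "y \<in> {\<theta> - d..\<theta> + d}"
        then have "0 < y \<and> y < L" by (intro box(1)) (auto simp: abs_le_iff)
        then show "y \<in> {0..L}" by simp
      qed
    qed simp
    have l: "\<bar>vxx x y + vyy x y\<bar> \<le> B * ?e * d powr - \<beta>" if "\<bar>x - s\<bar> < d" "\<bar>y - \<theta>\<bar> < d" for x y
    proof -
      have "\<bar>vxx x y + vyy x y\<bar> \<le> B * exp (\<mu> * x) * y powr - \<beta>"
        using box[of y] that by (intro lap_v) auto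
      also have "\<dots> \<le> B * ?e * d powr - \<beta>"
        using B d box[of y] that \<mu> \<beta> by (intro mult_mono powr_mono2') (auto simp: abs_less_iff)
      finally show ?thesis .
    qed
    have a: "\<bar>v x y\<bar> \<le> B * strip_const L \<beta> * ?e" if "\<bar>x - s\<bar> \<le> d" "\<bar>y - \<theta>\<bar> \<le> d" for x y
    proof -
      have "\<bar>v x y\<bar> \<le> B * strip_const L \<beta> * exp (\<mu> * x)"
        using box[of y] that by (intro v_le) auto
      also have "\<dots> \<le> B * strip_const L \<beta> * ?e"
        using B Q that \<mu> by (intro mult_left_mono) (auto simp: abs_le_iff)
      finally show ?thesis .
    qed
    have P: "B * ?e * d powr - \<beta> > 0" using B d by simp
    have in_box: "0 < y" "y < L" if "\<bar>y - \<theta>\<bar> < d" for y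
      using box(1)[of y] that by auto
    note dv' = dv[OF in_box]
    show "\<bar>vx s \<theta>\<bar> \<le> 2 * (B * strip_const L \<beta> * ?e) / d + (B * ?e * d powr - \<beta>) * d"
      by (rule partial_derivative_bound(1)[OF d(1) P c dv' l a])
    show "\<bar>vy s \<theta>\<bar> \<le> 2 * (B * strip_const L \<beta> * ?e) / d + (B * ?e * d powr - \<beta>) * d"
      by (rule partial_derivative_bound(2)[OF d(1) P c dv' l a])
  qed
  have "2 * (B * strip_const L \<beta> * ?e) / d + (B * ?e * d powr - \<beta>) * d =
      B * grad_const L (\<alpha> + \<gamma>) (2 + \<gamma>) \<delta> * exp ((2 + \<gamma>) * s)"
    unfolding grad_const_def \<mu>_def[symmetric] \<beta>_def[symmetric]
    using d by (simp add: distrib_left exp_add field_simps)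
  with grad show
    "\<bar>Px s \<theta> - 2 * exp (2 * s) * green L g \<theta>\<bar> \<le> B * grad_const L (\<alpha> + \<gamma>) (2 + \<gamma>) \<delta> * exp ((2 + \<gamma>) * s)"
    "\<bar>Py s \<theta> - exp (2 * s) * green' L g \<theta>\<bar> \<le> B * grad_const L (\<alpha> + \<gamma>) (2 + \<gamma>) \<delta> * exp ((2 + \<gamma>) * s)"
    by (simp_all add: vx_def vy_def)
qed

section \<open>Logarithmic polar coordinates\<close>

lemma has_derivative_dx_dy:
  assumes "f differentiable (at z)"
  shows "(f has_derivative (\<lambda>h. Re h * dx f z + Im h * dy f z)) (at z)"
proof -
  obtain f' where f': "(f has_derivative f') (at z)"
    using assms by (auto simp: differentiable_def)
  interpret f': bounded_linear f'
    using f' by (rule has_derivative_bounded_linear)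
  have line: "deriv (\<lambda>h. f (z + c * of_real h)) 0 = f' c" for c
  proof (rule DERIV_imp_deriv)
    have "((\<lambda>h::real. z + c * of_real h) has_derivative (\<lambda>h. c * of_real h)) (at 0)"
      by (auto intro!: derivative_eq_intros)
    moreover have "(f has_derivative f') (at (z + c * of_real (0::real)))"
      using f' by simp
    ultimately have "((\<lambda>h::real. f (z + c * of_real h)) has_derivative (\<lambda>h. f' (c * of_real h))) (at 0)"
      by (rule has_derivative_compose[where g = f])
    moreover have "f' (c * of_real h) = f' c * h" for h
      using f'.scaleR[of h c] by (simp add: scaleR_conv_of_real mult.commute)
    ultimately show "((\<lambda>h. f (z + c * of_real h)) has_real_derivative f' c) (at 0)"
      by (simp add: has_field_derivative_def)
  qed
  have "f' h = Re h * dx f z + Im h * dy f z" for h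
  proof -
    have "f' h = f' (Re h *\<^sub>R 1 + Im h *\<^sub>R \<i>)"
      by (metis complex_eq mult.commute mult.right_neutral scaleR_conv_of_real)
    also have "\<dots> = Re h * f' 1 + Im h * f' \<i>"
      by (simp add: f'.add f'.scaleR del: scaleR_complex.code)
    finally show ?thesis
      using line[of 1] line[of \<i>] by (simp add: dx_def dy_def)
  qed
  then have "f' = (\<lambda>h. Re h * dx f z + Im h * dy f z)"
    by blast
  with f' show ?thesis by simp
qed

lemma DERIV_along_path:
  assumes "f differentiable (at (p t))" "(p has_vector_derivative p') (at t)"
  shows "((\<lambda>t. f (p t)) has_real_derivative Re p' * dx f (p t) + Im p' * dy f (p t)) (at t)"
proof -
  have "((\<lambda>t. f (p t)) has_derivative (\<lambda>h. Re (h *\<^sub>R p') * dx f (p t) + Im (h *\<^sub>R p') * dy f (p t))) (at t)"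
    using assms(2) unfolding has_vector_derivative_def
    by (rule has_derivative_compose[where g = f]) (rule has_derivative_dx_dy[OF assms(1)])
  moreover have "(\<lambda>h. Re (h *\<^sub>R p') * dx f (p t) + Im (h *\<^sub>R p') * dy f (p t)) =
      (*) (Re p' * dx f (p t) + Im p' * dy f (p t))"
    by (auto simp: algebra_simps)
  ultimately show ?thesis
    unfolding has_field_derivative_def by simp
qed

lemma DERIV_Re_Im:
  assumes "(p has_vector_derivative p') (at t)"
  shows "((\<lambda>t. Re (p t)) has_real_derivative Re p') (at t)" "((\<lambda>t. Im (p t)) has_real_derivative Im p') (at t)"
  using bounded_linear.has_vector_derivative[OF bounded_linear_Re assms]
    bounded_linear.has_vector_derivative[OF bounded_linear_Im assms]
  by (simp_all add: has_real_derivative_iff_has_vector_derivative)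

lemma rcis_radial_path: "((\<lambda>s. rcis (exp s) \<theta>) has_vector_derivative rcis (exp s) \<theta>) (at s)"
proof -
  have "((\<lambda>s. exp s *\<^sub>R cis \<theta>) has_vector_derivative exp s *\<^sub>R cis \<theta>) (at s)"
    by (auto intro!: derivative_eq_intros)
  then show ?thesis by (simp add: rcis_def scaleR_conv_of_real)
qed

lemma rcis_angular_path: "((\<lambda>\<theta>. rcis r \<theta>) has_vector_derivative \<i> * rcis r \<theta>) (at \<theta>)"
proof -
  have "((\<lambda>\<theta>. of_real r * exp (\<i> * of_real \<theta>)) has_vector_derivative of_real r * (\<i> * exp (\<i> * of_real \<theta>))) (at \<theta>)"
    by (rule has_vector_derivative_real_field[where f = "\<lambda>w. of_real r * exp (\<i> * w)"])
      (auto intro!: derivative_eq_intros)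
  then show ?thesis by (simp add: rcis_def cis_conv_exp mult_ac)
qed

text \<open>The derivatives \<open>r \<partial>\<^sub>r\<close> and \<open>\<partial>\<^sub>\<theta>\<close> and their squares, in Cartesian terms. The mixed second derivatives
\<open>\<partial>\<^sub>x \<partial>\<^sub>y\<close> and \<open>\<partial>\<^sub>y \<partial>\<^sub>x\<close> are kept apart; they cancel in the sum of the two squares.\<close>

definition radial :: "(complex \<Rightarrow> real) \<Rightarrow> complex \<Rightarrow> real" where
  "radial f z = Re z * dx f z + Im z * dy f z"

definition angular :: "(complex \<Rightarrow> real) \<Rightarrow> complex \<Rightarrow> real" where
  "angular f z = Re z * dy f z - Im z * dx f z"

definition radial2 :: "(complex \<Rightarrow> real) \<Rightarrow> complex \<Rightarrow> real" where
  "radial2 f z = radial f z + Re z * radial (dx f) z + Im z * radial (dy f) z"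

definition angular2 :: "(complex \<Rightarrow> real) \<Rightarrow> complex \<Rightarrow> real" where
  "angular2 f z = - radial f z + Re z * angular (dy f) z - Im z * angular (dx f) z"

lemma DERIV_log_polar:
  assumes "C2_on S f" "rcis (exp s) \<theta> \<in> S"
  shows "((\<lambda>s. f (rcis (exp s) \<theta>)) has_real_derivative radial f (rcis (exp s) \<theta>)) (at s)"
    and "((\<lambda>s. radial f (rcis (exp s) \<theta>)) has_real_derivative radial2 f (rcis (exp s) \<theta>)) (at s)"
    and "((\<lambda>\<theta>. f (rcis (exp s) \<theta>)) has_real_derivative angular f (rcis (exp s) \<theta>)) (at \<theta>)"
    and "((\<lambda>\<theta>. angular f (rcis (exp s) \<theta>)) has_real_derivative angular2 f (rcis (exp s) \<theta>)) (at \<theta>)"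
proof -
  let ?z = "rcis (exp s) \<theta>"
  have f: "f differentiable (at ?z)" "dx f differentiable (at ?z)" "dy f differentiable (at ?z)"
    using assms by (auto simp: C2_on_def C1_on_def)
  note r = DERIV_along_path[OF _ rcis_radial_path] and a = DERIV_along_path[OF _ rcis_angular_path]
  note rr = DERIV_Re_Im[OF rcis_radial_path] and aa = DERIV_Re_Im[OF rcis_angular_path]
  show "((\<lambda>s. f (rcis (exp s) \<theta>)) has_real_derivative radial f ?z) (at s)"
    using r[OF f(1)] by (simp add: radial_def)
  show "((\<lambda>\<theta>. f (rcis (exp s) \<theta>)) has_real_derivative angular f ?z) (at \<theta>)"
    using a[OF f(1)] by (simp add: angular_def)
  note [derivative_intros] = r[OF f(2)] r[OF f(3)] rr
  show "((\<lambda>s. radial f (rcis (exp s) \<theta>)) has_real_derivative radial2 f ?z) (at s)"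
    unfolding radial_def[of f]
    by (rule derivative_eq_intros refl)+ (simp add: radial2_def radial_def algebra_simps)
  note [derivative_intros] = a[OF f(2)] a[OF f(3)] aa
  show "((\<lambda>\<theta>. angular f (rcis (exp s) \<theta>)) has_real_derivative angular2 f ?z) (at \<theta>)"
    unfolding angular_def[of f]
    by (rule derivative_eq_intros refl)+ (simp add: angular2_def angular_def radial_def algebra_simps)
qed

lemma log_polar_laplacian: "radial2 f z + angular2 f z = (cmod z)\<^sup>2 * laplacian f z"
  unfolding radial2_def angular2_def radial_def angular_def laplacian_def cmod_power2
  by (simp add: power2_eq_square algebra_simps)

lemma velocity_log_polar:
  assumes "r > 0"
  shows "velocity_theta \<psi> r \<theta> / r = radial \<psi> (rcis r \<theta>) / r\<^sup>2"
    and "velocity_r \<psi> r \<theta> = - angular \<psi> (rcis r \<theta>) / r"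
  using assms
  by (simp_all add: velocity_theta_def velocity_r_def velocity_def radial_def angular_def inner_complex_def
      power2_eq_square field_simps)

lemma sector_off_rays:
  assumes "m > 0" "r > 0" "0 < \<theta>" "\<theta> < pi / real m"
  shows "rcis r \<theta> \<in> off_rays m"
proof -
  have "0 < sin (real m * \<theta>)"
    using assms by (intro sin_gt_zero) (auto simp: field_simps)
  then show ?thesis
    using assms by (simp add: off_rays_def DeMoivre2)
qed

lemma odd_mfold_ray_zero:
  assumes "odd_mfold m f" "m > 0"
  shows "f (rcis r 0) = 0" "f (rcis r (pi / real m)) = 0"
proof -
  have odd: "f (cnj z) = - f z" and rot: "f (cis (2 * pi / real m) * z) = f z" for z
    using assms by (auto simp: odd_mfold_def)
  show "f (rcis r 0) = 0"
    using odd[of "rcis r 0"] by (simp add: rcis_def)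
  have "cis (2 * pi / real m) * cnj (rcis r (pi / real m)) = rcis r (pi / real m)"
    by (simp add: rcis_def cis_cnj cis_mult mult.left_commute)
  then have "f (rcis r (pi / real m)) = f (cnj (rcis r (pi / real m)))"
    using rot by metis
  then show "f (rcis r (pi / real m)) = 0"
    using odd by simp
qed

section \<open>Bounds for the vorticity, uniform in time\<close>

lemma eventually_at_right_0_less: "0 < c \<Longrightarrow> \<forall>\<^sub>F x in at_right 0. x < (c::real)"
  by (rule eventually_at_rightI[of 0 c]) auto

text \<open>The part of the norm that the proof uses: the vorticity and its first radial derivative.\<close>

definition weighted_bound :: "nat \<Rightarrow> real \<Rightarrow> real \<Rightarrow> (complex \<Rightarrow> real) \<Rightarrow> bool" where
  "weighted_bound m \<alpha> A f \<longleftrightarrow> (\<forall>(r, \<theta>) \<in> sector m.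
     \<bar>f (rcis r \<theta>)\<bar> \<le> A * (r + \<theta>) powr - \<alpha> \<and> \<bar>dr 1 f r \<theta>\<bar> \<le> A * (r + \<theta>) powr - (1 + \<alpha>))"

lemma Comega_norm_term:
  assumes "Comega_norm m \<alpha> l f \<le> ennreal A" "0 < l" "(r, \<theta>) \<in> sector m" "0 \<le> A"
  shows "l ^ k / fact k * ((r + \<theta>) powr (real k + \<alpha>) * \<bar>dr k f r \<theta>\<bar>) \<le> A"
proof -
  let ?S = "\<lambda>k. SUP (r, \<theta>) \<in> sector m. ennreal ((r + \<theta>) powr (real k + \<alpha>) * \<bar>dr k f r \<theta>\<bar>)"
  let ?U = "\<lambda>k. SUP (r, \<theta>) \<in> sector m. ennreal ((r + \<theta>) powr (real k + \<alpha>) * \<bar>dtheta k f r \<theta>\<bar>)"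
  have "ennreal (l ^ k / fact k * ((r + \<theta>) powr (real k + \<alpha>) * \<bar>dr k f r \<theta>\<bar>)) =
      ennreal (l ^ k / fact k) * ennreal ((r + \<theta>) powr (real k + \<alpha>) * \<bar>dr k f r \<theta>\<bar>)"
    using assms(2) by (intro ennreal_mult) auto
  also have "\<dots> \<le> ennreal (l ^ k / fact k) * (?S k + ?U k)"
  proof (intro mult_left_mono)
    have "ennreal ((r + \<theta>) powr (real k + \<alpha>) * \<bar>dr k f r \<theta>\<bar>) \<le> ?S k"
      using assms(3) by (intro SUP_upper2[of "(r, \<theta>)"]) auto
    then show "ennreal ((r + \<theta>) powr (real k + \<alpha>) * \<bar>dr k f r \<theta>\<bar>) \<le> ?S k + ?U k"
      by (intro add_increasing2) auto
  qed auto
  also have "\<dots> = (\<Sum>k\<in>{k}. ennreal (l ^ k / fact k) * (?S k + ?U k))" by simp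
  also have "\<dots> \<le> (\<Sum>k. ennreal (l ^ k / fact k) * (?S k + ?U k))"
    by (rule sum_le_suminf) auto
  also have "\<dots> \<le> ennreal A"
    using assms(1) by (simp add: Comega_norm_def)
  finally have "ennreal (l ^ k / fact k * ((r + \<theta>) powr (real k + \<alpha>) * \<bar>dr k f r \<theta>\<bar>)) \<le> ennreal A" .
  then show ?thesis
    using assms(4) by simp
qed

lemma Comega_norm_weighted_bound:
  assumes norm: "Comega_norm m \<alpha> l f \<le> ennreal A" and l: "0 < l" and A: "0 \<le> A"
  shows "weighted_bound m \<alpha> (max A (A / l)) f"
    and "\<forall>(r, \<theta>) \<in> sector m. \<bar>f (rcis r \<theta>)\<bar> \<le> A * (r + \<theta>) powr - \<alpha>"
proof -
  have 0: "\<bar>f (rcis r \<theta>)\<bar> \<le> A * (r + \<theta>) powr - \<alpha>" and 1: "\<bar>dr 1 f r \<theta>\<bar> \<le> A / l * (r + \<theta>) powr - (1 + \<alpha>)"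
    if "(r, \<theta>) \<in> sector m" for r \<theta>
  proof -
    have pos: "r + \<theta> > 0" using that by (auto simp: sector_def)
    have "(r + \<theta>) powr \<alpha> * \<bar>f (rcis r \<theta>)\<bar> \<le> A"
      using Comega_norm_term[OF norm l that A, of 0] by (simp add: dr_def)
    then show "\<bar>f (rcis r \<theta>)\<bar> \<le> A * (r + \<theta>) powr - \<alpha>"
      using pos by (simp add: powr_minus_divide field_simps)
    have "l * ((r + \<theta>) powr (1 + \<alpha>) * \<bar>dr 1 f r \<theta>\<bar>) \<le> A"
      using Comega_norm_term[OF norm l that A, of 1] by simp
    moreover have "(r + \<theta>) powr (1 + \<alpha>) > 0" using pos by simp
    ultimately show "\<bar>dr 1 f r \<theta>\<bar> \<le> A / l * (r + \<theta>) powr - (1 + \<alpha>)"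
      using l unfolding powr_minus_divide by (simp add: field_simps)
  qed
  show "\<forall>(r, \<theta>) \<in> sector m. \<bar>f (rcis r \<theta>)\<bar> \<le> A * (r + \<theta>) powr - \<alpha>"
    using 0 by auto
  show "weighted_bound m \<alpha> (max A (A / l)) f"
    unfolding weighted_bound_def
  proof (intro ballI, clarify, intro conjI)
    fix r \<theta> assume s: "(r, \<theta>) \<in> sector m"
    show "\<bar>f (rcis r \<theta>)\<bar> \<le> max A (A / l) * (r + \<theta>) powr - \<alpha>"
      using 0[OF s] by (rule order_trans) (intro mult_right_mono, auto)
    show "\<bar>dr 1 f r \<theta>\<bar> \<le> max A (A / l) * (r + \<theta>) powr - (1 + \<alpha>)"
      using 1[OF s] by (rule order_trans) (intro mult_right_mono, auto)
  qed
qed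

lemma weighted_bound_mono: "weighted_bound m \<alpha> A f \<Longrightarrow> A \<le> B \<Longrightarrow> weighted_bound m \<alpha> B f"
  unfolding weighted_bound_def
  by (fastforce elim!: order_trans intro!: mult_right_mono)

lemma DERIV_radial_of_smooth: 
  assumes "smooth_in_sector m f" "(r, \<theta>) \<in> sector m"
  shows "((\<lambda>\<rho>. f (rcis \<rho> \<theta>)) has_real_derivative dr 1 f r \<theta>) (at r)"
proof -
  have "(\<lambda>\<rho>. dr 0 f \<rho> \<theta>) differentiable (at r)"
    using assms unfolding smooth_in_sector_def by blast
  then show ?thesis
    by (simp add: dr_def DERIV_deriv_iff_real_differentiable)
qed

lemma DERIV_angular_of_smooth: 
  assumes "smooth_in_sector m f" "(r, \<theta>) \<in> sector m"
  shows "((\<lambda>\<phi>. f (rcis r \<phi>)) has_real_derivative dtheta 1 f r \<theta>) (at \<theta>)"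
proof -
  have "(\<lambda>\<phi>. dtheta 0 f r \<phi>) differentiable (at \<theta>)"
    using assms unfolding smooth_in_sector_def by blast
  then show ?thesis
    by (simp add: dtheta_def DERIV_deriv_iff_real_differentiable)
qed

lemma weighted_bound_add:
  assumes "weighted_bound m \<alpha> A f" "weighted_bound m \<alpha> B (\<lambda>z. g z - f z)"
    "smooth_in_sector m f" "smooth_in_sector m g"
  shows "weighted_bound m \<alpha> (A + B) g"
  unfolding weighted_bound_def
proof (intro ballI, clarify, intro conjI)
  fix r \<theta> assume s: "(r, \<theta>) \<in> sector m"
  have "dr 1 (\<lambda>z. g z - f z) r \<theta> = dr 1 g r \<theta> - dr 1 f r \<theta>"
    using DERIV_diff[OF DERIV_radial_of_smooth[OF assms(4) s] DERIV_radial_of_smooth[OF assms(3) s]]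
    by (auto simp: dr_def dest: DERIV_imp_deriv)
  moreover have "\<bar>f (rcis r \<theta>)\<bar> \<le> A * (r + \<theta>) powr - \<alpha>" "\<bar>dr 1 f r \<theta>\<bar> \<le> A * (r + \<theta>) powr - (1 + \<alpha>)"
    "\<bar>g (rcis r \<theta>) - f (rcis r \<theta>)\<bar> \<le> B * (r + \<theta>) powr - \<alpha>"
    "\<bar>dr 1 (\<lambda>z. g z - f z) r \<theta>\<bar> \<le> B * (r + \<theta>) powr - (1 + \<alpha>)"
    using assms(1,2) s by (auto simp: weighted_bound_def)
  ultimately show "\<bar>g (rcis r \<theta>)\<bar> \<le> (A + B) * (r + \<theta>) powr - \<alpha>"
    "\<bar>dr 1 g r \<theta>\<bar> \<le> (A + B) * (r + \<theta>) powr - (1 + \<alpha>)"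
    unfolding distrib_right by linarith+
qed

text \<open>Continuity in time gives a common bound near every time; compactness of the time interval makes it
uniform. The last conclusion is continuity in time in the weighted supremum norm.\<close>

lemma in_C_Comega_uniform:
  assumes "in_C_Comega m \<alpha> T \<omega>" "0 \<le> T'" "T' < T"
  obtains A where "A > 0" "\<And>t. 0 \<le> t \<Longrightarrow> t \<le> T' \<Longrightarrow> smooth_in_sector m (\<omega> t)"
    "\<And>t. 0 \<le> t \<Longrightarrow> t \<le> T' \<Longrightarrow> weighted_bound m \<alpha> A (\<omega> t)"
    "\<And>t \<epsilon>. 0 \<le> t \<Longrightarrow> t \<le> T' \<Longrightarrow> 0 < \<epsilon> \<Longrightarrow> \<forall>\<^sub>F s in at t within {0..T'}.
        \<forall>(r, \<theta>) \<in> sector m. \<bar>\<omega> s (rcis r \<theta>) - \<omega> t (rcis r \<theta>)\<bar> \<le> \<epsilon> * (r + \<theta>) powr - \<alpha>"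
proof -
  obtain l where l: "l > 0" "\<And>t. t \<in> {0..T'} \<Longrightarrow> \<omega> t \<in> Comega_ball m \<alpha> l"
    "\<And>t. t \<in> {0..T'} \<Longrightarrow> ((\<lambda>s. Comega_norm m \<alpha> l (\<lambda>z. \<omega> s z - \<omega> t z)) \<longlongrightarrow> 0) (at t within {0..T'})"
    using assms unfolding in_C_Comega_def by blast
  have near: "\<forall>\<^sub>F s in at t within {0..T'}. Comega_norm m \<alpha> l (\<lambda>z. \<omega> s z - \<omega> t z) \<le> ennreal \<epsilon>"
    if "t \<in> {0..T'}" "\<epsilon> > 0" for t \<epsilon>
    using order_tendstoD(2)[OF l(3)[OF that(1)], of "ennreal \<epsilon>"] that
    by (auto elim!: eventually_mono)
  have smooth: "smooth_in_sector m (\<omega> t)" if "t \<in> {0..T'}" for t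
    using l(2)[OF that] by (simp add: Comega_ball_def)
  have point: "\<exists>A. weighted_bound m \<alpha> A (\<omega> t)" if "t \<in> {0..T'}" for t
  proof -
    have "Comega_norm m \<alpha> l (\<omega> t) < \<infinity>"
      using l(2)[OF that] by (simp add: Comega_ball_def)
    then have "Comega_norm m \<alpha> l (\<omega> t) \<le> ennreal (enn2real (Comega_norm m \<alpha> l (\<omega> t)))"
      by (simp add: less_top)
    from Comega_norm_weighted_bound(1)[OF this l(1)] show ?thesis by auto
  qed
  have "\<exists>A. \<forall>s\<in>{0..T'} \<inter> {0..T'}. weighted_bound m \<alpha> A (\<omega> s)"
  proof (rule Bolzano[of 0 T' "\<lambda>a b. \<exists>A. \<forall>s\<in>{a..b} \<inter> {0..T'}. weighted_bound m \<alpha> A (\<omega> s)"])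
    fix a b c assume "\<exists>A. \<forall>s\<in>{a..b} \<inter> {0..T'}. weighted_bound m \<alpha> A (\<omega> s)"
      "\<exists>A. \<forall>s\<in>{b..c} \<inter> {0..T'}. weighted_bound m \<alpha> A (\<omega> s)" "a \<le> b" "b \<le> c"
    then obtain A B where AB: "\<forall>s\<in>{a..b} \<inter> {0..T'}. weighted_bound m \<alpha> A (\<omega> s)"
      "\<forall>s\<in>{b..c} \<inter> {0..T'}. weighted_bound m \<alpha> B (\<omega> s)" by blast
    have "weighted_bound m \<alpha> (max A B) (\<omega> s)" if "s \<in> {a..c} \<inter> {0..T'}" for s
      using AB that weighted_bound_mono[of m \<alpha> A "\<omega> s" "max A B"] weighted_bound_mono[of m \<alpha> B "\<omega> s" "max A B"]
      by (cases "s \<le> b") auto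
    then show "\<exists>A. \<forall>s\<in>{a..c} \<inter> {0..T'}. weighted_bound m \<alpha> A (\<omega> s)" by blast
  next
    fix x assume "0 \<le> x" "x \<le> T'"
    then have x: "x \<in> {0..T'}" by simp
    obtain A where A: "weighted_bound m \<alpha> A (\<omega> x)" using point[OF x] by blast
    obtain d where d: "d > 0" "\<And>s. s \<in> {0..T'} \<Longrightarrow> s \<noteq> x \<Longrightarrow> dist s x < d \<Longrightarrow>
        Comega_norm m \<alpha> l (\<lambda>z. \<omega> s z - \<omega> x z) \<le> ennreal 1"
      using near[OF x zero_less_one] unfolding eventually_at by blast
    define B where "B = A + max 1 (1 / l)"
    have "weighted_bound m \<alpha> B (\<omega> s)" if s: "s \<in> {0..T'}" "dist s x < d" for s
    proof (cases "s = x")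
      case True
      then show ?thesis
        using weighted_bound_mono[OF A, of B] by (simp add: B_def)
    next
      case False
      show ?thesis
        unfolding B_def
        by (intro weighted_bound_add[OF A Comega_norm_weighted_bound(1)] d smooth s False x l) auto
    qed
    then have "\<forall>s\<in>{a..b} \<inter> {0..T'}. weighted_bound m \<alpha> B (\<omega> s)" if "a \<le> x \<and> x \<le> b \<and> b - a < d" for a b
      using that by (auto simp: dist_real_def abs_less_iff)
    then show "\<exists>d>0. \<forall>a b. a \<le> x \<and> x \<le> b \<and> b - a < d \<longrightarrow> (\<exists>A. \<forall>s\<in>{a..b} \<inter> {0..T'}. weighted_bound m \<alpha> A (\<omega> s))"
      using d(1) by blast
  qed (use assms in auto)
  then obtain A where A: "\<And>s. s \<in> {0..T'} \<Longrightarrow> weighted_bound m \<alpha> A (\<omega> s)"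
    unfolding Int_absorb by blast
  show ?thesis
  proof (rule that[of "max A 1"])
    show "weighted_bound m \<alpha> (max A 1) (\<omega> t)" if "0 \<le> t" "t \<le> T'" for t
      using A[of t] that by (auto intro: weighted_bound_mono)
    show "\<forall>\<^sub>F s in at t within {0..T'}.
        \<forall>(r, \<theta>) \<in> sector m. \<bar>\<omega> s (rcis r \<theta>) - \<omega> t (rcis r \<theta>)\<bar> \<le> \<epsilon> * (r + \<theta>) powr - \<alpha>"
      if "0 \<le> t" "t \<le> T'" "0 < \<epsilon>" for t \<epsilon>
    proof (rule eventually_mono[OF near])
      fix s assume "Comega_norm m \<alpha> l (\<lambda>z. \<omega> s z - \<omega> t z) \<le> ennreal \<epsilon>"
      from Comega_norm_weighted_bound(2)[OF this l(1)] that
      show "\<forall>(r, \<theta>) \<in> sector m. \<bar>\<omega> s (rcis r \<theta>) - \<omega> t (rcis r \<theta>)\<bar> \<le> \<epsilon> * (r + \<theta>) powr - \<alpha>"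
        by simp
    qed (use that in auto)
  qed (use smooth in auto)
qed

section \<open>The trace of the vorticity at the origin\<close>

definition origin_trace :: "(complex \<Rightarrow> real) \<Rightarrow> real \<Rightarrow> real" where
  "origin_trace f \<theta> = Lim (at_right 0) (\<lambda>r. f (rcis r \<theta>))"

locale bounded_vorticity =
  fixes m :: nat and \<alpha> A :: real and f :: "complex \<Rightarrow> real"
  assumes m: "m \<ge> 3" and \<alpha>: "0 < \<alpha>" "\<alpha> < 1" and A: "0 < A"
    and bound: "weighted_bound m \<alpha> A f" and smooth: "smooth_in_sector m f"
begin

lemma f_bound:
  assumes "0 < r" "0 < \<theta>" "\<theta> < pi / real m"
  shows "\<bar>f (rcis r \<theta>)\<bar> \<le> A * (r + \<theta>) powr - \<alpha>" "\<bar>f (rcis r \<theta>)\<bar> \<le> A * \<theta> powr - \<alpha>"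
    "\<bar>dr 1 f r \<theta>\<bar> \<le> A * \<theta> powr - (1 + \<alpha>)"
proof -
  have s: "(r, \<theta>) \<in> sector m" using assms by (simp add: sector_def)
  show 1: "\<bar>f (rcis r \<theta>)\<bar> \<le> A * (r + \<theta>) powr - \<alpha>"
    using bound s unfolding weighted_bound_def by blast
  have "A * (r + \<theta>) powr - \<alpha> \<le> A * \<theta> powr - \<alpha>"
    using A \<alpha> assms by (intro mult_left_mono powr_mono2') auto
  with 1 show "\<bar>f (rcis r \<theta>)\<bar> \<le> A * \<theta> powr - \<alpha>" by linarith
  have "\<bar>dr 1 f r \<theta>\<bar> \<le> A * (r + \<theta>) powr - (1 + \<alpha>)"
    using bound s unfolding weighted_bound_def by blast
  also have "\<dots> \<le> A * \<theta> powr - (1 + \<alpha>)"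
    using A \<alpha> assms by (intro mult_left_mono powr_mono2') auto
  finally show "\<bar>dr 1 f r \<theta>\<bar> \<le> A * \<theta> powr - (1 + \<alpha>)" .
qed

lemma lipschitz_radial:
  assumes \<theta>: "0 < \<theta>" "\<theta> < pi / real m" and r: "0 < r" "0 < r'"
  shows "\<bar>f (rcis r \<theta>) - f (rcis r' \<theta>)\<bar> \<le> A * \<theta> powr - (1 + \<alpha>) * \<bar>r - r'\<bar>"
proof -
  have "norm (f (rcis r \<theta>) - f (rcis r' \<theta>)) \<le> A * \<theta> powr - (1 + \<alpha>) * norm (r - r')"
  proof (rule field_differentiable_bound[of "{0<..}" "\<lambda>\<rho>. f (rcis \<rho> \<theta>)" "\<lambda>\<rho>. dr 1 f \<rho> \<theta>"])
    fix z :: real assume "z \<in> {0<..}"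
    then have z: "0 < z" "(z, \<theta>) \<in> sector m" using \<theta> by (auto simp: sector_def)
    show "((\<lambda>\<rho>. f (rcis \<rho> \<theta>)) has_field_derivative dr 1 f z \<theta>) (at z within {0<..})"
      using DERIV_radial_of_smooth[OF smooth z(2)] by (rule has_field_derivative_at_within)
    show "norm (dr 1 f z \<theta>) \<le> A * \<theta> powr - (1 + \<alpha>)"
      using f_bound(3)[OF z(1) \<theta>] by simp
  qed (use r in auto)
  then show ?thesis by simp
qed

lemma trace_tendsto:
  assumes \<theta>: "0 < \<theta>" "\<theta> < pi / real m"
  shows "((\<lambda>r. f (rcis r \<theta>)) \<longlongrightarrow> origin_trace f \<theta>) (at_right 0)"
proof -
  let ?F = "\<lambda>r. f (rcis r \<theta>)" and ?c = "A * \<theta> powr - (1 + \<alpha>)"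
  define X where "X n = ?F (inverse (real (Suc n)))" for n
  have inv: "(\<lambda>n. inverse (real (Suc n))) \<longlonglongrightarrow> 0"
    by (rule LIMSEQ_inverse_real_of_nat)
  have "Cauchy X"
  proof (rule metric_CauchyI)
    fix e :: real assume e: "0 < e"
    have c: "0 < ?c" using A \<theta> by simp
    have "Cauchy (\<lambda>n. inverse (real (Suc n)))"
      using inv by (intro LIMSEQ_imp_Cauchy)
    then obtain M where M: "\<And>i j. i \<ge> M \<Longrightarrow> j \<ge> M \<Longrightarrow> dist (inverse (real (Suc i))) (inverse (real (Suc j))) < e / ?c"
      using metric_CauchyD[of _ "e / ?c"] e c by (metis divide_pos_pos)
    show "\<exists>M. \<forall>i\<ge>M. \<forall>j\<ge>M. dist (X i) (X j) < e"
    proof (intro exI[of _ M] allI impI)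
      fix i j assume ij: "i \<ge> M" "j \<ge> M"
      have "dist (X i) (X j) \<le> ?c * \<bar>inverse (real (Suc i)) - inverse (real (Suc j))\<bar>"
        unfolding X_def dist_real_def by (intro lipschitz_radial \<theta>) auto
      also have "\<dots> < e"
        using M[OF ij] c by (simp add: dist_real_def pos_less_divide_eq mult.commute)
      finally show "dist (X i) (X j) < e" .
    qed
  qed
  then obtain l where l: "X \<longlonglongrightarrow> l"
    using Cauchy_convergent convergent_def by blast
  have le: "\<bar>?F r - l\<bar> \<le> ?c * r" if "0 < r" for r
  proof (rule LIMSEQ_le)
    show "(\<lambda>n. \<bar>?F r - X n\<bar>) \<longlonglongrightarrow> \<bar>?F r - l\<bar>"
      by (intro tendsto_intros l)
    have "(\<lambda>n. ?c * \<bar>r - inverse (real (Suc n))\<bar>) \<longlonglongrightarrow> ?c * \<bar>r - 0\<bar>"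
      by (intro tendsto_intros inv)
    then show "(\<lambda>n. ?c * \<bar>r - inverse (real (Suc n))\<bar>) \<longlonglongrightarrow> ?c * r"
      using that by simp
    show "\<exists>N. \<forall>n\<ge>N. \<bar>?F r - X n\<bar> \<le> ?c * \<bar>r - inverse (real (Suc n))\<bar>"
      unfolding X_def using that by (intro exI[of _ 0] allI impI lipschitz_radial \<theta>) auto
  qed
  have "((\<lambda>r. ?F r - l) \<longlongrightarrow> 0) (at_right 0)"
  proof (rule Lim_null_comparison)
    show "\<forall>\<^sub>F r in at_right 0. norm (?F r - l) \<le> ?c * r"
      using le by (auto simp: eventually_at_filter)
    have "((\<lambda>r. ?c * r) \<longlongrightarrow> ?c * 0) (at_right 0)"
      by (intro tendsto_intros)
    then show "((\<lambda>r. ?c * r) \<longlongrightarrow> 0) (at_right 0)" by simp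
  qed
  then have *: "(?F \<longlongrightarrow> l) (at_right 0)"
    by (simp add: LIM_zero_iff)
  then have "origin_trace f \<theta> = l"
    unfolding origin_trace_def by (intro tendsto_Lim trivial_limit_at_right_real)
  with * show ?thesis by simp
qed

lemma trace_bound:
  assumes \<theta>: "0 < \<theta>" "\<theta> < pi / real m"
  shows "\<bar>origin_trace f \<theta>\<bar> \<le> A * \<theta> powr - \<alpha>"
proof (rule tendsto_upperbound)
  show "((\<lambda>r. \<bar>f (rcis r \<theta>)\<bar>) \<longlongrightarrow> \<bar>origin_trace f \<theta>\<bar>) (at_right 0)"
    by (intro tendsto_intros trace_tendsto \<theta>)
  show "\<forall>\<^sub>F r in at_right 0. \<bar>f (rcis r \<theta>)\<bar> \<le> A * \<theta> powr - \<alpha>"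
    using f_bound(2)[OF _ \<theta>] by (auto simp: eventually_at_filter)
qed (rule trivial_limit_at_right_real)

lemma trace_rate:
  assumes \<theta>: "0 < \<theta>" "\<theta> < pi / real m" and r: "0 < r"
  shows "\<bar>f (rcis r \<theta>) - origin_trace f \<theta>\<bar> \<le> A * \<theta> powr - (1 + \<alpha>) * r"
proof (rule tendsto_le)
  show "((\<lambda>r'. \<bar>f (rcis r \<theta>) - f (rcis r' \<theta>)\<bar>) \<longlongrightarrow> \<bar>f (rcis r \<theta>) - origin_trace f \<theta>\<bar>) (at_right 0)"
    by (intro tendsto_intros trace_tendsto \<theta>)
  have "((\<lambda>r'. A * \<theta> powr - (1 + \<alpha>) * \<bar>r - r'\<bar>) \<longlongrightarrow> A * \<theta> powr - (1 + \<alpha>) * \<bar>r - 0\<bar>) (at_right 0)"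
    by (intro tendsto_intros)
  then show "((\<lambda>r'. A * \<theta> powr - (1 + \<alpha>) * \<bar>r - r'\<bar>) \<longlongrightarrow> A * \<theta> powr - (1 + \<alpha>) * r) (at_right 0)"
    using r by simp
  show "\<forall>\<^sub>F r' in at_right 0. \<bar>f (rcis r \<theta>) - f (rcis r' \<theta>)\<bar> \<le> A * \<theta> powr - (1 + \<alpha>) * \<bar>r - r'\<bar>"
    using lipschitz_radial[OF \<theta> r] by (auto simp: eventually_at_filter)
qed (rule trivial_limit_at_right_real)

text \<open>Interpolation between the Lipschitz bound in \<open>r\<close>, which is too singular at \<open>\<theta> = 0\<close>, and the trivial
bound: for small \<open>\<gamma>\<close> the exponent \<open>\<alpha> + \<gamma>\<close> stays below 1, as the comparison in the strip requires.\<close>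

lemma trace_rate_holder:
  assumes \<theta>: "0 < \<theta>" "\<theta> < pi / real m" and r: "0 < r" and \<gamma>: "0 < \<gamma>" "\<gamma> < 1"
  shows "\<bar>f (rcis r \<theta>) - origin_trace f \<theta>\<bar> \<le> 2 * A * r powr \<gamma> * \<theta> powr - (\<alpha> + \<gamma>)"
proof -
  have eq: "2 * A * r powr \<gamma> * \<theta> powr - (\<alpha> + \<gamma>) = 2 * (A * \<theta> powr - \<alpha>) * (r / \<theta>) powr \<gamma>"
    using \<theta> r powr_add[of \<theta> "- \<alpha>" "- \<gamma>"] by (simp add: powr_divide powr_minus_divide)
  have A': "0 < A * \<theta> powr - \<alpha>" using A \<theta> by simp
  show ?thesis
  proof (cases "r \<le> \<theta>")
    case True
    have "(r / \<theta>) powr 1 \<le> (r / \<theta>) powr \<gamma>"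
      using r \<theta> \<gamma> True by (intro powr_mono') auto
    then have "r / \<theta> \<le> (r / \<theta>) powr \<gamma>"
      using r \<theta> by simp
    then have *: "A * \<theta> powr - \<alpha> * (r / \<theta>) \<le> A * \<theta> powr - \<alpha> * (r / \<theta>) powr \<gamma>"
      using A' by (intro mult_left_mono) auto
    have "A * \<theta> powr - (1 + \<alpha>) * r = A * \<theta> powr - \<alpha> * (r / \<theta>)"
      using \<theta> powr_add[of \<theta> "- 1" "- \<alpha>"] by (simp add: powr_minus_divide)
    with * trace_rate[OF \<theta> r] have "\<bar>f (rcis r \<theta>) - origin_trace f \<theta>\<bar> \<le> A * \<theta> powr - \<alpha> * (r / \<theta>) powr \<gamma>"
      by linarith
    also have "\<dots> \<le> 2 * (A * \<theta> powr - \<alpha>) * (r / \<theta>) powr \<gamma>"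
      using A' by (intro mult_right_mono) auto
    finally show ?thesis unfolding eq .
  next
    case False
    have "1 powr \<gamma> \<le> (r / \<theta>) powr \<gamma>"
      using False \<theta> \<gamma> by (intro powr_mono2) auto
    then have "2 * (A * \<theta> powr - \<alpha>) * 1 \<le> 2 * (A * \<theta> powr - \<alpha>) * (r / \<theta>) powr \<gamma>"
      using A' by (intro mult_left_mono) auto
    then show ?thesis
      unfolding eq using f_bound(2)[OF r \<theta>] trace_bound[OF \<theta>] by linarith
  qed
qed

lemma continuous_angular:
  assumes "0 < r"
  shows "continuous_on {0<..<pi / real m} (\<lambda>\<theta>. f (rcis r \<theta>))"
proof (rule DERIV_continuous_on)
  fix \<theta> assume "\<theta> \<in> {0<..<pi / real m}"
  then have "(r, \<theta>) \<in> sector m" using assms by (simp add: sector_def)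
  from DERIV_angular_of_smooth[OF smooth this]
  show "((\<lambda>\<theta>. f (rcis r \<theta>)) has_field_derivative dtheta 1 f r \<theta>) (at \<theta> within {0<..<pi / real m})"
    by (rule has_field_derivative_at_within)
qed

lemma continuous_trace: "continuous_on {0<..<pi / real m} (origin_trace f)"
  unfolding continuous_on_eq_continuous_at[OF open_greaterThanLessThan]
proof
  fix \<theta> assume \<theta>: "\<theta> \<in> {0<..<pi / real m}"
  define \<delta> where "\<delta> = \<theta> / 2"
  let ?S = "{\<delta><..<pi / real m}"
  have \<delta>: "0 < \<delta>" "\<theta> \<in> ?S" using \<theta> by (auto simp: \<delta>_def)
  have "uniform_limit ?S (\<lambda>r \<theta>. f (rcis r \<theta>)) (origin_trace f) (at_right 0)"
  proof (rule uniform_limitI)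
    fix e :: real assume e: "0 < e"
    have c: "0 < A * \<delta> powr - (1 + \<alpha>)" using A \<delta> by simp
    have "\<forall>\<^sub>F r in at_right 0. 0 < r \<and> r < e / (A * \<delta> powr - (1 + \<alpha>))"
      using c e by (intro eventually_conj eventually_at_right_less eventually_at_right_0_less) auto
    then show "\<forall>\<^sub>F r in at_right 0. \<forall>x\<in>?S. dist (f (rcis r x)) (origin_trace f x) < e"
    proof (rule eventually_mono, intro ballI)
      fix r x assume r: "0 < r \<and> r < e / (A * \<delta> powr - (1 + \<alpha>))" and x: "x \<in> ?S"
      have "\<bar>f (rcis r x) - origin_trace f x\<bar> \<le> A * x powr - (1 + \<alpha>) * r"
        using x r \<delta> by (intro trace_rate) auto
      also have "\<dots> \<le> A * \<delta> powr - (1 + \<alpha>) * r"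
        using x r A \<delta> \<alpha> by (intro mult_right_mono mult_left_mono powr_mono2') auto
      also have "\<dots> < e"
        using r c by (simp add: pos_less_divide_eq mult.commute)
      finally show "dist (f (rcis r x)) (origin_trace f x) < e"
        by (simp add: dist_real_def)
    qed
  qed
  moreover have "\<forall>\<^sub>F r in at_right 0. continuous_on ?S (\<lambda>\<theta>. f (rcis r \<theta>))"
  proof (rule eventually_mono[OF eventually_at_right_less])
    fix r :: real assume "0 < r"
    then show "continuous_on ?S (\<lambda>\<theta>. f (rcis r \<theta>))"
      by (rule continuous_on_subset[OF continuous_angular]) (use \<delta> in auto)
  qed
  ultimately have "continuous_on ?S (origin_trace f)"
    by (intro uniform_limit_theorem[where F = "at_right (0::real)"]) (auto simp: trivial_limit_at_right_real)
  then show "isCont (origin_trace f) \<theta>"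
    using \<delta>(2) by (simp add: continuous_on_eq_continuous_at)
qed

lemma sector_angle: "0 < pi / real m" "pi / real m \<le> pi / 3"
  using m by (simp, intro frac_le, auto)

sublocale profile: angular_profile "pi / real m" \<alpha> A "origin_trace f"
  using sector_angle \<alpha> continuous_trace trace_bound by unfold_locales auto

end

context bounded_vorticity
begin

text \<open>The choice of \<open>\<gamma>\<close> makes both \<open>\<gamma> \<le> 1/2\<close> and \<open>\<alpha> + \<gamma> < 1\<close> true. The constants depend on the vorticity only
through its bound \<open>A\<close>.\<close>

lemma velocity_near_origin:
  assumes str: "stream_function m f \<psi>"
    and r: "0 < r" "r \<le> 1" and \<delta>: "0 < \<delta>" "\<delta> \<le> \<theta>" "\<theta> \<le> pi / real m - \<delta>"
  defines "L \<equiv> pi / real m" and "\<gamma> \<equiv> (1 - \<alpha>) / 2"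
  defines "c \<equiv> 2 * A * grad_const L (\<alpha> + \<gamma>) (2 + \<gamma>) \<delta>"
  shows "\<bar>velocity_theta \<psi> r \<theta> / r - 2 * green L (origin_trace f) \<theta>\<bar> \<le> c * r powr \<gamma>"
    and "\<bar>velocity_r \<psi> r \<theta>\<bar> \<le> (A * green_const L \<alpha> * L + c) * r"
proof -
  have odd: "odd_mfold m \<psi>" and C1: "C1_on (- {0}) \<psi>" and C2: "C2_on (off_rays m) \<psi>"
    and lap: "\<And>z. z \<in> off_rays m \<Longrightarrow> laplacian \<psi> z = f z"
    using str by (auto simp: stream_function_def)
  obtain C where C: "\<And>z. z \<noteq> 0 \<Longrightarrow> \<bar>\<psi> z\<bar> / (cmod z)\<^sup>2 \<le> C"
    using str by (auto simp: stream_function_def)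
  have m0: "m > 0" using m by simp
  have \<gamma>: "0 < \<gamma>" "\<gamma> \<le> 1 / 2" "\<alpha> + \<gamma> < 1" "\<gamma> < 1"
    using \<alpha> by (auto simp: \<gamma>_def field_simps)
  have off: "rcis (exp s) \<theta> \<in> off_rays m" if "0 < \<theta>" "\<theta> < L" for s \<theta>
    using sector_off_rays[OF m0 _ that[unfolded L_def]] by simp
  have cont: "continuous_on (UNIV \<times> {0..L}) (\<lambda>(s, \<theta>). \<psi> (rcis (exp s) \<theta>))"
  proof -
    have "continuous_on (- {0}) \<psi>"
      using C1 by (auto simp: C1_on_def intro!: continuous_at_imp_continuous_on differentiable_imp_continuous_within)
    moreover have "continuous_on (UNIV \<times> {0..L}) (\<lambda>x. rcis (exp (fst x)) (snd x))"
      unfolding rcis_def by (intro continuous_intros)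
    ultimately show ?thesis
      unfolding case_prod_beta by (rule continuous_on_compose2) auto
  qed
  have growth: "\<bar>\<psi> (rcis (exp s) \<theta>)\<bar> \<le> C * exp (2 * s)" for s \<theta>
  proof -
    have "\<bar>\<psi> (rcis (exp s) \<theta>)\<bar> / (exp s)\<^sup>2 \<le> C"
      using C[of "rcis (exp s) \<theta>"] by simp
    then show ?thesis
      by (simp add: pos_divide_le_eq exp_double)
  qed
  have near: "\<bar>f (rcis (exp s) \<theta>) - origin_trace f \<theta>\<bar> \<le> 2 * A * exp (\<gamma> * s) * \<theta> powr - (\<alpha> + \<gamma>)"
    if "0 < \<theta>" "\<theta> < L" for s \<theta>
    using trace_rate_holder[OF that[unfolded L_def], of "exp s" \<gamma>] \<gamma>
    by (simp add: powr_def)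
  have lap': "radial2 \<psi> (rcis (exp s) \<theta>) + angular2 \<psi> (rcis (exp s) \<theta>) = exp (2 * s) * f (rcis (exp s) \<theta>)"
    if "0 < \<theta>" "\<theta> < L" for s \<theta>
    using lap[OF off[OF that]] by (simp add: log_polar_laplacian exp_double)
  define s where "s = ln r"
  have s: "exp s = r" "exp (2 * s) = r\<^sup>2" "exp ((2 + \<gamma>) * s) = r\<^sup>2 * r powr \<gamma>"
    using r by (simp_all add: s_def exp_double distrib_right exp_add powr_def)
  have \<theta>: "0 < \<theta>" "\<theta> < L" using \<delta> by (auto simp: L_def)
  have A2: "0 < 2 * A" using A by simp
  note asym = profile.velocity_asymptotics[folded L_def, OF \<gamma>(1-3) A2 cont _ _ growth
      DERIV_log_polar(1)[OF C2 off] DERIV_log_polar(2)[OF C2 off] DERIV_log_polar(3)[OF C2 off]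
      DERIV_log_polar(4)[OF C2 off] lap' near \<delta>(1,2) \<delta>(3)[folded L_def], of s]
  have z: "\<psi> (rcis (exp s) 0) = 0" "\<psi> (rcis (exp s) L) = 0" for s
    using odd_mfold_ray_zero[OF odd m0] by (auto simp: L_def)
  have 1: "\<bar>radial \<psi> (rcis r \<theta>) - 2 * r\<^sup>2 * green L (origin_trace f) \<theta>\<bar> \<le> c * (r\<^sup>2 * r powr \<gamma>)"
    using asym(1)[OF z] unfolding s c_def .
  have 2: "\<bar>angular \<psi> (rcis r \<theta>) - r\<^sup>2 * green' L (origin_trace f) \<theta>\<bar> \<le> c * (r\<^sup>2 * r powr \<gamma>)"
    using asym(2)[OF z] unfolding s c_def .
  have r2: "0 < r\<^sup>2" using r by simp
  have c0: "0 \<le> c"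
  proof -
    have "0 \<le> c * (r\<^sup>2 * r powr \<gamma>)" using 1 abs_ge_zero order_trans by blast
    moreover have "0 < r\<^sup>2 * r powr \<gamma>" using r by simp
    ultimately show ?thesis by (meson mult_neg_pos not_less)
  qed
  have "velocity_theta \<psi> r \<theta> / r - 2 * green L (origin_trace f) \<theta> =
      (radial \<psi> (rcis r \<theta>) - 2 * r\<^sup>2 * green L (origin_trace f) \<theta>) / r\<^sup>2"
    using r by (simp add: velocity_log_polar field_simps)
  also have "\<bar>\<dots>\<bar> \<le> c * (r\<^sup>2 * r powr \<gamma>) / r\<^sup>2"
    using divide_right_mono[OF 1 less_imp_le[OF r2]] by (simp add: abs_divide)
  finally show "\<bar>velocity_theta \<psi> r \<theta> / r - 2 * green L (origin_trace f) \<theta>\<bar> \<le> c * r powr \<gamma>"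
    using r by simp
  have "\<bar>green' L (origin_trace f) \<theta>\<bar> \<le> A * green_const L \<alpha> * L"
    using profile.green'_upper[folded L_def, OF \<theta>] .
  then have "\<bar>r\<^sup>2 * green' L (origin_trace f) \<theta>\<bar> \<le> r\<^sup>2 * (A * green_const L \<alpha> * L)"
    unfolding abs_mult using r by (intro mult_mono) auto
  moreover have "r powr \<gamma> \<le> 1"
    using r \<gamma> by (intro powr_le1) auto
  then have "c * (r\<^sup>2 * r powr \<gamma>) \<le> c * (r\<^sup>2 * 1)"
    using c0 by (intro mult_left_mono) auto
  ultimately have "\<bar>angular \<psi> (rcis r \<theta>)\<bar> \<le> r\<^sup>2 * (A * green_const L \<alpha> * L) + c * r\<^sup>2"
    using 2 by simp
  also have "\<dots> = (A * green_const L \<alpha> * L + c) * r * r"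
    by (simp add: algebra_simps power2_eq_square)
  finally have "\<bar>angular \<psi> (rcis r \<theta>)\<bar> / r \<le> (A * green_const L \<alpha> * L + c) * r"
    using r by (simp add: pos_divide_le_eq)
  moreover have "\<bar>velocity_r \<psi> r \<theta>\<bar> = \<bar>angular \<psi> (rcis r \<theta>)\<bar> / r"
    using r by (simp add: velocity_log_polar)
  ultimately show "\<bar>velocity_r \<psi> r \<theta>\<bar> \<le> (A * green_const L \<alpha> * L + c) * r" by simp
qed

end

section \<open>Comparison for the transport equation near the origin\<close>

text \<open>A maximum principle for \<open>W\<^sub>t + V W\<^sub>\<theta> = E\<close>, one equation for each radius \<open>r\<close>, where \<open>E \<rightarrow> 0\<close> and \<open>V \<rightarrow> 2 G\<close>
locally uniformly in the angle as \<open>r \<rightarrow> 0\<close>; the conclusion concerns the limit \<open>g\<close> of \<open>W\<close>. The condition on \<open>K'\<close> says that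
\<open>- K ((L - \<theta>)/\<theta>) powr \<alpha>\<close> is a supersolution of the limit equation: the logarithmic derivative of this
profile is \<open>- \<alpha> L / (\<theta> (L - \<theta>))\<close>. If the conclusion failed, then for small \<open>r\<close> the function \<open>D\<close> below
would have a positive maximum in the interior, where the penalty in \<open>D\<close> contradicts the equation. The case \<open>K = 0\<close> is the preservation of the sign of the vorticity.\<close>

lemma transport_comparison:
  fixes L \<alpha> T A C :: real and W V E Wy :: "real \<Rightarrow> real \<Rightarrow> real \<Rightarrow> real"
    and G g :: "real \<Rightarrow> real \<Rightarrow> real" and K K' :: "real \<Rightarrow> real"
  assumes L: "0 < L" and \<alpha>: "0 < \<alpha>" "\<alpha> < 1"
    and bound: "\<And>r t \<theta>. 0 < r \<Longrightarrow> 0 \<le> t \<Longrightarrow> t < T \<Longrightarrow> 0 < \<theta> \<Longrightarrow> \<theta> < L \<Longrightarrow> \<bar>W r t \<theta>\<bar> \<le> A * \<theta> powr - \<alpha>"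
    and cont: "\<And>r. 0 < r \<Longrightarrow> continuous_on ({0..<T} \<times> {0<..<L}) (\<lambda>(t, \<theta>). W r t \<theta>)"
    and Wt: "\<And>r t \<theta>. 0 < r \<Longrightarrow> 0 < t \<Longrightarrow> t < T \<Longrightarrow> 0 < \<theta> \<Longrightarrow> \<theta> < L \<Longrightarrow>
        ((\<lambda>t. W r t \<theta>) has_real_derivative E r t \<theta> - V r t \<theta> * Wy r t \<theta>) (at t)"
    and Wy: "\<And>r t \<theta>. 0 < r \<Longrightarrow> 0 < t \<Longrightarrow> t < T \<Longrightarrow> 0 < \<theta> \<Longrightarrow> \<theta> < L \<Longrightarrow>
        ((\<lambda>\<theta>. W r t \<theta>) has_real_derivative Wy r t \<theta>) (at \<theta>)"
    and small: "\<And>\<delta> \<eta>. 0 < \<delta> \<Longrightarrow> 0 < \<eta> \<Longrightarrow> \<forall>\<^sub>F r in at_right 0. \<forall>t\<in>{0<..<T}. \<forall>\<theta>\<in>{\<delta>..L - \<delta>}.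
        \<bar>E r t \<theta>\<bar> \<le> \<eta> \<and> \<bar>V r t \<theta> - 2 * G t \<theta>\<bar> \<le> \<eta>"
    and G: "\<And>t \<theta>. 0 < t \<Longrightarrow> t < T \<Longrightarrow> 0 < \<theta> \<Longrightarrow> \<theta> < L \<Longrightarrow> \<bar>2 * G t \<theta>\<bar> \<le> C * (\<theta> * (L - \<theta>))"
    and init: "\<And>r \<theta>. 0 < r \<Longrightarrow> 0 < \<theta> \<Longrightarrow> \<theta> < L \<Longrightarrow> W r 0 \<theta> = - ((r + \<theta>) powr - \<alpha>)"
    and lim: "\<And>t \<theta>. 0 \<le> t \<Longrightarrow> t < T \<Longrightarrow> 0 < \<theta> \<Longrightarrow> \<theta> < L \<Longrightarrow> ((\<lambda>r. W r t \<theta>) \<longlongrightarrow> g t \<theta>) (at_right 0)"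
    and K: "continuous_on {0..<T} K" "\<And>t. 0 \<le> t \<Longrightarrow> t < T \<Longrightarrow> 0 \<le> K t" "K 0 \<le> (2 * L) powr - \<alpha>"
    and K': "\<And>t. 0 < t \<Longrightarrow> t < T \<Longrightarrow> (K has_real_derivative K' t) (at t)"
    and K'_le: "\<And>t \<theta>. 0 < t \<Longrightarrow> t < T \<Longrightarrow> 0 < \<theta> \<Longrightarrow> \<theta> < L \<Longrightarrow>
        K' t * (\<theta> * (L - \<theta>)) \<le> 2 * \<alpha> * L * K t * G t \<theta>"
    and t1: "0 \<le> t1" "t1 < T" and \<theta>1: "0 < \<theta>1" "\<theta>1 < L"
  shows "g t1 \<theta>1 \<le> - (K t1 * ((L - \<theta>1) / \<theta>1) powr \<alpha>)"
proof (rule ccontr)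
  define q where "q \<theta> = ((L - \<theta>) / \<theta>) powr \<alpha>" for \<theta>
  \<comment> \<open>The penalty is more singular than \<open>W\<close> at both ends of the interval, and since the velocity vanishes
    linearly there, transport increases it at most at an exponential rate; \<open>lam\<close> exceeds that rate.\<close>
  define P where "P \<theta> = 1 / \<theta> + 1 / (L - \<theta>)" for \<theta>
  define q' where "q' \<theta> = - (\<alpha> * L / (\<theta> * (L - \<theta>)) * q \<theta>)" for \<theta>
  define P' where "P' \<theta> = - 1 / \<theta>\<^sup>2 + 1 / (L - \<theta>)\<^sup>2" for \<theta>
  define p where "p = g t1 \<theta>1 + K t1 * q \<theta>1"
  assume "\<not> ?thesis"
  then have p: "p > 0" by (simp add: p_def q_def)
  have C: "C \<ge> 0" if "0 < t" "t < T" for t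
    using G[OF that \<theta>1] \<theta>1 by (smt (verit) mult_pos_pos zero_le_mult_iff)
  define lam where "lam = C * L + 1"
  have dq: "(q has_real_derivative q' \<theta>) (at \<theta>)" if "0 < \<theta>" "\<theta> < L" for \<theta>
  proof -
    have "(q has_real_derivative \<alpha> * ((L - \<theta>) / \<theta>) powr (\<alpha> - 1) * (- L / \<theta>\<^sup>2)) (at \<theta>)"
      unfolding q_def using that
      by (auto intro!: derivative_eq_intros) (simp add: field_simps power2_eq_square)
    moreover have "\<alpha> * ((L - \<theta>) / \<theta>) powr (\<alpha> - 1) * (- L / \<theta>\<^sup>2) = q' \<theta>"
      using that by (simp add: q'_def q_def powr_diff field_simps power2_eq_square)
    ultimately show ?thesis by simp
  qed
  have dP: "(P has_real_derivative P' \<theta>) (at \<theta>)" if "0 < \<theta>" "\<theta> < L" for \<theta>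
    unfolding P_def P'_def using that
    by (auto intro!: derivative_eq_intros simp: power2_eq_square field_simps)
  have P_pos: "0 < P \<theta>" "1 / L \<le> P \<theta>" "1 / \<theta> \<le> P \<theta>" "1 / (L - \<theta>) \<le> P \<theta>" if "0 < \<theta>" "\<theta> < L" for \<theta>
  proof -
    have "0 < 1 / \<theta>" "0 < 1 / (L - \<theta>)" using that by auto
    then show *: "0 < P \<theta>" "1 / \<theta> \<le> P \<theta>" "1 / (L - \<theta>) \<le> P \<theta>"
      unfolding P_def by linarith+
    have "1 / L \<le> 1 / \<theta>" using that by (simp add: field_simps)
    with *(2) show "1 / L \<le> P \<theta>" by linarith
  qed
  have q_nonneg: "0 \<le> q \<theta>" for \<theta>
    by (simp add: q_def)
  have q_le: "q \<theta> \<le> L powr \<alpha> * \<theta> powr - \<alpha>" if "0 < \<theta>" "\<theta> < L" for \<theta>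
  proof -
    have "q \<theta> \<le> (L / \<theta>) powr \<alpha>"
      unfolding q_def using that \<alpha> by (intro powr_mono2 divide_right_mono) auto
    then show ?thesis
      using that by (simp add: powr_divide powr_minus_divide)
  qed
  obtain Km where Km: "\<And>t. 0 \<le> t \<Longrightarrow> t \<le> t1 \<Longrightarrow> K t \<le> Km" "0 \<le> Km"
  proof -
    have "continuous_on {0..t1} K"
      using t1 by (intro continuous_on_subset[OF K(1)]) auto
    then have "\<exists>x\<in>{0..t1}. \<forall>y\<in>{0..t1}. K y \<le> K x"
      using t1 by (intro continuous_attains_sup) auto
    then obtain x where "x \<in> {0..t1}" "\<And>y. y \<in> {0..t1} \<Longrightarrow> K y \<le> K x" by blast
    then show ?thesis
      using t1 K(2)[of x] by (intro that[of "K x"]) auto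
  qed
  define A1 where "A1 = A + Km * L powr \<alpha>"
  define \<epsilon> where "\<epsilon> = p / (2 * exp (lam * t1) * P \<theta>1)"
  have \<epsilon>: "\<epsilon> > 0" "\<epsilon> * exp (lam * t1) * P \<theta>1 = p / 2"
    using p P_pos(1)[OF \<theta>1] by (auto simp: \<epsilon>_def)
  have "\<forall>\<^sub>F \<delta> in at_right 0. A1 * \<delta> powr (1 - \<alpha>) < \<epsilon> \<and> A1 * (L / 2) powr - \<alpha> * \<delta> < \<epsilon> \<and>
      0 < \<delta> \<and> \<delta> < L / 2 \<and> \<delta> < \<theta>1 \<and> \<delta> < L - \<theta>1"
  proof (intro eventually_conj)
    have "((\<lambda>\<delta>. A1 * \<delta> powr (1 - \<alpha>)) \<longlongrightarrow> A1 * 0 powr (1 - \<alpha>)) (at_right 0)"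
      using \<alpha> by (intro tendsto_intros tendsto_powr2) (auto simp: eventually_at_right_less eventually_at intro!: exI[of _ 1])
    then show "\<forall>\<^sub>F \<delta> in at_right 0. A1 * \<delta> powr (1 - \<alpha>) < \<epsilon>"
      using \<epsilon> by (intro order_tendstoD(2)) auto
    have "((\<lambda>\<delta>. A1 * (L / 2) powr - \<alpha> * \<delta>) \<longlongrightarrow> A1 * (L / 2) powr - \<alpha> * 0) (at_right 0)"
      by (intro tendsto_intros)
    then show "\<forall>\<^sub>F \<delta> in at_right 0. A1 * (L / 2) powr - \<alpha> * \<delta> < \<epsilon>"
      using \<epsilon> by (intro order_tendstoD(2)) auto
  qed (rule eventually_at_right_less | (rule eventually_at_right_0_less, use L \<theta>1 in simp))+
  then obtain \<delta> where \<delta>: "A1 * \<delta> powr (1 - \<alpha>) < \<epsilon>" "A1 * (L / 2) powr - \<alpha> * \<delta> < \<epsilon>"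
      "0 < \<delta>" "\<delta> < L / 2" "\<delta> < \<theta>1" "\<delta> < L - \<theta>1"
    using eventually_happens[of _ "at_right (0::real)"] by (auto simp: trivial_limit_at_right_real)
  define Bq where "Bq = \<alpha> * L / \<delta>\<^sup>2 * (L powr \<alpha> * \<delta> powr - \<alpha>)"
  define Bp where "Bp = 2 / \<delta>\<^sup>2"
  have Bq: "\<bar>q' \<theta>\<bar> \<le> Bq" and Bp: "\<bar>P' \<theta>\<bar> \<le> Bp" if "\<delta> \<le> \<theta>" "\<theta> \<le> L - \<delta>" for \<theta>
  proof -
    have pos: "0 < \<theta>" "\<theta> < L" using that \<delta> by auto
    have "\<bar>q' \<theta>\<bar> = \<alpha> * L / (\<theta> * (L - \<theta>)) * q \<theta>"
      unfolding q'_def using pos \<alpha> L q_nonneg by simp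
    also have "\<dots> \<le> \<alpha> * L / \<delta>\<^sup>2 * (L powr \<alpha> * \<delta> powr - \<alpha>)"
    proof (intro mult_mono divide_left_mono)
      show "\<delta>\<^sup>2 \<le> \<theta> * (L - \<theta>)"
        unfolding power2_eq_square using that \<delta> by (intro mult_mono) auto
      show "q \<theta> \<le> L powr \<alpha> * \<delta> powr - \<alpha>"
        using q_le[OF pos] that \<delta> \<alpha>
        by (elim order_trans) (intro mult_left_mono powr_mono2', auto)
    qed (use \<alpha> L pos \<delta> q_nonneg in auto)
    finally show "\<bar>q' \<theta>\<bar> \<le> Bq" by (simp add: Bq_def)
    have "1 / \<theta>\<^sup>2 \<le> 1 / \<delta>\<^sup>2" "1 / (L - \<theta>)\<^sup>2 \<le> 1 / \<delta>\<^sup>2"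
      using that \<delta> pos by (auto intro!: divide_left_mono power_mono)
    note sq = this
    have "0 \<le> x \<Longrightarrow> 0 \<le> y \<Longrightarrow> x \<le> z \<Longrightarrow> y \<le> z \<Longrightarrow> \<bar>- x + y\<bar> \<le> 2 * z" for x y z :: real
      by linarith
    from this[of "1 / \<theta>\<^sup>2" "1 / (L - \<theta>)\<^sup>2" "1 / \<delta>\<^sup>2"] sq
    have "\<bar>- (1 / \<theta>\<^sup>2) + 1 / (L - \<theta>)\<^sup>2\<bar> \<le> 2 * (1 / \<delta>\<^sup>2)"
      by simp
    then show "\<bar>P' \<theta>\<bar> \<le> Bp"
      unfolding P'_def Bp_def by simp
  qed
  have Bq0: "0 \<le> Bq" using \<alpha> L by (auto simp: Bq_def)
  \<comment> \<open>The size of the errors \<open>E\<close> and \<open>V - 2 G\<close> that the strict inequality gained from the penalty can absorb.\<close>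
  define \<eta> where "\<eta> = min (1 / (2 * L * Bp)) (\<epsilon> / (4 * L * (1 + Km * Bq)))"
  have \<eta>: "0 < \<eta>" "\<eta> * Bp \<le> 1 / (2 * L)" "\<eta> * (1 + Km * Bq) < \<epsilon> / (2 * L)"
  proof -
    have 1: "0 < Bp" "0 < 1 + Km * Bq"
      using \<delta> Km Bq0 by (auto simp: Bp_def intro: add_pos_nonneg)
    then show "0 < \<eta>" using L \<epsilon> by (auto simp: \<eta>_def)
    have "\<eta> * Bp \<le> 1 / (2 * L * Bp) * Bp"
      using 1 by (intro mult_right_mono) (auto simp: \<eta>_def)
    then show "\<eta> * Bp \<le> 1 / (2 * L)" using 1 by simp
    have "\<eta> * (1 + Km * Bq) \<le> \<epsilon> / (4 * L * (1 + Km * Bq)) * (1 + Km * Bq)"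
      using 1 by (intro mult_right_mono) (auto simp: \<eta>_def)
    also have "\<dots> = \<epsilon> / (4 * L)" using 1 by simp
    also have "\<dots> < \<epsilon> / (2 * L)" using \<epsilon> L by (simp add: field_simps)
    finally show "\<eta> * (1 + Km * Bq) < \<epsilon> / (2 * L)" .
  qed
  have "\<forall>\<^sub>F r in at_right 0. (\<forall>t\<in>{0<..<T}. \<forall>\<theta>\<in>{\<delta>..L - \<delta>}. \<bar>E r t \<theta>\<bar> \<le> \<eta> \<and> \<bar>V r t \<theta> - 2 * G t \<theta>\<bar> \<le> \<eta>)
      \<and> g t1 \<theta>1 - p / 2 < W r t1 \<theta>1 \<and> 0 < r \<and> r < \<delta>"
    using order_tendstoD(1)[OF lim[OF t1 \<theta>1], of "g t1 \<theta>1 - p / 2"] p \<delta> \<eta>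
    by (intro eventually_conj small) (auto intro!: eventually_at_right_less eventually_at_right_0_less)
  then obtain r where r: "0 < r" "r < \<delta>" "g t1 \<theta>1 - p / 2 < W r t1 \<theta>1"
    and rE: "\<And>t \<theta>. 0 < t \<Longrightarrow> t < T \<Longrightarrow> \<delta> \<le> \<theta> \<Longrightarrow> \<theta> \<le> L - \<delta> \<Longrightarrow> \<bar>E r t \<theta>\<bar> \<le> \<eta>"
    and rV: "\<And>t \<theta>. 0 < t \<Longrightarrow> t < T \<Longrightarrow> \<delta> \<le> \<theta> \<Longrightarrow> \<theta> \<le> L - \<delta> \<Longrightarrow> \<bar>V r t \<theta> - 2 * G t \<theta>\<bar> \<le> \<eta>"
    using eventually_happens[of _ "at_right (0::real)"] by (force simp: trivial_limit_at_right_real)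
  define D where "D t \<theta> = W r t \<theta> + K t * q \<theta> - \<epsilon> * exp (lam * t) * P \<theta>" for t \<theta>
  have "\<exists>x\<in>{0..t1} \<times> {\<delta>..L - \<delta>}. \<forall>y\<in>{0..t1} \<times> {\<delta>..L - \<delta>}. (\<lambda>(t, \<theta>). D t \<theta>) y \<le> (\<lambda>(t, \<theta>). D t \<theta>) x"
  proof (intro continuous_attains_sup)
    have sub: "{0..t1} \<times> {\<delta>..L - \<delta>} \<subseteq> {0..<T} \<times> {0<..<L}"
      using t1 \<delta> by auto
    have "continuous_on ({0..t1} \<times> {\<delta>..L - \<delta>}) (\<lambda>x. W r (fst x) (snd x))"
      using continuous_on_subset[OF cont[OF r(1)] sub] by (simp add: case_prod_beta)
    moreover have "continuous_on ({0..t1} \<times> {\<delta>..L - \<delta>}) (\<lambda>x. K (fst x))"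
      by (rule continuous_on_compose2[OF K(1)]) (use t1 in \<open>auto intro!: continuous_intros\<close>)
    moreover have cq: "continuous_on {\<delta>..L - \<delta>} q"
      by (rule DERIV_continuous_on, rule has_field_derivative_at_within, rule dq) (use \<delta> in auto)
    have "continuous_on ({0..t1} \<times> {\<delta>..L - \<delta>}) (\<lambda>x. q (snd x))"
      by (rule continuous_on_compose2[OF cq]) (auto intro!: continuous_on_snd continuous_on_id)
    moreover have cP: "continuous_on {\<delta>..L - \<delta>} P"
      by (rule DERIV_continuous_on, rule has_field_derivative_at_within, rule dP) (use \<delta> in auto)
    have "continuous_on ({0..t1} \<times> {\<delta>..L - \<delta>}) (\<lambda>x. P (snd x))"
      by (rule continuous_on_compose2[OF cP]) (auto intro!: continuous_on_snd continuous_on_id)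
    ultimately show "continuous_on ({0..t1} \<times> {\<delta>..L - \<delta>}) (\<lambda>(t, \<theta>). D t \<theta>)"
      unfolding D_def case_prod_beta by (intro continuous_intros)
  qed (use t1 \<delta> in \<open>auto intro!: compact_Times\<close>)
  then obtain t \<theta> where tb: "0 \<le> t" "t \<le> t1" "\<delta> \<le> \<theta>" "\<theta> \<le> L - \<delta>"
    and max: "\<And>t' \<theta>'. 0 \<le> t' \<Longrightarrow> t' \<le> t1 \<Longrightarrow> \<delta> \<le> \<theta>' \<Longrightarrow> \<theta>' \<le> L - \<delta> \<Longrightarrow> D t' \<theta>' \<le> D t \<theta>"
    by auto
  have \<theta>: "0 < \<theta>" "\<theta> < L" using tb \<delta> by auto
  have "0 < D t1 \<theta>1"
    using r(3) p_def unfolding D_def \<epsilon>(2) by linarith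
  also have "\<dots> \<le> D t \<theta>"
    using t1 \<delta> by (intro max) auto
  finally have D_pos: "0 < D t \<theta>" .
  have lam0: "0 \<le> lam * t"
  proof (cases "t = 0")
    case False
    then have "0 \<le> C" using C[of t] tb t1 by auto
    then show ?thesis using L tb by (simp add: lam_def)
  qed simp
  then have e1: "1 \<le> exp (lam * t)" by simp
  have D_le: "D t \<theta> \<le> A1 * \<theta> powr - \<alpha> - \<epsilon> * P \<theta>"
  proof -
    have "W r t \<theta> \<le> A * \<theta> powr - \<alpha>"
      using bound[of r t \<theta>] r tb t1 \<theta> by (simp add: abs_le_iff)
    moreover have "K t * q \<theta> \<le> Km * (L powr \<alpha> * \<theta> powr - \<alpha>)"
      using Km K(2)[of t] tb t1 q_le[OF \<theta>] q_nonneg by (intro mult_mono) auto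
    moreover have "\<epsilon> * 1 * P \<theta> \<le> \<epsilon> * exp (lam * t) * P \<theta>"
      using \<epsilon>(1) e1 P_pos(1)[OF \<theta>] by (intro mult_right_mono mult_left_mono) auto
    ultimately show ?thesis
      by (simp add: D_def A1_def algebra_simps)
  qed
  have "\<theta> \<noteq> \<delta>"
  proof
    assume "\<theta> = \<delta>"
    have "A1 * \<theta> powr - \<alpha> = A1 * \<delta> powr (1 - \<alpha>) * (1 / \<theta>)"
      using \<delta> \<open>\<theta> = \<delta>\<close> by (simp add: powr_diff powr_minus field_simps)
    also have "\<dots> \<le> \<epsilon> * (1 / \<theta>)"
      using \<delta> \<theta> by (intro mult_right_mono) auto
    also have "\<dots> \<le> \<epsilon> * P \<theta>"
      using \<epsilon> P_pos(3)[OF \<theta>] by (intro mult_left_mono) auto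
    finally show False using D_le D_pos by simp
  qed
  moreover have "\<theta> \<noteq> L - \<delta>"
  proof
    assume eq: "\<theta> = L - \<delta>"
    have A1: "0 \<le> A1"
    proof -
      have "0 \<le> A * \<theta> powr - \<alpha>"
        using bound[of r t \<theta>] r tb t1 \<theta> abs_ge_zero order_trans by fastforce
      then have "0 \<le> A" using \<theta> by (simp add: zero_le_mult_iff)
      then show ?thesis using Km by (simp add: A1_def)
    qed
    have "A1 * \<theta> powr - \<alpha> \<le> A1 * (L / 2) powr - \<alpha>"
      using A1 \<alpha> L \<delta> eq by (intro mult_left_mono powr_mono2') auto
    also have "\<dots> = A1 * (L / 2) powr - \<alpha> * \<delta> * (1 / (L - \<theta>))"
      using \<delta> eq by simp
    also have "\<dots> \<le> \<epsilon> * (1 / (L - \<theta>))"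
      using \<delta> \<theta> by (intro mult_right_mono) auto
    also have "\<dots> \<le> \<epsilon> * P \<theta>"
      using \<epsilon> P_pos(4)[OF \<theta>] by (intro mult_left_mono) auto
    finally show False using D_le D_pos by simp
  qed
  ultimately have \<theta>_int: "\<delta> < \<theta>" "\<theta> < L - \<delta>" using tb by auto
  have "t \<noteq> 0"
  proof
    assume "t = 0"
    \<comment> \<open>The constant \<open>2 L\<close> leaves room for \<open>r + \<theta> \<le> 2 \<theta>\<close>, which holds for \<open>r < \<delta> \<le> \<theta>\<close>.\<close>
    have "K 0 * q \<theta> \<le> (2 * L) powr - \<alpha> * q \<theta>"
      using K(3) q_nonneg by (intro mult_right_mono) auto
    also have "\<dots> = ((L - \<theta>) / (2 * L * \<theta>)) powr \<alpha>"
      unfolding q_def using \<theta> L by (simp add: powr_divide powr_mult powr_minus field_simps)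
    also have "\<dots> \<le> (1 / (r + \<theta>)) powr \<alpha>"
    proof (intro powr_mono2)
      have "(L - \<theta>) * (r + \<theta>) \<le> L * (2 * \<theta>)"
        using r \<theta> tb by (intro mult_mono) auto
      then show "(L - \<theta>) / (2 * L * \<theta>) \<le> 1 / (r + \<theta>)"
        using r \<theta> L by (simp add: field_simps)
    qed (use \<alpha> \<theta> L in auto)
    also have "\<dots> = (r + \<theta>) powr - \<alpha>"
      using r \<theta> by (simp add: powr_divide powr_minus_divide)
    finally have "D 0 \<theta> \<le> - (\<epsilon> * P \<theta>)"
      using init[OF r(1) \<theta>] by (simp add: D_def)
    moreover have "0 < \<epsilon> * P \<theta>"
      using \<epsilon> P_pos[OF \<theta>] by simp
    ultimately show False
      using D_pos \<open>t = 0\<close> by simp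
  qed
  then have t: "0 < t" "t < T" using tb t1 by auto
  note [derivative_intros] = Wt[OF r(1) t \<theta>] Wy[OF r(1) t \<theta>] K'[OF t] dq[OF \<theta>] dP[OF \<theta>]
  have Dt: "((\<lambda>t. D t \<theta>) has_real_derivative
      (E r t \<theta> - V r t \<theta> * Wy r t \<theta>) + K' t * q \<theta> - \<epsilon> * (lam * exp (lam * t)) * P \<theta>) (at t)"
    unfolding D_def by (rule derivative_eq_intros refl)+ simp
  have Dy: "((\<lambda>\<theta>. D t \<theta>) has_real_derivative
      Wy r t \<theta> + K t * q' \<theta> - \<epsilon> * exp (lam * t) * P' \<theta>) (at \<theta>)"
    unfolding D_def by (rule derivative_eq_intros refl)+ simp
  have 1: "0 \<le> (E r t \<theta> - V r t \<theta> * Wy r t \<theta>) + K' t * q \<theta> - \<epsilon> * (lam * exp (lam * t)) * P \<theta>"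
  proof (rule ccontr)
    assume "\<not> ?thesis"
    then have neg: "(E r t \<theta> - V r t \<theta> * Wy r t \<theta>) + K' t * q \<theta> - \<epsilon> * (lam * exp (lam * t)) * P \<theta> < 0" by simp
    obtain d where d: "d > 0" "\<And>h. 0 < h \<Longrightarrow> h < d \<Longrightarrow> D t \<theta> < D (t - h) \<theta>"
      using DERIV_neg_dec_left[OF Dt neg] by blast
    have "D t \<theta> < D (t - min (d / 2) t) \<theta>"
      using d t by (intro d(2)) auto
    moreover have "D (t - min (d / 2) t) \<theta> \<le> D t \<theta>"
      using d(1) t tb by (intro max) auto
    ultimately show False by simp
  qed
  have 2: "Wy r t \<theta> + K t * q' \<theta> - \<epsilon> * exp (lam * t) * P' \<theta> = 0"
  proof (rule DERIV_local_max[OF Dy])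
    show "0 < min (\<theta> - \<delta>) (L - \<delta> - \<theta>)" using \<theta>_int by simp
    show "\<forall>y. \<bar>\<theta> - y\<bar> < min (\<theta> - \<delta>) (L - \<delta> - \<theta>) \<longrightarrow> D t y \<le> D t \<theta>"
      using tb by (auto intro!: max simp: abs_less_iff)
  qed
  define e where "e = V r t \<theta> - 2 * G t \<theta>"
  have e: "\<bar>e\<bar> \<le> \<eta>" using rV[OF t tb(3,4)] by (simp add: e_def)
  have E_le: "\<bar>E r t \<theta>\<bar> \<le> \<eta>" using rE[OF t tb(3,4)] .
  have Wy_eq: "Wy r t \<theta> = \<epsilon> * exp (lam * t) * P' \<theta> - K t * q' \<theta>" using 2 by simp
  have V_eq: "V r t \<theta> = 2 * G t \<theta> + e" by (simp add: e_def)
  have E_ge: "\<epsilon> * exp (lam * t) * (lam * P \<theta> + 2 * G t \<theta> * P' \<theta> + e * P' \<theta>) -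
      (K' t * q \<theta> + 2 * G t \<theta> * K t * q' \<theta>) - e * K t * q' \<theta> \<le> E r t \<theta>"
    using 1 unfolding Wy_eq V_eq by (simp add: algebra_simps)
  have sub: "K' t * q \<theta> + 2 * G t \<theta> * K t * q' \<theta> \<le> 0"
  proof -
    have x: "\<theta> * (L - \<theta>) > 0" using \<theta> by simp
    have "K' t \<le> 2 * \<alpha> * L * K t * G t \<theta> / (\<theta> * (L - \<theta>))"
      using K'_le[OF t \<theta>] x by (simp add: pos_le_divide_eq)
    then have "K' t * q \<theta> \<le> 2 * \<alpha> * L * K t * G t \<theta> / (\<theta> * (L - \<theta>)) * q \<theta>"
      using q_nonneg by (intro mult_right_mono)
    also have "\<dots> = - (2 * G t \<theta> * K t * q' \<theta>)"
      by (simp add: q'_def)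
    finally show ?thesis by simp
  qed
  have pen: "1 / (2 * L) \<le> lam * P \<theta> + 2 * G t \<theta> * P' \<theta> + e * P' \<theta>"
  proof -
    have "\<bar>2 * G t \<theta> * P' \<theta>\<bar> \<le> C * (\<theta> * (L - \<theta>)) * (1 / \<theta>\<^sup>2 + 1 / (L - \<theta>)\<^sup>2)"
    proof (unfold abs_mult[of "2 * G t \<theta>"], intro mult_mono)
      have "\<bar>P' \<theta>\<bar> \<le> \<bar>1 / (L - \<theta>)\<^sup>2\<bar> + \<bar>1 / \<theta>\<^sup>2\<bar>"
        using abs_triangle_ineq4[of "1 / (L - \<theta>)\<^sup>2" "1 / \<theta>\<^sup>2"] by (simp add: P'_def)
      then show "\<bar>P' \<theta>\<bar> \<le> 1 / \<theta>\<^sup>2 + 1 / (L - \<theta>)\<^sup>2"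
        by simp
    qed (use G[OF t \<theta>] C[OF t] \<theta> in auto)
    also have "\<dots> = C * ((L - \<theta>) / \<theta> + \<theta> / (L - \<theta>))"
    proof -
      have "a * b * (1 / a\<^sup>2 + 1 / b\<^sup>2) = b / a + a / b" if "0 < a" "0 < b" for a b :: real
        using that by (simp add: field_simps power2_eq_square)
      from this[of \<theta> "L - \<theta>"] \<theta> show ?thesis
        by (simp only: mult.assoc diff_gt_0_iff_gt)
    qed
    also have "\<dots> \<le> C * (L / \<theta> + L / (L - \<theta>))"
      using \<theta> C[OF t] by (intro mult_left_mono add_mono divide_right_mono) auto
    also have "\<dots> = C * L * P \<theta>"
      by (simp add: P_def algebra_simps)
    finally have a: "- (C * L * P \<theta>) \<le> 2 * G t \<theta> * P' \<theta>" by (simp add: abs_le_iff)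
    have "\<bar>e * P' \<theta>\<bar> \<le> \<eta> * Bp"
      unfolding abs_mult using e Bp[OF tb(3,4)] \<eta> by (intro mult_mono) auto
    then have b: "- (1 / (2 * L)) \<le> e * P' \<theta>"
      using \<eta>(2) by (simp add: abs_le_iff)
    have c: "1 / L \<le> P \<theta>" using P_pos(2)[OF \<theta>] .
    have "lam * P \<theta> = C * L * P \<theta> + P \<theta>" by (simp add: lam_def algebra_simps)
    moreover have "1 / L - 1 / (2 * L) = 1 / (2 * L)" using L by (simp add: field_simps)
    ultimately show ?thesis using a b c by linarith
  qed
  have "\<epsilon> * 1 * (1 / (2 * L)) \<le> \<epsilon> * exp (lam * t) * (lam * P \<theta> + 2 * G t \<theta> * P' \<theta> + e * P' \<theta>)"
    using \<epsilon> e1 pen L by (intro mult_mono) auto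
  moreover have "\<bar>e * K t * q' \<theta>\<bar> \<le> \<eta> * Km * Bq"
    unfolding abs_mult using e Km K(2)[of t] tb t Bq[OF tb(3,4)] \<eta> by (intro mult_mono) auto
  then have "e * K t * q' \<theta> \<le> \<eta> * Km * Bq" by (simp add: abs_le_iff)
  ultimately have "\<epsilon> / (2 * L) - \<eta> * Km * Bq \<le> \<eta>"
    using E_ge sub E_le by (simp add: abs_le_iff)
  then show False
    using \<eta>(3) by (simp add: algebra_simps)
qed

section \<open>Finite lifespan\<close>

lemma continuous_on_uniform_times:
  fixes F :: "real \<Rightarrow> real \<Rightarrow> real"
  assumes cont: "\<And>t. t \<in> S \<Longrightarrow> continuous_on U (F t)"
    and unif: "\<And>t \<epsilon>. t \<in> S \<Longrightarrow> 0 < \<epsilon> \<Longrightarrow> \<forall>\<^sub>F s in at t within S. \<forall>\<theta>\<in>U. \<bar>F s \<theta> - F t \<theta>\<bar> \<le> \<epsilon>"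
  shows "continuous_on (S \<times> U) (\<lambda>(t, \<theta>). F t \<theta>)"
  unfolding continuous_on_iff
proof (clarify, goal_cases)
  case (1 t \<theta> e)
  obtain d1 where d1: "d1 > 0" "\<And>\<theta>'. \<theta>' \<in> U \<Longrightarrow> dist \<theta>' \<theta> < d1 \<Longrightarrow> dist (F t \<theta>') (F t \<theta>) < e / 2"
    using cont[OF 1(1)] 1 unfolding continuous_on_iff by (meson half_gt_zero)
  obtain d2 where d2: "d2 > 0" "\<And>s \<theta>'. s \<in> S \<Longrightarrow> s \<noteq> t \<Longrightarrow> dist s t < d2 \<Longrightarrow> \<theta>' \<in> U \<Longrightarrow> \<bar>F s \<theta>' - F t \<theta>'\<bar> \<le> e / 2"
    using unif[OF 1(1), of "e / 2"] 1 unfolding eventually_at by (meson half_gt_zero)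
  show ?case
  proof (intro exI[of _ "min d1 d2"] conjI ballI impI, safe)
    fix s \<theta>' assume s: "s \<in> S" "\<theta>' \<in> U" "dist (s, \<theta>') (t, \<theta>) < min d1 d2"
    have "dist s t < d2" "dist \<theta>' \<theta> < d1"
      using s(3) dist_fst_le[of "(s, \<theta>')" "(t, \<theta>)"] dist_snd_le[of "(s, \<theta>')" "(t, \<theta>)"] by auto
    then have "\<bar>F s \<theta>' - F t \<theta>'\<bar> \<le> e / 2" "dist (F t \<theta>') (F t \<theta>) < e / 2"
      using d1(2) d2(2) s 1 by (cases "s = t"; auto)+
    then show "dist (F s \<theta>') (F t \<theta>) < e"
      unfolding dist_real_def by linarith
  qed (use d1 d2 in auto)
qed

text \<open>The blow-up time of \<open>K' = \<kappa> c K\<^sup>2\<close>, \<open>K 0 = (2 L) powr - \<alpha>\<close>, with \<open>\<kappa> = \<alpha> / (2 sin(2 L))\<close>, \<open>c\<close> the growth moment.\<close>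

definition lifespan_bound :: "real \<Rightarrow> real \<Rightarrow> real" where
  "lifespan_bound L \<alpha> = 1 / ((2 * L) powr - \<alpha> * (\<alpha> / (2 * sin (2 * L))) * growth_moment L \<alpha>)"

lemma solution_time_bound:
  assumes m: "m \<ge> 3" and \<alpha>: "0 < \<alpha>" "\<alpha> < 1"
    and sol: "euler_solution m \<alpha> (initial_vorticity m \<alpha>) T \<omega>"
    and T': "0 < T'" "T' < T"
  shows "T' \<le> lifespan_bound (pi / real m) \<alpha>"
proof -
  define L where "L = pi / real m"
  have L: "0 < L" "L \<le> pi / 3"
    unfolding L_def using m by (simp, intro frac_le, auto)
  \<comment> \<open>The bounds are uniform only up to times smaller than \<open>T\<close>.\<close>
  define T1 where "T1 = (T' + T) / 2"
  have T1: "0 < T1" "T' < T1" "T1 < T" using T' by (auto simp: T1_def)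
  have inC: "in_C_Comega m \<alpha> T \<omega>" and \<omega>0: "\<omega> 0 = initial_vorticity m \<alpha>"
    using sol by (auto simp: euler_solution_def)
  obtain \<psi> where \<psi>: "\<And>t. t \<in> {0..<T} \<Longrightarrow> stream_function m (\<omega> t) (\<psi> t)"
    and eq: "\<And>t r \<theta>. t \<in> {0<..<T} \<Longrightarrow> (r, \<theta>) \<in> sector m \<Longrightarrow>
       ((\<lambda>s. \<omega> s (rcis r \<theta>)) has_real_derivative
              - (velocity_r (\<psi> t) r \<theta> * dr 1 (\<omega> t) r \<theta>
                 + velocity_theta (\<psi> t) r \<theta> / r * dtheta 1 (\<omega> t) r \<theta>)) (at t)"
    using sol unfolding euler_solution_def by blast
  obtain A where A: "A > 0" and smooth: "\<And>t. 0 \<le> t \<Longrightarrow> t \<le> T1 \<Longrightarrow> smooth_in_sector m (\<omega> t)"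
    and wb: "\<And>t. 0 \<le> t \<Longrightarrow> t \<le> T1 \<Longrightarrow> weighted_bound m \<alpha> A (\<omega> t)"
    and tcont: "\<And>t \<epsilon>. 0 \<le> t \<Longrightarrow> t \<le> T1 \<Longrightarrow> 0 < \<epsilon> \<Longrightarrow> \<forall>\<^sub>F s in at t within {0..T1}.
        \<forall>(r, \<theta>) \<in> sector m. \<bar>\<omega> s (rcis r \<theta>) - \<omega> t (rcis r \<theta>)\<bar> \<le> \<epsilon> * (r + \<theta>) powr - \<alpha>"
    using in_C_Comega_uniform[OF inC, of T1] T1 by auto
  have bv: "bounded_vorticity m \<alpha> A (\<omega> t)" if "0 \<le> t" "t \<le> T1" for t
    by unfold_locales (use m \<alpha> A wb smooth that in auto)
  define g where "g t = origin_trace (\<omega> t)" for t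
  have prof: "angular_profile L \<alpha> A (g t)" if "0 \<le> t" "t \<le> T1" for t
  proof -
    interpret bounded_vorticity m \<alpha> A "\<omega> t" by (rule bv[OF that])
    show ?thesis unfolding L_def g_def by (rule profile.angular_profile_axioms)
  qed
  have comparison: "g t \<theta> \<le> - (K t * ((L - \<theta>) / \<theta>) powr \<alpha>)"
    if K: "continuous_on {0..<T1} K" "\<And>t. 0 \<le> t \<Longrightarrow> t < T1 \<Longrightarrow> 0 \<le> K t" "K 0 \<le> (2 * L) powr - \<alpha>"
      "\<And>t. 0 < t \<Longrightarrow> t < T1 \<Longrightarrow> (K has_real_derivative K' t) (at t)"
      "\<And>t \<theta>. 0 < t \<Longrightarrow> t < T1 \<Longrightarrow> 0 < \<theta> \<Longrightarrow> \<theta> < L \<Longrightarrow>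
        K' t * (\<theta> * (L - \<theta>)) \<le> 2 * \<alpha> * L * K t * green L (g t) \<theta>"
      and t: "0 \<le> t" "t < T1" and \<theta>: "0 < \<theta>" "\<theta> < L"
    for K K' t \<theta>
  proof (rule transport_comparison[where W = "\<lambda>r t \<theta>. \<omega> t (rcis r \<theta>)" and
        Wy = "\<lambda>r t \<theta>. dtheta 1 (\<omega> t) r \<theta>" and V = "\<lambda>r t \<theta>. velocity_theta (\<psi> t) r \<theta> / r" and
        E = "\<lambda>r t \<theta>. - (velocity_r (\<psi> t) r \<theta> * dr 1 (\<omega> t) r \<theta>)" and T = T1 and K = K and
        K' = K' and A = A and C = "2 * (A * green_const L \<alpha>)" and G = "\<lambda>t. green L (g t)",
        OF L(1) \<alpha>(1,2) _ _ _ _ _ _ _ _ K t \<theta>])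
    fix r t \<theta> :: real assume r: "0 < r" and t: "0 \<le> t" "t < T1" and \<theta>: "0 < \<theta>" "\<theta> < L"
    show "\<bar>\<omega> t (rcis r \<theta>)\<bar> \<le> A * \<theta> powr - \<alpha>"
      using bounded_vorticity.f_bound(2)[OF bv r] t \<theta> by (simp add: L_def)
  next
    fix r :: real assume r: "0 < r"
    show "continuous_on ({0..<T1} \<times> {0<..<L}) (\<lambda>(t, \<theta>). \<omega> t (rcis r \<theta>))"
    proof (rule continuous_on_uniform_times)
      fix t assume t: "t \<in> {0..<T1}"
      show "continuous_on {0<..<L} (\<lambda>\<theta>. \<omega> t (rcis r \<theta>))"
        using bounded_vorticity.continuous_angular[OF bv r] t by (simp add: L_def)
      fix \<epsilon> :: real assume \<epsilon>: "0 < \<epsilon>"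
      have "0 < \<epsilon> * r powr \<alpha>" using \<epsilon> r by simp
      with t have "\<forall>\<^sub>F s in at t within {0..T1}. \<forall>(\<rho>, \<theta>) \<in> sector m.
          \<bar>\<omega> s (rcis \<rho> \<theta>) - \<omega> t (rcis \<rho> \<theta>)\<bar> \<le> \<epsilon> * r powr \<alpha> * (\<rho> + \<theta>) powr - \<alpha>"
        by (intro tcont) auto
      then have "\<forall>\<^sub>F s in at t within {0..<T1}. \<forall>(\<rho>, \<theta>) \<in> sector m.
          \<bar>\<omega> s (rcis \<rho> \<theta>) - \<omega> t (rcis \<rho> \<theta>)\<bar> \<le> \<epsilon> * r powr \<alpha> * (\<rho> + \<theta>) powr - \<alpha>"
        by (rule filter_leD[OF at_le, rotated]) auto
      then show "\<forall>\<^sub>F s in at t within {0..<T1}. \<forall>\<theta>\<in>{0<..<L}. \<bar>\<omega> s (rcis r \<theta>) - \<omega> t (rcis r \<theta>)\<bar> \<le> \<epsilon>"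
      proof (rule eventually_mono, intro ballI)
        fix s \<theta> assume s: "\<forall>(\<rho>, \<theta>) \<in> sector m.
            \<bar>\<omega> s (rcis \<rho> \<theta>) - \<omega> t (rcis \<rho> \<theta>)\<bar> \<le> \<epsilon> * r powr \<alpha> * (\<rho> + \<theta>) powr - \<alpha>" and \<theta>: "\<theta> \<in> {0<..<L}"
        then have "(r, \<theta>) \<in> sector m" using r by (simp add: sector_def L_def)
        with s have "\<bar>\<omega> s (rcis r \<theta>) - \<omega> t (rcis r \<theta>)\<bar> \<le> \<epsilon> * r powr \<alpha> * (r + \<theta>) powr - \<alpha>" by auto
        also have "\<dots> \<le> \<epsilon> * r powr \<alpha> * r powr - \<alpha>"
          using \<epsilon> r \<theta> \<alpha> by (intro mult_left_mono powr_mono2') auto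
        also have "\<dots> = \<epsilon>" using r by (simp add: powr_minus_divide)
        finally show "\<bar>\<omega> s (rcis r \<theta>) - \<omega> t (rcis r \<theta>)\<bar> \<le> \<epsilon>" .
      qed
    qed
  next
    fix r t \<theta> :: real assume r: "0 < r" and t: "0 < t" "t < T1" and \<theta>: "0 < \<theta>" "\<theta> < L"
    have s: "(r, \<theta>) \<in> sector m" using r \<theta> by (simp add: sector_def L_def)
    show "((\<lambda>t. \<omega> t (rcis r \<theta>)) has_real_derivative
        - (velocity_r (\<psi> t) r \<theta> * dr 1 (\<omega> t) r \<theta>) - velocity_theta (\<psi> t) r \<theta> / r * dtheta 1 (\<omega> t) r \<theta>) (at t)"
      using eq[of t r \<theta>] s t T1 by simp
    show "((\<lambda>\<theta>. \<omega> t (rcis r \<theta>)) has_real_derivative dtheta 1 (\<omega> t) r \<theta>) (at \<theta>)"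
      using t by (intro DERIV_angular_of_smooth[OF _ s] smooth) auto
  next
    fix \<delta> \<eta> :: real assume \<delta>: "0 < \<delta>" and \<eta>: "0 < \<eta>"
    define \<gamma> where "\<gamma> = (1 - \<alpha>) / 2"
    have \<gamma>: "0 < \<gamma>" using \<alpha> by (simp add: \<gamma>_def)
    define c where "c = 2 * A * grad_const L (\<alpha> + \<gamma>) (2 + \<gamma>) \<delta>"
    define k where "k = (A * green_const L \<alpha> * L + c) * (A * \<delta> powr - (1 + \<alpha>))"
    have "((\<lambda>r. c * r powr \<gamma>) \<longlongrightarrow> c * 0 powr \<gamma>) (at_right 0)"
      using \<gamma> by (intro tendsto_intros tendsto_powr2) (auto simp: eventually_at intro!: exI[of _ 1])
    then have ev1: "\<forall>\<^sub>F r in at_right 0. c * r powr \<gamma> < \<eta>"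
      using \<eta> by (intro order_tendstoD(2)) auto
    have "((\<lambda>r. k * r) \<longlongrightarrow> k * 0) (at_right 0)"
      by (intro tendsto_intros)
    then have ev2: "\<forall>\<^sub>F r in at_right 0. k * r < \<eta>"
      using \<eta> by (intro order_tendstoD(2)) auto
    show "\<forall>\<^sub>F r in at_right 0. \<forall>t\<in>{0<..<T1}. \<forall>\<theta>\<in>{\<delta>..L - \<delta>}.
        \<bar>- (velocity_r (\<psi> t) r \<theta> * dr 1 (\<omega> t) r \<theta>)\<bar> \<le> \<eta> \<and>
        \<bar>velocity_theta (\<psi> t) r \<theta> / r - 2 * green L (g t) \<theta>\<bar> \<le> \<eta>"
      using ev1 ev2 eventually_at_right_less eventually_at_right_0_less[OF zero_less_one]
    proof (eventually_elim, intro ballI conjI)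
      fix r t \<theta> :: real
      assume ev: "c * r powr \<gamma> < \<eta>" "k * r < \<eta>" and r: "0 < r" "r < 1"
        and t: "t \<in> {0<..<T1}" and \<theta>: "\<theta> \<in> {\<delta>..L - \<delta>}"
      interpret bounded_vorticity m \<alpha> A "\<omega> t" using t by (intro bv) auto
      have str: "stream_function m (\<omega> t) (\<psi> t)" using \<psi>[of t] t T1 by auto
      have \<theta>': "\<delta> \<le> \<theta>" "\<theta> \<le> L - \<delta>" "0 < \<theta>" "\<theta> < L" using \<theta> \<delta> by auto
      note v = velocity_near_origin[OF str r(1) less_imp_le[OF r(2)] \<delta> \<theta>'(1) \<theta>'(2)[unfolded L_def], folded L_def \<gamma>_def, folded c_def]
      show "\<bar>velocity_theta (\<psi> t) r \<theta> / r - 2 * green L (g t) \<theta>\<bar> \<le> \<eta>"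
        using v(1) ev(1) by (simp add: g_def)
      have "\<bar>dr 1 (\<omega> t) r \<theta>\<bar> \<le> A * \<theta> powr - (1 + \<alpha>)"
        using f_bound(3)[OF r(1) \<theta>'(3) \<theta>'(4)[unfolded L_def]] .
      also have "\<dots> \<le> A * \<delta> powr - (1 + \<alpha>)"
        using A \<delta> \<theta>' \<alpha> by (intro mult_left_mono powr_mono2') auto
      finally have d: "\<bar>dr 1 (\<omega> t) r \<theta>\<bar> \<le> A * \<delta> powr - (1 + \<alpha>)" .
      have "\<bar>velocity_r (\<psi> t) r \<theta> * dr 1 (\<omega> t) r \<theta>\<bar> \<le>
          (A * green_const L \<alpha> * L + c) * r * (A * \<delta> powr - (1 + \<alpha>))"
        unfolding abs_mult using v(2) d by (intro mult_mono order_trans[OF abs_ge_zero v(2)]) auto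
      also have "\<dots> = k * r" by (simp add: k_def)
      finally show "\<bar>- (velocity_r (\<psi> t) r \<theta> * dr 1 (\<omega> t) r \<theta>)\<bar> \<le> \<eta>"
        using ev(2) by simp
    qed
  next
    fix t \<theta> :: real assume t: "0 < t" "t < T1" and \<theta>: "0 < \<theta>" "\<theta> < L"
    have "\<bar>green L (g t) \<theta>\<bar> \<le> A * green_const L \<alpha> * (\<theta> * (L - \<theta>))"
      using angular_profile.green_upper[OF prof \<theta>] t by simp
    then show "\<bar>2 * green L (g t) \<theta>\<bar> \<le> 2 * (A * green_const L \<alpha>) * (\<theta> * (L - \<theta>))"
      by simp
  next
    fix r \<theta> :: real assume "0 < r" "0 < \<theta>" "\<theta> < L"
    then show "\<omega> 0 (rcis r \<theta>) = - ((r + \<theta>) powr - \<alpha>)"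
      unfolding \<omega>0 L_def using m by (intro initial_vorticity_sector) auto
  next
    fix t \<theta> :: real assume "0 \<le> t" "t < T1" "0 < \<theta>" "\<theta> < L"
    then show "((\<lambda>r. \<omega> t (rcis r \<theta>)) \<longlongrightarrow> g t \<theta>) (at_right 0)"
      unfolding g_def L_def by (intro bounded_vorticity.trace_tendsto[OF bv]) auto
  qed
  have neg: "g t \<theta> \<le> 0" if "0 \<le> t" "t < T1" "0 < \<theta>" "\<theta> < L" for t \<theta>
    using comparison[of "\<lambda>_. 0" "\<lambda>_. 0" t \<theta>] that by simp
  define M where "M t = moment L (g t)" for t
  have contM: "continuous_on {0..T1} M"
    unfolding continuous_on_def
  proof
    fix t assume t: "t \<in> {0..T1}"
    have "((\<lambda>s. M s - M t) \<longlongrightarrow> 0) (at t within {0..T1})"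
    proof (rule tendstoI)
      fix e :: real assume e: "0 < e"
      define k where "k = 2 * L powr (1 - \<alpha>) * L"
      have k: "0 < k" using L by (simp add: k_def)
      define \<epsilon> where "\<epsilon> = e / (2 * k)"
      have \<epsilon>: "0 < \<epsilon>" "\<epsilon> * k < e" using e k by (auto simp: \<epsilon>_def)
      have "\<forall>\<^sub>F s in at t within {0..T1}. s \<in> {0..T1} \<and> (\<forall>(r, \<theta>) \<in> sector m.
          \<bar>\<omega> s (rcis r \<theta>) - \<omega> t (rcis r \<theta>)\<bar> \<le> \<epsilon> * (r + \<theta>) powr - \<alpha>)"
        using t \<epsilon> by (intro eventually_conj tcont) (auto simp: eventually_at_filter)
      then show "\<forall>\<^sub>F s in at t within {0..T1}. dist (M s - M t) 0 < e"
      proof (rule eventually_mono, elim conjE)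
        fix s assume s: "s \<in> {0..T1}" and close: "\<forall>(r, \<theta>) \<in> sector m.
          \<bar>\<omega> s (rcis r \<theta>) - \<omega> t (rcis r \<theta>)\<bar> \<le> \<epsilon> * (r + \<theta>) powr - \<alpha>"
        have ps: "angular_profile L \<alpha> A (g s)" and pt: "angular_profile L \<alpha> A (g t)"
          using s t by (auto intro!: prof)
        have bs: "bounded_vorticity m \<alpha> A (\<omega> s)" and bt: "bounded_vorticity m \<alpha> A (\<omega> t)"
          using s t by (auto intro!: bv)
        have "angular_profile L \<alpha> \<epsilon> (\<lambda>\<theta>. g s \<theta> - g t \<theta>)"
        proof
          show "continuous_on {0<..<L} (\<lambda>\<theta>. g s \<theta> - g t \<theta>)"
            by (intro continuous_on_diff angular_profile.cont[OF ps] angular_profile.cont[OF pt])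
          fix \<theta> assume \<theta>: "0 < \<theta>" "\<theta> < L"
          show "\<bar>g s \<theta> - g t \<theta>\<bar> \<le> \<epsilon> * \<theta> powr - \<alpha>"
          proof (rule tendsto_upperbound)
            show "((\<lambda>r. \<bar>\<omega> s (rcis r \<theta>) - \<omega> t (rcis r \<theta>)\<bar>) \<longlongrightarrow> \<bar>g s \<theta> - g t \<theta>\<bar>) (at_right 0)"
              unfolding g_def using \<theta> by (intro tendsto_intros bounded_vorticity.trace_tendsto[OF bs]
                  bounded_vorticity.trace_tendsto[OF bt]) (auto simp: L_def)
            show "\<forall>\<^sub>F r in at_right 0. \<bar>\<omega> s (rcis r \<theta>) - \<omega> t (rcis r \<theta>)\<bar> \<le> \<epsilon> * \<theta> powr - \<alpha>"
            proof (rule eventually_mono[OF eventually_at_right_less])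
              fix r :: real assume r: "0 < r"
              then have "(r, \<theta>) \<in> sector m" using \<theta> by (simp add: sector_def L_def)
              with close have "\<bar>\<omega> s (rcis r \<theta>) - \<omega> t (rcis r \<theta>)\<bar> \<le> \<epsilon> * (r + \<theta>) powr - \<alpha>" by auto
              also have "\<dots> \<le> \<epsilon> * \<theta> powr - \<alpha>"
                using \<epsilon> r \<theta> \<alpha> by (intro mult_left_mono powr_mono2') auto
              finally show "\<bar>\<omega> s (rcis r \<theta>) - \<omega> t (rcis r \<theta>)\<bar> \<le> \<epsilon> * \<theta> powr - \<alpha>" .
            qed
          qed (rule trivial_limit_at_right_real)
        qed (use L \<alpha> in auto)
        from angular_profile.moment_bound[OF this] have "\<bar>M s - M t\<bar> \<le> \<epsilon> * k"
          unfolding M_def moment_diff[OF ps pt] k_def .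
        then show "dist (M s - M t) 0 < e" using \<epsilon> by simp
      qed
    qed
    then show "(M \<longlongrightarrow> M t) (at t within {0..T1})" by (simp add: LIM_zero_iff)
  qed
  define \<kappa> where "\<kappa> = \<alpha> / (2 * sin (2 * L))"
  define K0 where "K0 = (2 * L) powr - \<alpha>"
  define I where "I t = integral {0..t} M" for t
  define K where "K t = K0 * exp (\<kappa> * I t)" for t
  have sin0: "0 < sin (2 * L)"
    using angular_profile.sin_2L[OF prof[of 0]] T1 by simp
  have \<kappa>: "0 < \<kappa>" and K0: "0 < K0"
    using sin0 \<alpha> L by (auto simp: \<kappa>_def K0_def)
  have I': "(I has_real_derivative M t) (at t within {0..T1})" if "t \<in> {0..T1}" for t
    unfolding I_def by (rule integral_has_real_derivative[OF contM that])
  have dI: "(I has_real_derivative M t) (at t)" if "0 < t" "t < T1" for t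
    using I'[of t] that by (simp add: at_within_Icc_at)
  have contI: "continuous_on {0..T1} I"
    by (rule DERIV_continuous_on[OF I'])
  have dK: "(K has_real_derivative \<kappa> * M t * K t) (at t)" if "0 < t" "t < T1" for t
    unfolding K_def using dI[OF that] by (auto intro!: derivative_eq_intros)
  have barrier: "g t \<theta> \<le> - (K t * ((L - \<theta>) / \<theta>) powr \<alpha>)"
    if "0 \<le> t" "t < T1" "0 < \<theta>" "\<theta> < L" for t \<theta>
  proof (rule comparison[OF _ _ _ dK _ that])
    show "continuous_on {0..<T1} K"
      unfolding K_def by (intro continuous_intros continuous_on_subset[OF contI]) auto
    show "0 \<le> K t" for t using K0 by (simp add: K_def)
    show "K 0 \<le> (2 * L) powr - \<alpha>" by (simp add: K_def K0_def I_def)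
    fix t \<theta> assume t: "0 < t" "t < T1" and \<theta>: "0 < \<theta>" "\<theta> < L"
    have "1 / (4 * L * sin (2 * L)) * M t * (\<theta> * (L - \<theta>)) \<le> green L (g t) \<theta>"
      unfolding M_def using t by (intro angular_profile.green_lower[OF prof] neg \<theta>) auto
    then have "2 * \<alpha> * L * K t * (1 / (4 * L * sin (2 * L)) * M t * (\<theta> * (L - \<theta>))) \<le> 2 * \<alpha> * L * K t * green L (g t) \<theta>"
      using \<alpha> L K0 by (intro mult_left_mono) (auto simp: K_def)
    moreover have "2 * \<alpha> * L * K t * (1 / (4 * L * sin (2 * L)) * M t * (\<theta> * (L - \<theta>))) =
        \<kappa> * M t * K t * (\<theta> * (L - \<theta>))"
      unfolding \<kappa>_def using L sin0 by (simp add: field_simps)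
    ultimately show "\<kappa> * M t * K t * (\<theta> * (L - \<theta>)) \<le> 2 * \<alpha> * L * K t * green L (g t) \<theta>" by simp
  qed
  define c where "c = growth_moment L \<alpha>"
  have c: "0 < c" unfolding c_def by (rule growth_moment_pos[OF L \<alpha>])
  have M_ge: "K t * c \<le> M t" if "0 \<le> t" "t < T1" for t
  proof -
    have Kt: "0 \<le> K t" using K0 by (simp add: K_def)
    have "moment L (\<lambda>\<theta>. K t * (- (((L - \<theta>) / \<theta>) powr \<alpha>))) \<le> moment L (g t)"
      using barrier[OF that] that
      by (intro moment_mono[OF prof growth_profile[OF L \<alpha> Kt]]) auto
    then show ?thesis
      by (simp only: moment_scale M_def c_def growth_moment_def)
  qed
  \<comment> \<open>Since \<open>K = K0 exp(\<kappa> I)\<close>, the first summand is \<open>K0 / K\<close>; it decreases at a rate of at least \<open>K0 \<kappa> c\<close> and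
    stays positive.\<close>
  define N where "N t = exp (- \<kappa> * I t) + K0 * \<kappa> * c * t" for t
  have "N T' \<le> N 0"
  proof (rule DERIV_nonpos_imp_decreasing_open[of 0 T' N])
    show "0 \<le> T'" using T' by simp
    show "continuous_on {0..T'} N"
      unfolding N_def using T1 by (intro continuous_intros continuous_on_subset[OF contI]) auto
    fix t assume t: "0 < t" "t < T'"
    have "(N has_real_derivative - \<kappa> * M t * exp (- \<kappa> * I t) + K0 * \<kappa> * c) (at t)"
      unfolding N_def using dI[of t] t T1 by (auto intro!: derivative_eq_intros)
    moreover have "K0 * c \<le> M t * exp (- \<kappa> * I t)"
    proof -
      have "K t * c * exp (- \<kappa> * I t) \<le> M t * exp (- \<kappa> * I t)"
        using M_ge[of t] t T1 by (intro mult_right_mono) auto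
      moreover have "K t * c * exp (- \<kappa> * I t) = K0 * c"
        by (simp add: K_def exp_minus)
      ultimately show ?thesis by linarith
    qed
    then have "\<kappa> * (K0 * c) \<le> \<kappa> * (M t * exp (- \<kappa> * I t))"
      using \<kappa> by (intro mult_left_mono) auto
    then have "- \<kappa> * M t * exp (- \<kappa> * I t) + K0 * \<kappa> * c \<le> 0"
      by (simp add: mult_ac)
    ultimately show "\<exists>y. (N has_real_derivative y) (at t) \<and> y \<le> 0" by blast
  qed
  moreover have "0 < exp (- \<kappa> * I T')" by simp
  moreover have "N 0 = 1" by (simp add: N_def I_def)
  moreover have "N T' = exp (- \<kappa> * I T') + K0 * \<kappa> * c * T'" by (simp add: N_def)
  ultimately have "K0 * \<kappa> * c * T' \<le> 1" by linarith
  then have "T' \<le> 1 / (K0 * \<kappa> * c)"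
    using K0 \<kappa> c by (simp add: pos_le_divide_eq mult.commute)
  then show ?thesis
    by (simp add: lifespan_bound_def K0_def \<kappa>_def c_def L_def)
qed

theorem mainTheorem3:
  fixes m :: nat and \<alpha> :: real
  assumes "m \<ge> 3" and "0 < \<alpha>" and "\<alpha> < 1"
  shows "max_existence_time m \<alpha> (initial_vorticity m \<alpha>) < \<infinity>"
proof -
  have "max_existence_time m \<alpha> (initial_vorticity m \<alpha>) \<le> ennreal (lifespan_bound (pi / real m) \<alpha>)"
    unfolding max_existence_time_def
  proof (rule Sup_least, clarify)
    fix T \<omega> assume T: "T > 0" "euler_solution m \<alpha> (initial_vorticity m \<alpha>) T \<omega>"
    have "T \<le> lifespan_bound (pi / real m) \<alpha>"
      using T(1) solution_time_bound[OF assms T(2)] by (intro dense_le_bounded[of 0 T]) auto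
    then show "ennreal T \<le> ennreal (lifespan_bound (pi / real m) \<alpha>)"
      by (rule ennreal_leI)
  qed
  also have "\<dots> < \<infinity>" by simp
  finally show ?thesis .
qed

end
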